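(* Let $\mathcal C_<:=\mathcal C_2\cap F$ and $\mathcal C_>:=\mathcal C_3\cap F$. Then: (1) each of $\mathcal C_<\setminus\partial\mathcal C_<$ and $\mathcal C_>\setminus\partial\mathcal C_>$ is a smooth curve in $F$, with $\partial\mathcal C_<=\{\tilde\tau_<,\tfrac14+i\infty\}$ and $\partial\mathcal C_>=\{\tilde\tau_>,\tfrac34+i\infty\}$ for some $\tilde\tau_<,\tilde\tau_>\in\partial F$; (2) letting $\mathcal D\subset F$ be the set of points of $F$ obtained by transforming the critical points of $E_6$ in $\mathbb H$ into $F$ via Möbius transformations of elements of $SL(2,\mathbb Z)$, $\mathcal D$ is a dense subset of $\mathcal C_<\cup\mathcal C_>$; precisely, $$\mathcal D\subset\mathcal C_<\cup\mathcal C_>=\overline{\mathcal D}\cap F=\overline{\mathcal D}\setminus\{\infty\}.$$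
   Context: For $\tau\in\mathbb H$ (upper half-plane) let $g_2(\tau)=60\sum_{(m,n)\ne(0,0)}(m\tau+n)^{-4}$, $g_3(\tau)=140\sum_{(m,n)\ne(0,0)}(m\tau+n)^{-6}$, $E_6=\frac{27}{8\pi^6}g_3$, and $\eta_1(\tau)=2\zeta(\tfrac12;\tau)$ where $\zeta(z;\tau)$ is the Weierstrass zeta function of the lattice $\mathbb Z+\mathbb Z\tau$. Let $\phi(\tau)=\tau+\frac{36\pi i\, g_3(\tau)}{g_2(\tau)^2-18\eta_1(\tau)g_3(\tau)}$ (meromorphic on $\mathbb H$). Let $F_0=\{\tau\in\mathbb H:0\le\operatorname{Re}\tau\le1,|\tau-\frac12|\ge\frac12\}$ and $F=\{\tau\in\mathbb H:0\le\operatorname{Re}\tau\le1,|\tau|\ge1,|\tau-1|\ge1\}$. Define $\mathcal C_2=\{\tau\in F_0:\operatorname{Re}\tau<\tfrac12,\ \phi(\tau)\in(0,+\infty)\}$ and $\mathcal C_3=\{\tau\in F_0:\operatorname{Re}\tau>\tfrac12,\ \phi(\tau)\in(-\infty,1)\}$. An endpoint $a+i\infty$ means that along that end $\operatorname{Im}\tau\to+\infty$ and $\operatorname{Re}\tau\to a$. Closures are taken in $\mathbb H\cup\mathbb R\cup\{\infty\}$. *)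

theory Defs
  imports "HOL-Analysis.Analysis"
begin

definition upper_half_plane :: "complex set" (\<open>\<H>\<close>) where
  "\<H> = {\<tau>. Im \<tau> > 0}"

subsection \<open>Eisenstein series, the Weierstrass zeta function and \<open>\<phi>\<close>\<close>

abbreviation lattice_pt :: "complex \<Rightarrow> int \<Rightarrow> int \<Rightarrow> complex" where
  "lattice_pt \<tau> m n \<equiv> of_int m * \<tau> + of_int n"

text \<open>All the lattice sums below converge absolutely for \<open>\<tau> \<in> \<H>\<close>
  (in the zeta sum: for \<open>z\<close> outside the lattice), so that the unordered sum
  \<open>infsum\<close> is the intended value.\<close>

definition g2 :: "complex \<Rightarrow> complex" where
  "g2 \<tau> = 60 * (\<Sum>\<^sub>\<infinity>(m, n)\<in>UNIV - {(0, 0)}. 1 / lattice_pt \<tau> m n ^ 4)"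

definition g3 :: "complex \<Rightarrow> complex" where
  "g3 \<tau> = 140 * (\<Sum>\<^sub>\<infinity>(m, n)\<in>UNIV - {(0, 0)}. 1 / lattice_pt \<tau> m n ^ 6)"

definition E6 :: "complex \<Rightarrow> complex" where
  "E6 \<tau> = 27 / (8 * of_real pi ^ 6) * g3 \<tau>"

definition weierstrass_zeta :: "complex \<Rightarrow> complex \<Rightarrow> complex" where
  "weierstrass_zeta z \<tau> = 1 / z +
     (\<Sum>\<^sub>\<infinity>(m, n)\<in>UNIV - {(0, 0)}.
        1 / (z - lattice_pt \<tau> m n) + 1 / lattice_pt \<tau> m n + z / lattice_pt \<tau> m n ^ 2)"

definition eta1 :: "complex \<Rightarrow> complex" where
  "eta1 \<tau> = 2 * weierstrass_zeta (1 / 2) \<tau>"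

text \<open>The meromorphic function \<open>\<phi>\<close> has its poles in \<open>\<H>\<close> exactly at the zeros of the
  denominator: if the numerator vanished there as well, then \<open>g\<^sub>2 = g\<^sub>3 = 0\<close>, contradicting
  \<open>g\<^sub>2\<^sup>3 \<noteq> 27 g\<^sub>3\<^sup>2\<close>. At a pole, division by zero makes \<open>phi \<tau> = \<tau>\<close>, which is not real;
  so, as required of the value \<open>\<infinity>\<close>, poles belong neither to \<open>C2\<close> nor to \<open>C3\<close> below.\<close>

definition phi :: "complex \<Rightarrow> complex" where
  "phi \<tau> = \<tau> + 36 * of_real pi * \<i> * g3 \<tau> / (g2 \<tau> ^ 2 - 18 * eta1 \<tau> * g3 \<tau>)"

subsection \<open>Domains, curves and transformed critical points\<close>

definition F0_dom :: "complex set" where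
  "F0_dom = {\<tau>\<in>\<H>. 0 \<le> Re \<tau> \<and> Re \<tau> \<le> 1 \<and> cmod (\<tau> - 1 / 2) \<ge> 1 / 2}"

definition F_dom :: "complex set" where
  "F_dom = {\<tau>\<in>\<H>. 0 \<le> Re \<tau> \<and> Re \<tau> \<le> 1 \<and> cmod \<tau> \<ge> 1 \<and> cmod (\<tau> - 1) \<ge> 1}"

definition C2 :: "complex set" where
  "C2 = {\<tau>\<in>F0_dom. Re \<tau> < 1 / 2 \<and> phi \<tau> \<in> of_real ` {0 <..}}"

definition C3 :: "complex set" where
  "C3 = {\<tau>\<in>F0_dom. Re \<tau> > 1 / 2 \<and> phi \<tau> \<in> of_real ` {..< 1}}"

definition C_lt :: "complex set" where
  "C_lt = C2 \<inter> F_dom"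

definition C_gt :: "complex set" where
  "C_gt = C3 \<inter> F_dom"

definition D_set :: "complex set" where
  "D_set = {\<tau>\<in>F_dom. \<exists>z\<in>\<H>. deriv E6 z = 0 \<and>
     (\<exists>a b c d :: int. a * d - b * c = 1 \<and>
        \<tau> = (of_int a * z + of_int b) / (of_int c * z + of_int d))}"

subsection \<open>Smooth curves with prescribed ends\<close>

definition smooth_on_open :: "real set \<Rightarrow> (real \<Rightarrow> complex) \<Rightarrow> bool" where
  "smooth_on_open S \<gamma> \<longleftrightarrow>
     (\<forall>k. \<forall>t\<in>S. ((\<lambda>f s. vector_derivative f (at s)) ^^ k) \<gamma> differentiable (at t))"

text \<open>\<open>Vertical a\<close> stands for the end \<open>a + i\<infinity>\<close>.\<close>

datatype curve_end = Point complex | Vertical real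

fun tends_to_end :: "(real \<Rightarrow> complex) \<Rightarrow> real filter \<Rightarrow> curve_end \<Rightarrow> bool" where
  "tends_to_end \<gamma> G (Point p) \<longleftrightarrow> (\<gamma> \<longlongrightarrow> p) G"
| "tends_to_end \<gamma> G (Vertical a) \<longleftrightarrow>
     filterlim (\<lambda>t. Im (\<gamma> t)) at_top G \<and> ((\<lambda>t. Re (\<gamma> t)) \<longlongrightarrow> a) G"

text \<open>\<open>C\<close> without its two ends \<open>e\<^sub>1, e\<^sub>2\<close> is a smooth curve running from \<open>e\<^sub>1\<close> to \<open>e\<^sub>2\<close>:
  the injective image of a regular \<open>C\<^sup>\<infinity>\<close> parametrization of \<open>(0,1)\<close>.
  Since the limits at the two ends do not lie on the image, the parametrization is
  automatically a homeomorphism onto it.\<close>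

definition smooth_curve_with_ends :: "complex set \<Rightarrow> curve_end \<Rightarrow> curve_end \<Rightarrow> bool" where
  "smooth_curve_with_ends C e1 e2 \<longleftrightarrow>
     (\<exists>\<gamma> :: real \<Rightarrow> complex.
        C - {z. Point z \<in> {e1, e2}} = \<gamma> ` {0<..<1} \<and>
        inj_on \<gamma> {0<..<1} \<and>
        smooth_on_open {0<..<1} \<gamma> \<and>
        (\<forall>t\<in>{0<..<1}. vector_derivative \<gamma> (at t) \<noteq> 0) \<and>
        tends_to_end \<gamma> (at_right 0) e1 \<and>
        tends_to_end \<gamma> (at_left 1) e2)"

subsection \<open>Closures in \<open>\<H> \<union> \<real> \<union> {\<infinity>}\<close>\<close>

text \<open>\<open>\<H> \<union> \<real> \<union> {\<infinity>}\<close>, as a subspace of the Riemann sphere, is the one-point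
  compactification of the closed upper half-plane; \<open>None\<close> is the point \<open>\<infinity>\<close>.\<close>

definition closed_half_plane_compact :: "complex option topology" where
  "closed_half_plane_compact = Alexandroff_compactification (top_of_set {\<tau>. Im \<tau> \<ge> 0})"

definition closure_H :: "complex set \<Rightarrow> complex option set" where
  "closure_H A = closed_half_plane_compact closure_of (Some ` A)"

end

theory Submission
  imports Defs "HOL-Complex_Analysis.Complex_Analysis" "HOL-Real_Asymp.Real_Asymp"
begin

text \<open>
  Ramanujan's formula for the derivative of \<open>E\<^sub>6\<close> gives \<open>\<phi> = \<tau> + 6 E\<^sub>6 / E\<^sub>6'\<close>; it holds because the
  difference of its two sides is a cusp form of weight 8. So \<open>\<phi>\<close> commutes with \<open>SL(2, \<int>)\<close>, and a
  Moebius image of \<open>\<tau>\<close> is critical for \<open>E\<^sub>6\<close> iff the matrix sends \<open>\<phi>(\<tau>)\<close> to infinity. On \<open>F\<close> there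
  are no critical points, hence \<open>D = {\<tau> \<in> F. \<phi>(\<tau>) \<in> \<rat>}\<close>.

  In the nome, \<open>\<phi> = \<tau> + \<i>/(168\<pi>) (1/q - 570 + 20256 q + O(q\<^sup>2))\<close>, and \<open>\<bar>q\<bar> \<le> 1/227\<close> on \<open>F\<close>. Explicit bounds
  for the remainder show that \<open>Im \<phi>'\<close> is negative for \<open>0 < Re \<tau> < 1/2\<close> and \<open>Im \<tau> \<ge> 19/20\<close>. Thus on each
  horizontal line \<open>Im \<phi>\<close> decreases, from a positive to a negative value, and has a single zero: the
  real locus of \<open>\<phi>\<close> in this strip is a graph over \<open>Im \<tau>\<close>. Since \<open>\<phi>\<close> is injective there, its
  holomorphic inverse parametrizes the graph by the value of \<open>\<phi>\<close>, which increases along the graph;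
  so the points with rational value are dense. The reflection \<open>\<tau> \<mapsto> 1 - cnj \<tau>\<close> exchanges the halves
  of \<open>F\<close>.
\<close>

subsection \<open>Power series in the nome\<close>

text \<open>Two defects cancel in Ramanujan's formula: \<open>eta1\<close> is the Eisenstein series
  of weight 2, which acquires the term -2 pi i tau under inversion, and the derivative of
  \<open>E6\<close> acquires a multiple of \<open>E6\<close>. Both enter as multiples of
  \<open>g3\<close>. The constant terms in q cancel as well. The estimates must survive near Re tau
  = 0 and Re tau = 1/2, where the leading term of Im phi', a multiple of sin(2 pi Re tau), tends to
  0. An absolute bound for the remainder would be useless there. But all coefficients in q are real,
  so the imaginary part of the remainder is bounded by a multiple of |Im q|, hence of the same sine.
  The corner (1 + i sqrt 3) / 2 of F lies below the height 19/20 at which these estimates start.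
  Points of F below that height have Re tau between 1/4 and 3/4, and in that range the constant -570
  alone decides the sign of Im phi. The height is chosen below sqrt 15 / 4, where the unit circle
  meets Re tau = 1/4.\<close>

lemma has_sum_int_split:
  fixes f :: "int \<Rightarrow> 'a::{topological_comm_monoid_add}"
  assumes "((\<lambda>n. f (int n)) has_sum a) UNIV" "((\<lambda>n. f (- int (Suc n))) has_sum b) UNIV"
  shows "(f has_sum (a + b)) UNIV"
proof -
  have 1: "bij_betw int UNIV {0..}"
    by (rule bij_betwI[where g = nat]) auto
  have 2: "bij_betw (\<lambda>n. - int (Suc n)) UNIV {..<0}"
    by (rule bij_betwI[where g = "\<lambda>k. nat (- k - 1)"]) auto
  have "(f has_sum a) {0..}"
    using assms(1) has_sum_reindex_bij_betw[OF 1, of f a] by simp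
  moreover have "(f has_sum b) {..<0}"
    using assms(2) has_sum_reindex_bij_betw[OF 2, of f b] by simp
  ultimately have "(f has_sum (a + b)) ({0..} \<union> {..<0})"
    by (rule has_sum_Un_disjoint) auto
  also have "{0..} \<union> {..<0} = (UNIV :: int set)" by auto
  finally show ?thesis .
qed

text \<open>Convergence is asked for on the whole unit disc, which is the range of the nome on the
  upper half-plane completed by the cusp q = 0.\<close>

definition unit_series :: "(nat \<Rightarrow> complex) \<Rightarrow> bool" where
  "unit_series c \<longleftrightarrow> (\<forall>q. norm q < 1 \<longrightarrow> summable (\<lambda>n. c n * q ^ n))"

definition pser :: "(nat \<Rightarrow> complex) \<Rightarrow> complex \<Rightarrow> complex" where
  "pser c q = (\<Sum>n. c n * q ^ n)"

lemma unit_series_abs_summable: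
  assumes "unit_series c" "norm q < 1"
  shows "summable (\<lambda>n. norm (c n * q ^ n))"
proof -
  obtain r where r: "norm q < r" "r < 1" using assms(2) dense by blast
  have "norm (of_real r :: complex) < 1" "norm q < norm (of_real r :: complex)"
    using r norm_ge_zero[of q] by (auto simp del: norm_ge_zero)
  thus ?thesis using assms(1) powser_insidea unfolding unit_series_def by blast
qed

lemma unit_series_sums: "unit_series c \<Longrightarrow> norm q < 1 \<Longrightarrow> (\<lambda>n. c n * q ^ n) sums pser c q"
  by (simp add: pser_def unit_series_def summable_sums)

lemma unit_series_mult_of_nat:
  assumes "unit_series c"
  shows "unit_series (\<lambda>n. of_nat n * c n)"
  unfolding unit_series_def
proof safe
  fix q :: complex assume q: "norm q < 1"
  have "summable (\<lambda>n. diffs c n * q ^ n)"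
    by (rule termdiff_converges[OF q]) (use assms in \<open>auto simp: unit_series_def\<close>)
  hence "summable (\<lambda>n. of_nat (Suc n) * c (Suc n) * q ^ n * q)"
    by (intro summable_mult2) (simp add: diffs_def)
  hence "summable (\<lambda>n. of_nat (Suc n) * c (Suc n) * q ^ Suc n)"
    by (simp add: mult_ac)
  thus "summable (\<lambda>n. of_nat n * c n * q ^ n)"
    using summable_iff_shift[of "\<lambda>n. of_nat n * c n * q ^ n" 1] by simp
qed

text \<open>The conclusion is phrased for q d/dq, which is d/dtau up to the factor 2 pi i; it
  multiplies the n-th coefficient by n without shifting indices. The product \<open>q * d\<close>
  avoids a division at q = 0.\<close>

lemma has_field_derivative_pser:
  assumes "unit_series c" "norm q < 1"
  shows "\<exists>d. (pser c has_field_derivative d) (at q) \<and> q * d = pser (\<lambda>n. of_nat n * c n) q"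
proof -
  obtain r where r: "norm q < r" "r < 1" using assms(2) dense by blast
  hence r': "norm (of_real r :: complex) < 1" "norm q < norm (of_real r :: complex)"
    using norm_ge_zero[of q] by (auto simp del: norm_ge_zero)
  have "((\<lambda>x. \<Sum>n. c n * x ^ n) has_field_derivative (\<Sum>n. diffs c n * q ^ n)) (at q)"
    by (rule termdiffs_strong[of _ "of_real r"]) (use r' assms in \<open>auto simp: unit_series_def\<close>)
  moreover have "q * (\<Sum>n. diffs c n * q ^ n) = pser (\<lambda>n. of_nat n * c n) q"
  proof -
    have sm: "summable (\<lambda>n. diffs c n * q ^ n)"
      by (rule termdiff_converges[OF assms(2)]) (use assms in \<open>auto simp: unit_series_def\<close>)
    have "q * (\<Sum>n. diffs c n * q ^ n) = (\<Sum>n. q * (diffs c n * q ^ n))"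
      by (rule suminf_mult[symmetric, OF sm])
    also have "\<dots> = (\<Sum>n. of_nat (Suc n) * c (Suc n) * q ^ Suc n)"
      by (simp add: diffs_def mult_ac)
    also have "\<dots> = (\<Sum>n. of_nat n * c n * q ^ n)"
      using unit_series_mult_of_nat[OF assms(1)] assms(2)
      by (subst suminf_split_head) (auto simp: unit_series_def)
    finally show ?thesis by (simp add: pser_def)
  qed
  ultimately show ?thesis unfolding pser_def by blast
qed

lemma holomorphic_pser: "unit_series c \<Longrightarrow> pser c holomorphic_on ball 0 1"
  using has_field_derivative_pser unfolding holomorphic_on_open[OF open_ball]
  by (metis dist_0_norm mem_ball)

lemma unit_series_one: "unit_series (\<lambda>_. 1)"
  by (auto simp: unit_series_def intro: summable_geometric)

lemma unit_series_power: "unit_series (\<lambda>n. of_nat n ^ k)"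
proof (induction k)
  case 0 show ?case using unit_series_one by simp
next
  case (Suc k) thus ?case using unit_series_mult_of_nat[OF Suc] by simp
qed

lemma unit_series_comparison:
  assumes "unit_series b" "\<And>n. norm (c n) \<le> norm (b n)"
  shows "unit_series c"
  unfolding unit_series_def
proof safe
  fix q :: complex assume "norm q < 1"
  from unit_series_abs_summable[OF assms(1) this]
  show "summable (\<lambda>n. c n * q ^ n)"
    by (rule summable_comparison_test'[where N = 0])
       (auto simp: norm_mult assms(2) intro: mult_right_mono)
qed

definition nome :: "complex \<Rightarrow> complex" where
  "nome z = exp (2 * of_real pi * \<i> * z)"

lemma norm_nome: "norm (nome z) = exp (- 2 * pi * Im z)"
  by (simp add: nome_def norm_exp_eq_Re)

lemma norm_nome_less_1: "Im z > 0 \<Longrightarrow> norm (nome z) < 1"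
  by (simp add: norm_nome mult_pos_pos)

lemma nome_nonzero [simp]: "nome z \<noteq> 0"
  by (simp add: nome_def)

lemma has_field_derivative_nome:
  "(nome has_field_derivative 2 * of_real pi * \<i> * nome z) (at z)"
  unfolding nome_def[abs_def] by (auto intro!: derivative_eq_intros)

lemma nome_plus_1: "nome (z + 1) = nome z"
  by (simp add: nome_def ring_distribs exp_add)

lemma has_field_derivative_pser_nome:
  assumes "unit_series c" "Im z > 0"
  shows "((\<lambda>z. pser c (nome z)) has_field_derivative
            2 * of_real pi * \<i> * pser (\<lambda>n. of_nat n * c n) (nome z)) (at z)"
proof -
  obtain d where d: "(pser c has_field_derivative d) (at (nome z))"
      "nome z * d = pser (\<lambda>n. of_nat n * c n) (nome z)"
    using has_field_derivative_pser[OF assms(1)] norm_nome_less_1[OF assms(2)] by blast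
  have "((\<lambda>z. pser c (nome z)) has_field_derivative d * (2 * of_real pi * \<i> * nome z)) (at z)"
    by (rule DERIV_chain2[OF d(1) has_field_derivative_nome])
  also have "d * (2 * of_real pi * \<i> * nome z) = 2 * of_real pi * \<i> * (nome z * d)"
    by (simp add: mult_ac)
  finally show ?thesis unfolding d(2) .
qed

subsection \<open>Bilateral sums and the Lipschitz formula\<close>

text \<open>Both sides of the reflection formula for \<open>rGamma\<close> are differentiated;
  dividing the result by the formula itself leaves the cotangent.\<close>

lemma Digamma_reflection:
  assumes "(z :: complex) \<notin> \<int>"
  shows "Digamma (1 - z) - Digamma z = of_real pi * cot (of_real pi * z)"
proof -
  have z1: "z \<notin> \<int>\<^sub>\<le>\<^sub>0" "1 - z \<notin> \<int>\<^sub>\<le>\<^sub>0"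
    using assms nonpos_Ints_subset_Ints by (auto dest!: nonpos_Ints_Int)
  have "((\<lambda>z. rGamma z * rGamma (1 - z)) has_field_derivative
      rGamma z * rGamma (1 - z) * (Digamma (1 - z) - Digamma z)) (at z)"
    using z1 by (auto intro!: derivative_eq_intros simp: algebra_simps)
  moreover have "((\<lambda>z. sin (of_real pi * z) / of_real pi) has_field_derivative cos (of_real pi * z)) (at z)"
    by (auto intro!: derivative_eq_intros)
  moreover have "(\<lambda>z::complex. rGamma z * rGamma (1 - z)) = (\<lambda>z. sin (of_real pi * z) / of_real pi)"
    by (rule ext) (rule rGamma_reflection_complex)
  ultimately have "rGamma z * rGamma (1 - z) * (Digamma (1 - z) - Digamma z) = cos (of_real pi * z)"
    using DERIV_unique by metis
  moreover have "rGamma z * rGamma (1 - z) \<noteq> 0"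
    using z1 by (simp add: rGamma_eq_zero_iff)
  ultimately show ?thesis
    unfolding rGamma_reflection_complex by (simp add: cot_def field_simps)
qed

lemma abs_summable_inverse_shift:
  fixes z :: complex
  assumes "k \<ge> 2"
  shows "summable (\<lambda>n. norm (1 / (z + of_nat n) ^ k))"
proof (rule summable_comparison_test_ev)
  have "eventually (\<lambda>n. real n \<ge> 2 * norm z + 1) sequentially"
    using eventually_ge_at_top[of "nat \<lceil>2 * norm z + 1\<rceil>"] by eventually_elim linarith
  thus "\<forall>\<^sub>F n in sequentially. norm (norm (1 / (z + of_nat n) ^ k)) \<le> 2 ^ k * inverse (real n ^ k)"
  proof eventually_elim
    case (elim n)
    have "norm (z + of_nat n) \<ge> real n - norm z"
      using norm_diff_ineq[of "of_nat n" z] by (simp add: add.commute)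
    hence "norm (z + of_nat n) \<ge> real n / 2" using elim by simp
    hence "norm (z + of_nat n) ^ k \<ge> (real n / 2) ^ k" by (intro power_mono) auto
    moreover have "real n > 0" using elim norm_ge_zero[of z] by linarith
    ultimately have "inverse (norm (z + of_nat n) ^ k) \<le> inverse ((real n / 2) ^ k)"
      by (intro le_imp_inverse_le) auto
    also have "\<dots> = 2 ^ k * inverse (real n ^ k)"
      by (simp add: power_divide field_simps)
    finally show ?case by (simp add: norm_divide norm_power inverse_eq_divide)
  qed
  show "summable (\<lambda>n. 2 ^ k * inverse (real n ^ k))"
    by (intro summable_mult inverse_power_summable assms)
qed

text \<open>Single reciprocals are not summable, but the difference is (b - a) / ((a + n)(b + n)),
  of order n^(-2). The regularizing terms 1/(n+1) and the Euler constants of the two Digamma series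
  cancel.\<close>

lemma has_sum_inverse_diff_nat:
  assumes "(a :: complex) \<notin> \<int>\<^sub>\<le>\<^sub>0" "b \<notin> \<int>\<^sub>\<le>\<^sub>0"
  shows "((\<lambda>n. 1 / (a + of_nat n) - 1 / (b + of_nat n)) has_sum (Digamma b - Digamma a)) UNIV"
proof (rule norm_summable_imp_has_sum)
  have nz: "a + of_nat n \<noteq> 0" "b + of_nat n \<noteq> 0" for n
    using assms by (auto simp: plus_of_nat_eq_0_imp)
  have "(\<lambda>n. (inverse (of_nat (Suc n)) - inverse (b + of_nat n)) -
          (inverse (of_nat (Suc n)) - inverse (a + of_nat n))) sums
          ((Digamma b + euler_mascheroni) - (Digamma a + euler_mascheroni))"
    using nz[of 0] unfolding Digamma_def
    by (intro sums_diff) (auto intro!: summable_sums[OF summable_Digamma] simp del: of_nat_Suc)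
  thus "(\<lambda>n. 1 / (a + of_nat n) - 1 / (b + of_nat n)) sums (Digamma b - Digamma a)"
    by (simp add: field_simps)
  show "summable (\<lambda>n. norm (1 / (a + of_nat n) - 1 / (b + of_nat n)))"
  proof (rule summable_comparison_test'[where N = 0])
    show "summable (\<lambda>n. norm (b - a) * (norm (1 / (a + of_nat n)^2) + norm (1 / (b + of_nat n)^2)))"
      by (intro summable_mult summable_add abs_summable_inverse_shift) auto
    fix n
    have "1 / (a + of_nat n) - 1 / (b + of_nat n) = (b - a) * (1 / (a + of_nat n) * (1 / (b + of_nat n)))"
      using nz[of n] by (simp add: field_simps)
    hence "norm (1 / (a + of_nat n) - 1 / (b + of_nat n)) =
        norm (b - a) * (norm (1 / (a + of_nat n)) * norm (1 / (b + of_nat n)))"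
      by (simp only: norm_mult)
    also have "norm (1 / (a + of_nat n)) * norm (1 / (b + of_nat n)) \<le>
        norm (1 / (a + of_nat n))^2 + norm (1 / (b + of_nat n))^2"
    proof -
      have "x * y \<le> x\<^sup>2 + y\<^sup>2" if "x \<ge> 0" "y \<ge> 0" for x y :: real
        using sum_squares_bound[of x y] mult_nonneg_nonneg[OF that] by linarith
      thus ?thesis by simp
    qed
    finally show "norm (norm (1 / (a + of_nat n) - 1 / (b + of_nat n))) \<le>
        norm (b - a) * (norm (1 / (a + of_nat n)^2) + norm (1 / (b + of_nat n)^2))"
      by (simp add: norm_divide norm_power power_divide mult_left_mono)
  qed
qed

text \<open>Only a difference of two cotangents is expanded, because the bilateral series of 1/(a +
  n) is not unconditionally summable. Nonnegative n contribute Digamma at a and b, negative n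
  Digamma at 1 - a and 1 - b; the reflection formula joins them.\<close>

lemma cot_partial_fractions:
  assumes "(a :: complex) \<notin> \<int>" "b \<notin> \<int>"
  shows "((\<lambda>n::int. 1 / (a + of_int n) - 1 / (b + of_int n)) has_sum
            (of_real pi * cot (of_real pi * a) - of_real pi * cot (of_real pi * b))) UNIV"
proof -
  have ni: "a \<notin> \<int>\<^sub>\<le>\<^sub>0" "b \<notin> \<int>\<^sub>\<le>\<^sub>0" "1 - a \<notin> \<int>\<^sub>\<le>\<^sub>0" "1 - b \<notin> \<int>\<^sub>\<le>\<^sub>0"
    using assms nonpos_Ints_subset_Ints by (auto dest!: nonpos_Ints_Int)
  have "((\<lambda>n::int. 1 / (a + of_int n) - 1 / (b + of_int n)) has_sum
     ((Digamma b - Digamma a) + (Digamma (1 - a) - Digamma (1 - b)))) UNIV"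
  proof (rule has_sum_int_split)
    show "((\<lambda>n. 1 / (a + of_int (int n)) - 1 / (b + of_int (int n))) has_sum (Digamma b - Digamma a)) UNIV"
      using has_sum_inverse_diff_nat[OF ni(1,2)] by simp
    have "1 / (a + of_int (- int (Suc n))) - 1 / (b + of_int (- int (Suc n))) =
       1 / (1 - b + of_nat n) - 1 / (1 - a + of_nat n)" for n
    proof -
      have "a + of_int (- int (Suc n)) = - (1 - a + of_nat n)" "b + of_int (- int (Suc n)) = - (1 - b + of_nat n)"
        by simp_all
      thus ?thesis by (simp only: divide_minus_right)  simp
    qed
    thus "((\<lambda>n. 1 / (a + of_int (- int (Suc n))) - 1 / (b + of_int (- int (Suc n)))) has_sum
             (Digamma (1 - a) - Digamma (1 - b))) UNIV"
      using has_sum_inverse_diff_nat[OF ni(4,3)] by (simp only:)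
  qed
  also have "(Digamma b - Digamma a) + (Digamma (1 - a) - Digamma (1 - b)) =
      (Digamma (1 - a) - Digamma a) - (Digamma (1 - b) - Digamma b)" by simp
  also have "\<dots> = of_real pi * cot (of_real pi * a) - of_real pi * cot (of_real pi * b)"
    by (simp only: Digamma_reflection[OF assms(1)] Digamma_reflection[OF assms(2)])
  finally show ?thesis .
qed

text \<open>Index 0 is set apart because of 0^0 = 1: for k = 0 the series has to be q / (1 -
  q).\<close>

definition pow_coeff :: "nat \<Rightarrow> nat \<Rightarrow> complex" where
  "pow_coeff k n = (if n = 0 then 0 else of_nat n ^ k)"

lemma unit_series_pow_coeff: "unit_series (pow_coeff k)"
  by (rule unit_series_comparison[OF unit_series_power[of k]]) (auto simp: pow_coeff_def)

lemma pi_cot_nome: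
  assumes "Im z > 0"
  shows "of_real pi * cot (of_real pi * z) = - of_real pi * \<i> - 2 * of_real pi * \<i> * pser (pow_coeff 0) (nome z)"
proof -
  define q where "q = nome z"
  have q: "norm q < 1" "q \<noteq> 0" "q \<noteq> 1" using norm_nome_less_1[OF assms] by (auto simp: q_def)
  have "pser (pow_coeff 0) q = q / (1 - q)"
  proof -
    have "(\<lambda>n. q ^ n) sums (1 / (1 - q))" by (rule geometric_sums) fact
    hence "(\<lambda>n. q * q ^ n) sums (q * (1 / (1 - q)))" by (rule sums_mult)
    hence "(\<lambda>n. pow_coeff 0 (Suc n) * q ^ Suc n) sums (q / (1 - q))"
      by (simp add: pow_coeff_def)
    hence "(\<lambda>n. pow_coeff 0 n * q ^ n) sums (q / (1 - q))"
      by (subst (asm) sums_Suc_iff) (simp add: pow_coeff_def)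
    thus ?thesis by (simp add: pser_def sums_iff)
  qed
  moreover have "cot (of_real pi * z) = \<i> * (q + 1) / (q - 1)"
  proof -
    define e where "e = exp (\<i> * (of_real pi * z))"
    have e: "e \<noteq> 0" "q = e * e"
      by (auto simp: e_def q_def nome_def mult_exp_exp algebra_simps)
    have "cot (of_real pi * z) = ((e + inverse e) / 2) / ((e - inverse e) / (2 * \<i>))"
      by (simp add: cot_def cos_exp_eq sin_exp_eq e_def exp_minus)
    also have "\<dots> = \<i> * (q + 1) / (q - 1)"
      using e q by (simp add: field_simps)
    finally show ?thesis .
  qed
  ultimately show ?thesis
    unfolding q_def[symmetric]
  proof -
    assume 1: "pser (pow_coeff 0) q = q / (1 - q)" and 2: "cot (of_real pi * z) = \<i> * (q + 1) / (q - 1)"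
    have "\<i> * (q + 1) / (q - 1) = - \<i> - 2 * \<i> * (q / (1 - q))"
      using q by (simp add: divide_simps) (simp add: algebra_simps)
    thus "of_real pi * cot (of_real pi * z) = - of_real pi * \<i> - 2 * of_real pi * \<i> * pser (pow_coeff 0) q"
      unfolding 1 2 by (simp only: right_diff_distrib mult_minus_left mult_minus_right mult_ac)
  qed
qed

text \<open>The k-th derivative of pi cot(pi z), written through the reflection formula. In this
  form the bilateral sum over (z + n)^(-k-1) is immediate from the two Polygamma series.\<close>

definition polygamma_refl :: "nat \<Rightarrow> complex \<Rightarrow> complex" where
  "polygamma_refl k z = (-1) ^ k * Polygamma k (1 - z) - Polygamma k z"

lemma polygamma_refl_0: "z \<notin> \<int> \<Longrightarrow> polygamma_refl 0 z = of_real pi * cot (of_real pi * z)"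
  by (simp add: polygamma_refl_def Digamma_reflection)

lemma has_field_derivative_polygamma_refl:
  assumes "z \<notin> \<int>"
  shows "(polygamma_refl k has_field_derivative polygamma_refl (Suc k) z) (at z)"
proof -
  have "z \<notin> \<int>\<^sub>\<le>\<^sub>0" "1 - z \<notin> \<int>\<^sub>\<le>\<^sub>0"
    using assms nonpos_Ints_subset_Ints by (auto dest!: nonpos_Ints_Int)
  thus ?thesis unfolding polygamma_refl_def[abs_def]
    by (auto intro!: derivative_eq_intros DERIV_chain2[OF has_field_derivative_Polygamma])
qed

lemma Im_pos_not_Ints: "Im z > 0 \<Longrightarrow> z \<notin> \<int>"
  by (auto elim!: Ints_cases)

text \<open>Both sides are differentiated in z: every step multiplies the series by 2 pi i and its
  n-th coefficient by n. The constant -pi i is lost at the first step.\<close>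

lemma polygamma_refl_nome:
  assumes "Im z > 0"
  shows "polygamma_refl k z = (if k = 0 then - of_real pi * \<i> else 0) -
           (2 * of_real pi * \<i>) ^ Suc k * pser (pow_coeff k) (nome z)"
  using assms
proof (induction k arbitrary: z)
  case 0
  thus ?case by (simp add: polygamma_refl_0 Im_pos_not_Ints pi_cot_nome)
next
  case (Suc k)
  have op: "open {z. Im z > 0}" by (simp add: open_halfspace_Im_gt)
  have eq: "(\<lambda>n. of_nat n * pow_coeff k n) = pow_coeff (Suc k)"
    by (auto simp: pow_coeff_def fun_eq_iff)
  have "((\<lambda>z. (if k = 0 then - of_real pi * \<i> else 0) -
           (2 * of_real pi * \<i>) ^ Suc k * pser (pow_coeff k) (nome z)) has_field_derivative
         (0 - (2 * of_real pi * \<i>) ^ Suc k * (2 * of_real pi * \<i> * pser (pow_coeff (Suc k)) (nome z)))) (at z)"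
    using has_field_derivative_pser_nome[OF unit_series_pow_coeff Suc.prems, of k] unfolding eq
    by (intro DERIV_diff DERIV_const DERIV_cmult)
  hence "(polygamma_refl k has_field_derivative
         (0 - (2 * of_real pi * \<i>) ^ Suc k * (2 * of_real pi * \<i> * pser (pow_coeff (Suc k)) (nome z)))) (at z)"
    by (rule has_field_derivative_transform_within_open[OF _ op]) (use Suc in auto)
  from DERIV_unique[OF has_field_derivative_polygamma_refl[OF Im_pos_not_Ints[OF Suc.prems]] this]
  show ?case by (simp add: mult_ac)
qed

lemma has_sum_Polygamma:
  assumes "(z :: complex) \<notin> \<int>\<^sub>\<le>\<^sub>0" "k \<ge> 1"
  shows "((\<lambda>n. 1 / (z + of_nat n) ^ Suc k) has_sum ((-1) ^ Suc k * Polygamma k z / fact k)) UNIV"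
proof (rule norm_summable_imp_has_sum)
  show "summable (\<lambda>n. norm (1 / (z + of_nat n) ^ Suc k))"
    using assms by (intro abs_summable_inverse_shift) auto
  hence "(\<lambda>n. 1 / (z + of_nat n) ^ Suc k) sums (\<Sum>n. 1 / (z + of_nat n) ^ Suc k)"
    by (rule summable_sums[OF summable_norm_cancel])
  also have "(\<Sum>n. 1 / (z + of_nat n) ^ Suc k) = (-1) ^ Suc k * Polygamma k z / fact k"
    using assms by (simp add: Polygamma_def inverse_eq_divide mult_ac flip: power_add)
  finally show "(\<lambda>n. 1 / (z + of_nat n) ^ Suc k) sums ((-1) ^ Suc k * Polygamma k z / fact k)" .
qed

lemma has_sum_polygamma_refl:
  assumes "z \<notin> \<int>" "k \<ge> 1"
  shows "((\<lambda>n::int. 1 / (z + of_int n) ^ Suc k) has_sum ((-1) ^ k * polygamma_refl k z / fact k)) UNIV"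
proof -
  have ni: "z \<notin> \<int>\<^sub>\<le>\<^sub>0" "1 - z \<notin> \<int>\<^sub>\<le>\<^sub>0"
    using assms nonpos_Ints_subset_Ints by (auto dest!: nonpos_Ints_Int)
  have "((\<lambda>n::int. 1 / (z + of_int n) ^ Suc k) has_sum
     ((-1) ^ Suc k * Polygamma k z / fact k + (-1) ^ Suc k * ((-1) ^ Suc k * Polygamma k (1 - z) / fact k))) UNIV"
  proof (rule has_sum_int_split)
    show "((\<lambda>n. 1 / (z + of_int (int n)) ^ Suc k) has_sum ((-1) ^ Suc k * Polygamma k z / fact k)) UNIV"
      using has_sum_Polygamma[OF ni(1) assms(2)] by simp
    have "1 / (z + of_int (- int (Suc n))) ^ Suc k = (-1) ^ Suc k * (1 / (1 - z + of_nat n) ^ Suc k)" for n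
    proof -
      have "z + of_int (- int (Suc n)) = - (1 - z + of_nat n)" by simp
      thus ?thesis by (simp only: power_minus[of "1 - z + of_nat n"]) (simp add: divide_simps flip: power_add)
    qed
    thus "((\<lambda>n. 1 / (z + of_int (- int (Suc n))) ^ Suc k) has_sum
              ((-1) ^ Suc k * ((-1) ^ Suc k * Polygamma k (1 - z) / fact k))) UNIV"
      using has_sum_cmult_right[OF has_sum_Polygamma[OF ni(2) assms(2)], of "(-1) ^ Suc k"] by (simp only:)
  qed
  also have "(-1) ^ Suc k * Polygamma k z / fact k + (-1) ^ Suc k * ((-1) ^ Suc k * Polygamma k (1 - z) / fact k)
     = (-1) ^ k * polygamma_refl k z / fact k"
    by (simp add: polygamma_refl_def algebra_simps diff_divide_distrib flip: power_add mult.assoc)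
  finally show ?thesis .
qed

text \<open>The sign (-1)^k of the bilateral sum and the minus sign of the nome series combine to
  the base -2 pi i. Applied to the rows of the lattice, this gives the q-expansions of the
  Eisenstein series.\<close>

lemma lipschitz_formula:
  assumes "Im z > 0" "k \<ge> 1"
  shows "((\<lambda>n::int. 1 / (z + of_int n) ^ Suc k) has_sum
           ((- 2 * of_real pi * \<i>) ^ Suc k / fact k * pser (pow_coeff k) (nome z))) UNIV"
proof -
  have "(-1) ^ k * polygamma_refl k z / fact k = (- 2 * of_real pi * \<i>) ^ Suc k / fact k * pser (pow_coeff k) (nome z)"
  proof -
    have "(- 2 * of_real pi * \<i>) ^ Suc k = (-1) ^ Suc k * (2 * of_real pi * \<i>) ^ Suc k"
      by (subst power_mult_distrib[symmetric]) simp
    thus ?thesis using assms by (simp add: polygamma_refl_nome)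
  qed
  thus ?thesis using has_sum_polygamma_refl[OF Im_pos_not_Ints[OF assms(1)] assms(2)] by simp
qed

text \<open>For c = pi cot(pi z) one has c' = -(pi^2 + c^2). So if the k-th derivative is P(c), the
  next one is -P'(c) (pi^2 + c^2).\<close>

lemma polygamma_refl_step:
  assumes "\<And>z. z \<notin> \<int> \<Longrightarrow> polygamma_refl k z = P (of_real pi * cot (of_real pi * z))"
    and "\<And>w. (P has_field_derivative P' w) (at w)" and "z \<notin> \<int>"
  shows "polygamma_refl (Suc k) z =
     - P' (of_real pi * cot (of_real pi * z)) * (of_real pi ^ 2 + (of_real pi * cot (of_real pi * z)) ^ 2)"
proof -
  have op: "open (- (\<int> :: complex set))" by (simp add: open_Compl)
  have s: "sin (of_real pi * z) \<noteq> 0"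
  proof
    assume "sin (of_real pi * z) = 0"
    then obtain n :: int where "of_real pi * z = of_real (n * pi)" by (auto simp: Complex_Transcendental.sin_eq_0)
    hence "z = of_int n" by simp
    thus False using assms(3) by simp
  qed
  have "((\<lambda>z. of_real pi * z) has_field_derivative of_real pi) (at z)"
    by (auto intro!: derivative_eq_intros)
  from DERIV_cmult[OF DERIV_chain2[OF DERIV_cot[OF s] this], of "of_real pi"]
  have "((\<lambda>z. of_real pi * cot (of_real pi * z)) has_field_derivative
      of_real pi * (- inverse ((sin (of_real pi * z))^2) * of_real pi)) (at z)" .
  also have "of_real pi * (- inverse ((sin (of_real pi * z))^2) * of_real pi) =
      - (of_real pi ^ 2 + (of_real pi * cot (of_real pi * z)) ^ 2)"
  proof -
    have "1 + cot (of_real pi * z) ^ 2 = inverse ((sin (of_real pi * z))^2)"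
      using s sin_cos_squared_add[of "of_real pi * z"]
      by (simp add: cot_def power_divide inverse_eq_divide add_divide_eq_iff)
    hence "of_real pi ^ 2 * inverse ((sin (of_real pi * z))^2) = of_real pi ^ 2 + (of_real pi * cot (of_real pi * z)) ^ 2"
      by (metis power_mult_distrib distrib_left mult.right_neutral)
    thus ?thesis by (simp add: power2_eq_square mult_ac)
  qed
  finally have "((\<lambda>z. P (of_real pi * cot (of_real pi * z))) has_field_derivative
     P' (of_real pi * cot (of_real pi * z)) * (- (of_real pi ^ 2 + (of_real pi * cot (of_real pi * z)) ^ 2))) (at z)"
    by (rule DERIV_chain2[OF assms(2)])
  hence "(polygamma_refl k has_field_derivative
     P' (of_real pi * cot (of_real pi * z)) * (- (of_real pi ^ 2 + (of_real pi * cot (of_real pi * z)) ^ 2))) (at z)"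
    by (rule has_field_derivative_transform_within_open[OF _ op]) (use assms in auto)
  from DERIV_unique[OF has_field_derivative_polygamma_refl[OF assms(3)] this] show ?thesis by (simp only: mult_minus_left mult_minus_right)
qed

text \<open>The derivatives of the cotangent are polynomials in the cotangent itself, which vanishes
  here, so only their constant terms survive. These are the source of zeta(2), zeta(4) and
  zeta(6).\<close>

lemma polygamma_refl_half:
  "polygamma_refl 1 (1/2) = - (of_real pi ^ 2)"
  "polygamma_refl 3 (1/2) = - 2 * of_real pi ^ 4"
  "polygamma_refl 5 (1/2) = - 16 * of_real pi ^ 6"
proof -
  define p where "p = complex_of_real pi"
  define c where "c = (\<lambda>z. p * cot (p * z))"
  have r0: "polygamma_refl 0 z = (\<lambda>w. w) (c z)" if "z \<notin> \<int>" for z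
    using that by (simp add: polygamma_refl_0 c_def p_def)
  have r1: "polygamma_refl 1 z = (\<lambda>w. - (p^2 + w^2)) (c z)" if "z \<notin> \<int>" for z
  proof -
    have "polygamma_refl (Suc 0) z = - 1 * (p^2 + c z^2)"
      unfolding c_def p_def
      by (rule polygamma_refl_step[where P = "\<lambda>w. w" and P' = "\<lambda>_. 1", OF r0[unfolded c_def p_def] _ that],
          assumption, rule DERIV_ident)
    thus ?thesis by simp
  qed
  have r2: "polygamma_refl 2 z = (\<lambda>w. 2 * p^2 * w + 2 * w ^ 3) (c z)" if "z \<notin> \<int>" for z
  proof -
    have "polygamma_refl (Suc 1) z = - (- 2 * c z) * (p^2 + c z^2)"
      unfolding c_def p_def
      by (rule polygamma_refl_step[where P = "\<lambda>w. - (of_real pi^2 + w^2)"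
            and P' = "\<lambda>w. - 2 * w",
            OF r1[unfolded c_def p_def] _ that],
          assumption, (rule derivative_eq_intros refl)+, simp add: algebra_simps)
    thus ?thesis by (simp add: numeral_2_eq_2) (simp add: algebra_simps power_numeral_reduce)
  qed
  have r3: "polygamma_refl 3 z = (\<lambda>w. - (2 * p^4 + 8 * p^2 * w^2 + 6 * w ^ 4)) (c z)" if "z \<notin> \<int>" for z
  proof -
    have "polygamma_refl (Suc 2) z = - (2 * p^2 + 6 * c z ^ 2) * (p^2 + c z^2)"
      unfolding c_def p_def
      by (rule polygamma_refl_step[where P = "\<lambda>w. 2 * of_real pi^2 * w + 2 * w ^ 3"
            and P' = "\<lambda>w. 2 * of_real pi ^ 2 + 6 * w ^ 2",
            OF r2[unfolded c_def p_def] _ that],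
          assumption, (rule derivative_eq_intros refl)+, simp add: algebra_simps)
    moreover have "Suc 2 = 3" by simp
    ultimately show ?thesis by (simp only:) (simp add: algebra_simps power_numeral_reduce)
  qed
  have r4: "polygamma_refl 4 z = (\<lambda>w. 16 * p^4 * w + 40 * p^2 * w^3 + 24 * w ^ 5) (c z)" if "z \<notin> \<int>" for z
  proof -
    have "polygamma_refl (Suc 3) z = - (- (16 * p^2 * c z + 24 * c z ^ 3)) * (p^2 + c z^2)"
      unfolding c_def p_def
      by (rule polygamma_refl_step[where P = "\<lambda>w. - (2 * of_real pi^4 + 8 * of_real pi^2 * w^2 + 6 * w ^ 4)"
            and P' = "\<lambda>w. - (16 * of_real pi ^ 2 * w + 24 * w ^ 3)",
            OF r3[unfolded c_def p_def] _ that],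
          assumption, (rule derivative_eq_intros refl)+, simp add: algebra_simps)
    moreover have "Suc 3 = 4" by simp
    ultimately show ?thesis by (simp only:) (simp add: algebra_simps power_numeral_reduce)
  qed
  have half: "(1/2 :: complex) \<notin> \<int>"
    using fraction_not_in_Ints[where 'a = complex, of 2 1] by simp
  have c: "c (1/2) = 0"
  proof -
    have "p * (1/2) = of_real (pi / 2)" by (simp add: p_def)
    hence "cos (p * (1/2)) = 0" by (simp only: cos_of_real cos_pi_half of_real_0)
    thus ?thesis by (simp add: c_def cot_def)
  qed
  have "polygamma_refl (Suc 4) (1/2) = - (16 * p^4 + 120 * p^2 * c (1/2) ^ 2 + 120 * c (1/2) ^ 4) * (p^2 + c (1/2)^2)"
    unfolding c_def p_def
    by (rule polygamma_refl_step[where P = "\<lambda>w. 16 * of_real pi^4 * w + 40 * of_real pi^2 * w^3 + 24 * w ^ 5"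
          and P' = "\<lambda>w. 16 * of_real pi ^ 4 + 120 * of_real pi ^ 2 * w ^ 2 + 120 * w ^ 4",
          OF r4[unfolded c_def p_def] _ half],
        assumption, (rule derivative_eq_intros refl)+, simp add: algebra_simps)
  moreover have "Suc 4 = 5" by simp
  ultimately show "polygamma_refl 5 (1/2) = - 16 * of_real pi ^ 6" using c
    by (simp only:) (simp add: p_def flip: power_add)
  show "polygamma_refl 1 (1/2) = - (of_real pi ^ 2)" using r1[OF half] c by (simp add: p_def)
  show "polygamma_refl 3 (1/2) = - 2 * of_real pi ^ 4" using r3[OF half] c by (simp add: p_def)
qed

section \<open>Values of the Riemann zeta function at 2, 4 and 6\<close>

lemma has_sum_zeta_from_half:
  assumes "k \<ge> 2" "((\<lambda>n. 1 / (1/2 + of_nat n) ^ k) has_sum (S :: complex)) UNIV"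
  shows "((\<lambda>n. 1 / of_nat (Suc n) ^ k) has_sum (S / (2 ^ k - 1))) UNIV"
proof -
  have "summable (\<lambda>n. norm (1 / (1 + of_nat n :: complex) ^ k))"
    by (rule abs_summable_inverse_shift) fact
  hence "(\<lambda>n. 1 / of_nat (Suc n) ^ k :: complex) summable_on UNIV"
    using norm_summable_imp_summable_on by (simp add: algebra_simps)
  then obtain Z :: complex where Z: "((\<lambda>n. 1 / of_nat (Suc n) ^ k) has_sum Z) UNIV"
    by (auto simp: summable_on_def)
  have 1: "bij_betw (\<lambda>j::nat. 2 * j) UNIV {n. even n}"
    by (rule bij_betwI[where g = "\<lambda>n. n div 2"]) auto
  have 2: "bij_betw (\<lambda>j::nat. 2 * j + 1) UNIV {n. odd n}"
    by (rule bij_betwI[where g = "\<lambda>n. n div 2"]) auto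
  have "((\<lambda>j. 1 / 2 ^ k * (1 / (1/2 + of_nat j) ^ k) :: complex) has_sum (1 / 2 ^ k * S)) UNIV"
    by (rule has_sum_cmult_right) fact
  also have "(\<lambda>j. 1 / 2 ^ k * (1 / (1/2 + of_nat j) ^ k) :: complex) = (\<lambda>j. 1 / of_nat (Suc (2 * j)) ^ k)"
    by (simp add: fun_eq_iff algebra_simps flip: power_mult_distrib)
  \<comment> \<open>The index n stands for the denominator n + 1, so even n carry the odd
    denominators. These sum to S / 2^k and the others to Z / 2^k, whence Z (2^k - 1) = S.\<close>
  finally have e: "((\<lambda>n. 1 / of_nat (Suc n) ^ k) has_sum (1 / 2 ^ k * S)) {n. even n}"
    using has_sum_reindex_bij_betw[OF 1, of "\<lambda>n. 1 / of_nat (Suc n) ^ k :: complex"] by simp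
  have "((\<lambda>j. 1 / 2 ^ k * (1 / of_nat (Suc j) ^ k) :: complex) has_sum (1 / 2 ^ k * Z)) UNIV"
    by (rule has_sum_cmult_right) fact
  also have "(\<lambda>j. 1 / 2 ^ k * (1 / of_nat (Suc j) ^ k) :: complex) = (\<lambda>j. 1 / of_nat (Suc (2 * j + 1)) ^ k)"
    by (simp add: fun_eq_iff algebra_simps flip: power_mult_distrib)
  finally have o: "((\<lambda>n. 1 / of_nat (Suc n) ^ k) has_sum (1 / 2 ^ k * Z)) {n. odd n}"
    using has_sum_reindex_bij_betw[OF 2, of "\<lambda>n. 1 / of_nat (Suc n) ^ k :: complex"] by simp
  have "((\<lambda>n. 1 / of_nat (Suc n) ^ k) has_sum (1 / 2 ^ k * S + 1 / 2 ^ k * Z)) ({n. even n} \<union> {n. odd n})"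
    by (rule has_sum_Un_disjoint[OF e o]) auto
  also have "{n. even n} \<union> {n. odd n} = (UNIV :: nat set)" by auto
  finally have "1 / 2 ^ k * S + 1 / 2 ^ k * Z = Z" using Z has_sum_unique by blast
  moreover have "(2::complex) ^ k \<noteq> 1"
  proof
    assume "(2::complex) ^ k = 1"
    hence "norm ((2::complex) ^ k) = 1" by simp
    hence "(2::real) ^ k = 1" by (simp add: norm_power)
    thus False using assms(1) one_less_power[of "2::real" k] by simp
  qed
  ultimately have "Z = S / (2 ^ k - 1)" by (simp add: field_simps)
  thus ?thesis using Z by simp
qed

text \<open>The arguments in use are 2, 4 and 6; the last branch is the value at 6 and doubles as
  the default.\<close>

definition zeta_even :: "nat \<Rightarrow> complex" where
  "zeta_even k = (if k = 2 then of_real pi ^ 2 / 6 else if k = 4 then of_real pi ^ 4 / 90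
     else of_real pi ^ 6 / 945)"

lemma has_sum_zeta_even:
  assumes "k \<in> {2, 4, 6}"
  shows "((\<lambda>n. 1 / of_nat (Suc n) ^ k) has_sum zeta_even k) UNIV"
proof -
  have half: "(1/2 :: complex) \<notin> \<int>"
    using fraction_not_in_Ints[where 'a = complex, of 2 1] by simp
  hence half': "(1/2 :: complex) \<notin> \<int>\<^sub>\<le>\<^sub>0" using nonpos_Ints_subset_Ints by auto
  have *: "((\<lambda>n. 1 / (1/2 + of_nat n) ^ Suc j) has_sum (- polygamma_refl j (1/2) / 2 / fact j)) UNIV"
    if "odd j" for j
    using has_sum_Polygamma[OF half', of j] that by (cases j) (auto simp: polygamma_refl_def)
  have **: "((\<lambda>n. 1 / of_nat (Suc n) ^ Suc j) has_sum (- polygamma_refl j (1/2) / 2 / fact j / (2 ^ Suc j - 1))) UNIV"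
    if "odd j" for j
    using that by (intro has_sum_zeta_from_half[OF _ *]) (cases j, auto)
  have z: "- polygamma_refl 1 (1/2) / 2 / fact 1 / (2 ^ 2 - 1) = zeta_even 2"
    "- polygamma_refl 3 (1/2) / 2 / fact 3 / (2 ^ 4 - 1) = zeta_even 4"
    "- polygamma_refl 5 (1/2) / 2 / fact 5 / (2 ^ 6 - 1) = zeta_even 6"
    unfolding polygamma_refl_half by (simp_all add: zeta_even_def fact_numeral)
  have s: "Suc 1 = 2" "Suc 3 = 4" "Suc 5 = 6" "odd (1::nat)" "odd (3::nat)" "odd (5::nat)" by simp_all
  consider "k = 2" | "k = 4" | "k = 6" using assms by blast
  thus ?thesis
  proof cases
    case 1 thus ?thesis using **[OF s(4)] unfolding s z by simp
  next
    case 2 thus ?thesis using **[OF s(5)] unfolding s z by simp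
  next
    case 3 thus ?thesis using **[OF s(6)] unfolding s z by simp
  qed
qed

lemma has_sum_zeta_even_int:
  assumes "k \<in> {2, 4, 6}"
  shows "((\<lambda>n::int. 1 / of_int n ^ k) has_sum (2 * zeta_even k)) (- {0})"
proof -
  have ev: "even k" using assms by auto
  have 1: "bij_betw (\<lambda>n. int (Suc n)) UNIV {0<..}"
    by (rule bij_betwI[where g = "\<lambda>k. nat (k - 1)"]) auto
  have 2: "bij_betw (\<lambda>n. - int (Suc n)) UNIV {..<0}"
    by (rule bij_betwI[where g = "\<lambda>k. nat (- k - 1)"]) auto
  have a: "((\<lambda>n::int. 1 / of_int n ^ k) has_sum zeta_even k) {0<..}"
    using has_sum_zeta_even[OF assms] has_sum_reindex_bij_betw[OF 1, of "\<lambda>n::int. 1 / of_int n ^ k :: complex"]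
    by simp
  have "1 / of_int (- int (Suc n)) ^ k = (1 / of_nat (Suc n) ^ k :: complex)" for n
    using ev by (simp only: of_int_minus power_minus_even) simp
  hence b: "((\<lambda>n::int. 1 / of_int n ^ k) has_sum zeta_even k) {..<0}"
    using has_sum_zeta_even[OF assms] has_sum_reindex_bij_betw[OF 2, of "\<lambda>n::int. 1 / of_int n ^ k :: complex"]
    by (simp only:)
  have "((\<lambda>n::int. 1 / of_int n ^ k) has_sum (zeta_even k + zeta_even k)) ({0<..} \<union> {..<0})"
    by (rule has_sum_Un_disjoint[OF a b]) auto
  also have "{0<..} \<union> {..<0} = - {0 :: int}" by auto
  finally show ?thesis by simp
qed

subsection \<open>Lattice sums\<close>

abbreviation punctured :: "(int \<times> int) set" where
  "punctured \<equiv> UNIV - {(0, 0)}"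

lemma lattice_pt_lower_bound:
  assumes "Im \<tau> > 0"
  obtains \<delta> where "\<delta> > 0" "\<And>m n. norm (lattice_pt \<tau> m n) \<ge> \<delta> * (\<bar>of_int m\<bar> + \<bar>of_int n\<bar>)"
proof -
  define K where "K = 1 / Im \<tau> + 1 + norm \<tau> / Im \<tau>"
  have K: "K > 0" using assms unfolding K_def by (intro add_pos_nonneg add_pos_pos) auto
  have "\<bar>of_int m\<bar> + \<bar>of_int n\<bar> \<le> K * norm (lattice_pt \<tau> m n)" for m n
  proof -
    have "\<bar>of_int m\<bar> * Im \<tau> \<le> norm (lattice_pt \<tau> m n)"
      using abs_Im_le_cmod[of "lattice_pt \<tau> m n"] assms by (simp add: abs_mult)
    hence 1: "\<bar>of_int m\<bar> \<le> norm (lattice_pt \<tau> m n) / Im \<tau>" using assms by (simp add: field_simps)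
    have "norm (of_int n :: complex) \<le> norm (lattice_pt \<tau> m n) + norm (of_int m * \<tau>)"
      using norm_triangle_ineq4[of "lattice_pt \<tau> m n" "of_int m * \<tau>"] by simp
    hence "\<bar>of_int n\<bar> \<le> norm (lattice_pt \<tau> m n) + \<bar>of_int m\<bar> * norm \<tau>"
      by (simp add: norm_mult)
    also have "\<dots> \<le> norm (lattice_pt \<tau> m n) + norm (lattice_pt \<tau> m n) / Im \<tau> * norm \<tau>"
      using 1 by (intro add_left_mono mult_right_mono) auto
    finally show ?thesis using 1 unfolding K_def by (simp add: algebra_simps)
  qed
  hence "norm (lattice_pt \<tau> m n) \<ge> (1 / K) * (\<bar>of_int m\<bar> + \<bar>of_int n\<bar>)" for m n
    using K by (simp add: field_simps)
  thus ?thesis using that[of "1 / K"] K by simp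
qed

lemma lattice_pt_eq_0_iff:
  assumes "Im \<tau> > 0" shows "lattice_pt \<tau> m n = 0 \<longleftrightarrow> m = 0 \<and> n = 0"
proof
  assume *: "lattice_pt \<tau> m n = 0"
  obtain \<delta> where "\<delta> > 0" "\<delta> * (\<bar>of_int m\<bar> + \<bar>of_int n\<bar>) \<le> norm (lattice_pt \<tau> m n)"
    using lattice_pt_lower_bound[OF assms] by metis
  hence "\<bar>real_of_int m\<bar> + \<bar>real_of_int n\<bar> \<le> 0" unfolding * by (simp add: mult_le_0_iff)
  hence "\<bar>real_of_int m\<bar> \<le> 0 \<and> \<bar>real_of_int n\<bar> \<le> 0" by linarith
  thus "m = 0 \<and> n = 0" by simp
qed simp

lemma summable_on_int_powr: "(\<lambda>n::int. max 1 \<bar>real_of_int n\<bar> powr (-3/2)) summable_on UNIV"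
proof -
  have s: "summable (\<lambda>n. real (Suc n) powr (-3/2))"
    using summable_real_powr_iff[of "-3/2"] summable_iff_shift[of "\<lambda>n. real n powr (-3/2)" 1] by simp
  hence 1: "(\<lambda>n. real (Suc n) powr (-3/2)) summable_on UNIV"
    by (intro norm_summable_imp_summable_on) simp
  have eq: "max 1 \<bar>real_of_int (int (Suc n))\<bar> = real (Suc n)" "max 1 \<bar>real_of_int (- int (Suc n))\<bar> = real (Suc n)" for n
    by auto
  have "summable (\<lambda>n. max 1 \<bar>real_of_int (int (Suc n))\<bar> powr (-3/2))" unfolding eq by (rule s)
  hence "summable (\<lambda>n. max 1 \<bar>real_of_int (int n)\<bar> powr (-3/2))"
    using summable_iff_shift[of "\<lambda>n. max 1 \<bar>real_of_int (int n)\<bar> powr (-3/2)" 1] by simp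
  hence 2: "(\<lambda>n. max 1 \<bar>real_of_int (int n)\<bar> powr (-3/2)) summable_on UNIV"
    by (intro norm_summable_imp_summable_on) simp
  have 3: "(\<lambda>n. max 1 \<bar>real_of_int (- int (Suc n))\<bar> powr (-3/2)) summable_on UNIV"
    unfolding eq by (rule 1)
  from 2 3 obtain a b where "((\<lambda>n. max 1 \<bar>real_of_int (int n)\<bar> powr (-3/2)) has_sum a) UNIV"
      "((\<lambda>n. max 1 \<bar>real_of_int (- int (Suc n))\<bar> powr (-3/2)) has_sum b) UNIV"
    unfolding summable_on_def by blast
  from has_sum_int_split[OF this] show ?thesis by (rule has_sum_imp_summable)
qed

lemma summable_on_product_real:
  fixes f :: "'a \<Rightarrow> real" and g :: "'b \<Rightarrow> real"
  assumes "f summable_on A" "g summable_on B" "\<And>x. x \<in> A \<Longrightarrow> f x \<ge> 0" "\<And>x. x \<in> B \<Longrightarrow> g x \<ge> 0"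
  shows "(\<lambda>(x, y). f x * g y) summable_on A \<times> B"
proof (rule summable_on_SigmaI[where g = "\<lambda>x. f x * infsum g B"])
  show "((\<lambda>y. case (x, y) of (x, y) \<Rightarrow> f x * g y) has_sum f x * infsum g B) B" for x
    using has_sum_cmult_right[OF has_sum_infsum[OF assms(2)], of "f x"] by simp
  show "(\<lambda>x. f x * infsum g B) summable_on A"
    by (intro summable_on_cmult_left assms)
qed (use assms in auto)

text \<open>Since |m| + |n| dominates both max(1, |m|) and max(1, |n|), its cube dominates the
  product of their powers with exponent 3/2. This separates the variables, and 3/2 > 1 makes each
  factor summable.\<close>

lemma summable_on_lattice_cubes:
  assumes "Im \<tau> > 0"
  shows "(\<lambda>(m, n). 1 / norm (lattice_pt \<tau> m n) ^ 3) summable_on punctured"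
proof -
  obtain \<delta> where \<delta>: "\<delta> > 0" "\<And>m n. norm (lattice_pt \<tau> m n) \<ge> \<delta> * (\<bar>of_int m\<bar> + \<bar>of_int n\<bar>)"
    using lattice_pt_lower_bound[OF assms] by metis
  define u where "u = (\<lambda>n::int. max 1 \<bar>real_of_int n\<bar> powr (-3/2))"
  have "(\<lambda>(m, n). u m * u n) summable_on UNIV \<times> UNIV"
    unfolding u_def by (intro summable_on_product_real summable_on_int_powr) auto
  hence "(\<lambda>p. (1 / \<delta> ^ 3) * (case p of (m, n) \<Rightarrow> u m * u n)) summable_on punctured"
    by (intro summable_on_cmult_right) (rule summable_on_subset_banach, auto)
  thus ?thesis
  proof (rule summable_on_comparison_test)
    fix p :: "int \<times> int" assume p: "p \<in> punctured"
    obtain m n where mn: "p = (m, n)" by force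
    define s where "s = \<bar>real_of_int m\<bar> + \<bar>real_of_int n\<bar>"
    define a where "a = max 1 \<bar>real_of_int m\<bar>"
    define b where "b = max 1 \<bar>real_of_int n\<bar>"
    have "m \<noteq> 0 \<or> n \<noteq> 0" using p mn by auto
    hence "1 \<le> \<bar>m\<bar> + \<bar>n\<bar>" by linarith
    hence "s \<ge> 1" unfolding s_def using of_int_le_iff[of 1 "\<bar>m\<bar> + \<bar>n\<bar>", where 'a = real] by simp
    hence "a \<le> s" "b \<le> s" "a \<ge> 1" "b \<ge> 1" unfolding s_def a_def b_def by simp_all
    have "a powr (3/2) * b powr (3/2) \<le> s powr (3/2) * s powr (3/2)"
      using \<open>a \<le> s\<close> \<open>b \<le> s\<close> \<open>a \<ge> 1\<close> \<open>b \<ge> 1\<close> by (intro mult_mono powr_mono2) auto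
    also have "\<dots> = s powr 3" by (simp flip: powr_add)
    also have "\<dots> = s ^ 3" using \<open>s \<ge> 1\<close> by (simp add: powr_numeral)
    finally have 1: "a powr (3/2) * b powr (3/2) \<le> s ^ 3" .
    have "\<delta> ^ 3 * (a powr (3/2) * b powr (3/2)) \<le> \<delta> ^ 3 * s ^ 3"
      using 1 \<delta>(1) by (intro mult_left_mono) auto
    also have "\<dots> = (\<delta> * s) ^ 3" by (simp add: power_mult_distrib)
    also have "\<dots> \<le> norm (lattice_pt \<tau> m n) ^ 3"
      using \<delta> \<open>s \<ge> 1\<close> by (intro power_mono) (auto simp: s_def)
    finally have 2: "\<delta> ^ 3 * (a powr (3/2) * b powr (3/2)) \<le> norm (lattice_pt \<tau> m n) ^ 3" .
    have "0 < \<delta> ^ 3 * (a powr (3/2) * b powr (3/2))"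
      using \<delta>(1) \<open>a \<ge> 1\<close> \<open>b \<ge> 1\<close> by (intro mult_pos_pos zero_less_power) auto
    hence "1 / norm (lattice_pt \<tau> m n) ^ 3 \<le> 1 / (\<delta> ^ 3 * (a powr (3/2) * b powr (3/2)))"
      using 2 by (intro frac_le) auto
    also have "\<dots> = (1 / \<delta> ^ 3) * (u m * u n)"
      unfolding u_def a_def b_def by (simp add: powr_minus field_simps)
    finally show "(case p of (m, n) \<Rightarrow> 1 / norm (lattice_pt \<tau> m n) ^ 3) \<le> (1 / \<delta> ^ 3) * (case p of (m, n) \<Rightarrow> u m * u n)"
      by (simp add: mn)
  qed auto
qed

lemma summable_on_lattice_powers:
  assumes "Im \<tau> > 0" "k \<ge> 3"
  shows "(\<lambda>(m, n). 1 / lattice_pt \<tau> m n ^ k) summable_on punctured"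
proof -
  obtain \<delta> where \<delta>: "\<delta> > 0" "\<And>m n. norm (lattice_pt \<tau> m n) \<ge> \<delta> * (\<bar>of_int m\<bar> + \<bar>of_int n\<bar>)"
    using lattice_pt_lower_bound[OF assms(1)] by metis
  have "(\<lambda>p. norm ((\<lambda>(m, n). 1 / lattice_pt \<tau> m n ^ k) p)) summable_on punctured"
  proof (rule Infinite_Sum.abs_summable_on_comparison_test')
    show "(\<lambda>p. (1 / \<delta> ^ (k - 3)) * (case p of (m, n) \<Rightarrow> 1 / norm (lattice_pt \<tau> m n) ^ 3)) summable_on punctured"
      by (intro summable_on_cmult_right summable_on_lattice_cubes assms)
    fix p :: "int \<times> int" assume p: "p \<in> punctured"
    obtain m n where mn: "p = (m, n)" by force
    have "m \<noteq> 0 \<or> n \<noteq> 0" using p mn by auto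
    hence "1 \<le> \<bar>m\<bar> + \<bar>n\<bar>" by linarith
    hence "\<bar>real_of_int m\<bar> + \<bar>real_of_int n\<bar> \<ge> 1"
      using of_int_le_iff[of 1 "\<bar>m\<bar> + \<bar>n\<bar>", where 'a = real] by simp
    hence "\<delta> * 1 \<le> \<delta> * (\<bar>real_of_int m\<bar> + \<bar>real_of_int n\<bar>)" using \<delta>(1) by (intro mult_left_mono) auto
    hence ge: "norm (lattice_pt \<tau> m n) \<ge> \<delta>" using \<delta>(2)[of m n] by linarith
    have "norm (1 / lattice_pt \<tau> m n ^ k) = 1 / (norm (lattice_pt \<tau> m n) ^ (k - 3) * norm (lattice_pt \<tau> m n) ^ 3)"
      using assms(2) by (simp add: norm_divide norm_power flip: power_add)
    also have "\<dots> \<le> 1 / (\<delta> ^ (k - 3) * norm (lattice_pt \<tau> m n) ^ 3)"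
    proof -
      have "norm (lattice_pt \<tau> m n) > 0" using ge \<delta>(1) by linarith
      hence "0 < \<delta> ^ (k - 3) * norm (lattice_pt \<tau> m n) ^ 3" using \<delta>(1) by (intro mult_pos_pos zero_less_power)
      thus ?thesis using ge \<delta>(1) by (intro frac_le mult_right_mono power_mono) auto
    qed
    finally show "norm ((\<lambda>(m, n). 1 / lattice_pt \<tau> m n ^ k) p) \<le>
        (1 / \<delta> ^ (k - 3)) * (case p of (m, n) \<Rightarrow> 1 / norm (lattice_pt \<tau> m n) ^ 3)"
      by (simp add: mn)
  qed
  thus ?thesis by (rule abs_summable_summable)
qed

text \<open>The common reduction behind the Eisenstein series and the zeta function: rows m and -m
  of an even function have the same sum, so the total is \<open>R0\<close> plus twice the sum over
  the rows with m > 0.\<close>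

lemma has_sum_lattice_rows:
  fixes f :: "int \<times> int \<Rightarrow> complex"
  assumes "(f has_sum S) punctured" "\<And>m n. f (- m, - n) = f (m, n)"
    and "((\<lambda>n. f (0, n)) has_sum R0) (- {0})"
    and "\<And>j. ((\<lambda>n. f (int (Suc j), n)) has_sum R j) UNIV"
  shows "(R has_sum ((S - R0) / 2)) UNIV"
proof -
  define B where "B = (\<lambda>m::int. if m = 0 then - {0::int} else UNIV)"
  \<comment> \<open>The index j of \<open>R\<close> belongs to the rows j + 1 and -(j + 1), hence
    the subtraction of 1.\<close>
  define g where "g = (\<lambda>m. if m = 0 then R0 else R (nat \<bar>m\<bar> - 1))"
  have neg: "((\<lambda>n. f (- int (Suc j), n)) has_sum R j) UNIV" for j
  proof -
    have "bij_betw uminus (UNIV :: int set) UNIV" by (rule bij_betwI[where g = uminus]) auto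
    from has_sum_reindex_bij_betw[OF this, of "\<lambda>n. f (- int (Suc j), n)" "R j"] assms(2)[of "int (Suc j)"] assms(4)[of j]
    show ?thesis by simp
  qed
  have "((\<lambda>n. f (m, n)) has_sum g m) (B m)" for m
  proof -
    consider "m = 0" | j where "m = int (Suc j)" | j where "m = - int (Suc j)"
    proof (cases m rule: int_cases)
      case (nonneg n)
      thus ?thesis using that by (cases n) auto
    qed (use that in blast)
    thus ?thesis
    proof cases
      case 1 thus ?thesis using assms(3) by (simp add: g_def B_def)
    next
      case (2 j)
      hence "g m = R j" "B m = UNIV" by (simp_all add: g_def B_def nat_add_distrib)
      thus ?thesis using assms(4)[of j] 2 by (simp only:)
    next
      case (3 j)
      hence "g m = R j" "B m = UNIV" by (simp_all add: g_def B_def nat_add_distrib)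
      thus ?thesis using neg[of j] 3 by (simp only:)
    qed
  qed
  moreover have "Sigma UNIV B = punctured" by (auto simp: B_def split: if_splits)
  ultimately have g: "(g has_sum S) UNIV"
    using assms(1) has_sum_SigmaD[where A = UNIV and B = B and f = f and g = g and S = S] by simp
  hence "g summable_on {m. m > 0}" "g summable_on {m. m < 0}"
    by (auto intro: summable_on_subset_banach[OF has_sum_imp_summable])
  then obtain P N where P: "(g has_sum P) {m. m > 0}" and N: "(g has_sum N) {m. m < 0}"
    unfolding summable_on_def by blast
  have 1: "bij_betw (\<lambda>n. int (Suc n)) UNIV {m. m > 0}"
    by (rule bij_betwI[where g = "\<lambda>k. nat (k - 1)"]) auto
  have 2: "bij_betw (\<lambda>n. - int (Suc n)) UNIV {m. m < 0}"
    by (rule bij_betwI[where g = "\<lambda>k. nat (- k - 1)"]) auto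
  have P': "(R has_sum P) UNIV"
    using P has_sum_reindex_bij_betw[OF 1, of g P] by (simp add: g_def del: of_nat_Suc)
  have N': "(R has_sum N) UNIV"
    using N has_sum_reindex_bij_betw[OF 2, of g N] by (simp add: g_def del: of_nat_Suc)
  have "N = P" using P' N' has_sum_unique by blast
  have "(g has_sum R0) {0}" by (rule has_sum_finiteI) (auto simp: g_def)
  hence "(g has_sum (R0 + (P + N))) ({0} \<union> ({m. m > 0} \<union> {m. m < 0}))"
    by (intro has_sum_Un_disjoint P N) auto
  also have "{0} \<union> ({m. m > 0} \<union> {m. m < 0}) = (UNIV :: int set)" by auto
  finally have "R0 + (P + N) = S" using g has_sum_unique by blast
  hence "S = R0 + 2 * P" using \<open>N = P\<close> by simp
  hence "P = (S - R0) / 2" by simp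
  thus ?thesis using P' by (simp only:)
qed

section \<open>Divisor sums and Lambert series\<close>

definition sigma_coeff :: "nat \<Rightarrow> nat \<Rightarrow> complex" where
  "sigma_coeff k n = (if n = 0 then 0 else \<Sum>d | d dvd n. of_nat d ^ k)"

lemma norm_sigma_coeff_le: "norm (sigma_coeff k n) \<le> real n ^ Suc k"
proof (cases "n = 0")
  case False
  have "norm (sigma_coeff k n) \<le> (\<Sum>d | d dvd n. real d ^ k)"
    using False by (auto simp: sigma_coeff_def norm_power intro!: order_trans[OF norm_sum])
  also have "\<dots> \<le> (\<Sum>d | d dvd n. real n ^ k)"
    using False by (intro sum_mono power_mono) (auto dest: dvd_imp_le)
  also have "\<dots> = real (card {d. d dvd n}) * real n ^ k" by simp
  also have "\<dots> \<le> real n * real n ^ k"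
  proof -
    have "{d. d dvd n} \<subseteq> {1..n}" using False by (auto dest: dvd_imp_le intro: Suc_leI dvd_pos_nat)
    hence "card {d. d dvd n} \<le> card {1..n}" by (intro card_mono) auto
    thus ?thesis by (intro mult_right_mono) auto
  qed
  finally show ?thesis by simp
qed (auto simp: sigma_coeff_def)

lemma unit_series_sigma_coeff: "unit_series (sigma_coeff k)"
proof (rule unit_series_comparison[OF unit_series_power[of "Suc k"]])
  show "norm (sigma_coeff k n) \<le> norm (of_nat n ^ Suc k :: complex)" for n
    using norm_sigma_coeff_le[of k n] by (simp add: norm_mult norm_power)
qed

text \<open>The double series over m, n >= 1 of n^k q^(m n) is summed once along rows and once along
  the sets m n = N, where a pair is recorded as N together with its divisor n.\<close>

lemma lambert_series:
  assumes "norm q < 1"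
  shows "((\<lambda>j. pser (pow_coeff k) (q ^ Suc j)) has_sum pser (sigma_coeff k) q) UNIV"
proof -
  define f where "f = (\<lambda>(m, n). pow_coeff k n * q ^ (m * n))"
  define r where "r = norm q"
  have r: "r \<ge> 0" "r < 1" using assms by (auto simp: r_def)
  have pos: "f summable_on {1..} \<times> {1..}"
  proof -
    have "summable (\<lambda>n. norm (pow_coeff k n * q ^ n))"
      by (rule unit_series_abs_summable[OF unit_series_pow_coeff assms])
    hence "(\<lambda>n. norm (pow_coeff k n) * r ^ n) summable_on UNIV"
      by (intro norm_summable_imp_summable_on) (simp add: norm_mult norm_power r_def)
    hence 1: "(\<lambda>n. norm (pow_coeff k n) * r ^ n) summable_on {1..}"
      by (rule summable_on_subset_banach) auto
    have "(\<lambda>m. r ^ m) summable_on UNIV"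
      using r by (intro norm_summable_imp_summable_on) (auto simp: norm_power intro: summable_geometric)
    hence "((\<lambda>m. r ^ (m - 1)) \<circ> Suc) summable_on UNIV" by (simp add: o_def)
    hence "(\<lambda>m. r ^ (m - 1)) summable_on (Suc ` UNIV)"
      by (subst summable_on_reindex) auto
    also have "Suc ` UNIV = {1..}" using image_Suc_lessThan by (auto simp: image_iff) (metis Suc_le_D)
    finally have 2: "(\<lambda>m. r ^ (m - 1)) summable_on {1..}" .
    have "(\<lambda>(m, n). r ^ (m - 1) * (norm (pow_coeff k n) * r ^ n)) summable_on {1..} \<times> {1..}"
      using r by (intro summable_on_product_real 1 2) auto
    hence "(\<lambda>p. norm (f p)) summable_on {1..} \<times> {1..}"
    proof (rule Infinite_Sum.abs_summable_on_comparison_test')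
      fix p :: "nat \<times> nat" assume p: "p \<in> {1..} \<times> {1..}"
      obtain m n where mn: "p = (Suc m, Suc n)" using p by (cases p) (auto simp: Suc_le_eq gr0_conv_Suc)
      \<comment> \<open>For indices at least 1 the product is at least the sum minus 1, so the
        double series is dominated by a product of two simple ones.\<close>
      have "r ^ (Suc m * Suc n) \<le> r ^ (m + Suc n)" using r by (intro power_decreasing) auto
      also have "\<dots> = r ^ m * r ^ Suc n" by (simp add: power_add)
      finally have "norm (pow_coeff k (Suc n)) * r ^ (Suc m * Suc n) \<le> norm (pow_coeff k (Suc n)) * (r ^ m * r ^ Suc n)"
        by (intro mult_left_mono) auto
      thus "norm (f p) \<le> (\<lambda>(m, n). r ^ (m - 1) * (norm (pow_coeff k n) * r ^ n)) p"
        by (simp add: mn f_def norm_mult norm_power r_def mult_ac add_ac)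
    qed
    thus ?thesis by (rule abs_summable_summable)
  qed
  then obtain S where S: "(f has_sum S) ({1..} \<times> {1..})" by (auto simp: summable_on_def)
  have row: "((\<lambda>n. f (m, n)) has_sum pser (pow_coeff k) (q ^ m)) {1..}" if "m \<in> {1..}" for m
  proof -
    have "norm q ^ m < 1" using assms that by (auto intro: power_less_one_iff[THEN iffD2])
    hence qm: "norm (q ^ m) < 1" by (simp add: norm_power)
    have "((\<lambda>n. pow_coeff k n * (q ^ m) ^ n) has_sum pser (pow_coeff k) (q ^ m)) UNIV"
      by (rule norm_summable_imp_has_sum[OF unit_series_abs_summable unit_series_sums])
         (use qm unit_series_pow_coeff in auto)
    also have "?this \<longleftrightarrow> ((\<lambda>n. f (m, n)) has_sum pser (pow_coeff k) (q ^ m)) {1..}"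
      by (rule has_sum_cong_neutral) (auto simp: f_def pow_coeff_def power_mult Suc_le_eq)
    finally show ?thesis .
  qed
  have "((\<lambda>m. pser (pow_coeff k) (q ^ m)) has_sum S) {1..}"
    using S row by (rule has_sum_SigmaD)
  moreover have "bij_betw Suc UNIV {1..}"
    by (rule bij_betwI[where g = "\<lambda>n. n - 1"]) auto
  ultimately have 1: "((\<lambda>j. pser (pow_coeff k) (q ^ Suc j)) has_sum S) UNIV"
    using has_sum_reindex_bij_betw[of Suc UNIV "{1..}" "\<lambda>m. pser (pow_coeff k) (q ^ m)" S] by simp
  have "((\<lambda>(N, d). pow_coeff k d * q ^ N) has_sum S) (Sigma {1..} (\<lambda>N. {d. d dvd N}))"
  proof -
    have "((\<lambda>(N, d). pow_coeff k d * q ^ N) has_sum S) (Sigma {1..} (\<lambda>N. {d. d dvd N})) \<longleftrightarrow>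
        (f has_sum S) ({1..} \<times> {1..})"
      by (rule has_sum_reindex_bij_witness[where i = "\<lambda>(m, n). (m * n, n)" and j = "\<lambda>(N, d). (N div d, d)"])
         (auto simp: f_def Suc_le_eq mult.commute intro: dvd_pos_nat dvd_div_eq_0_iff elim!: dvdE)
    thus ?thesis using S by simp
  qed
  hence "((\<lambda>N. \<Sum>d | d dvd N. pow_coeff k d * q ^ N) has_sum S) {1..}"
    by (rule has_sum_SigmaD) (auto intro!: has_sum_finiteI)
  also have "?this \<longleftrightarrow> ((\<lambda>N. sigma_coeff k N * q ^ N) has_sum S) UNIV"
  proof (rule has_sum_cong_neutral)
    fix N :: nat assume N: "N \<in> {1..} \<inter> UNIV"
    have "(\<Sum>d | d dvd N. pow_coeff k d * q ^ N) = (\<Sum>d | d dvd N. of_nat d ^ k * q ^ N)"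
      using N by (intro sum.cong) (auto simp: pow_coeff_def)
    thus "(\<Sum>d | d dvd N. pow_coeff k d * q ^ N) = sigma_coeff k N * q ^ N"
      using N by (simp add: sigma_coeff_def sum_distrib_right)
  qed (auto simp: sigma_coeff_def Suc_le_eq)
  finally have "(\<lambda>N. sigma_coeff k N * q ^ N) sums S" by (rule has_sum_imp_sums)
  hence "pser (sigma_coeff k) q = S" by (simp add: pser_def sums_iff)
  thus ?thesis using 1 by simp
qed

lemma nome_mult_nat: "nome (of_nat m * z) = nome z ^ m"
  by (simp add: nome_def mult_ac flip: exp_of_nat_mult)

text \<open>The q-expansion of the Eisenstein series of weight k. For k = 2, where the lattice sum
  is not absolutely convergent, the expansion itself serves as the definition.\<close>

definition eisenstein :: "nat \<Rightarrow> complex \<Rightarrow> complex" where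
  "eisenstein k q = 2 * zeta_even k + 2 * (2 * of_real pi * \<i>) ^ k / fact (k - 1) * pser (sigma_coeff (k - 1)) q"

lemma has_sum_lattice_row:
  assumes "Im \<tau> > 0" "k \<in> {2, 4, 6}"
  shows "((\<lambda>n. 1 / lattice_pt \<tau> (int (Suc j)) n ^ k) has_sum
            ((2 * of_real pi * \<i>) ^ k / fact (k - 1) * pser (pow_coeff (k - 1)) (nome \<tau> ^ Suc j))) UNIV"
proof -
  have "Im (of_nat (Suc j) * \<tau>) > 0" using assms by (simp del: of_nat_Suc)
  from lipschitz_formula[OF this, of "k - 1"] assms(2)
  have "((\<lambda>n::int. 1 / (of_nat (Suc j) * \<tau> + of_int n) ^ k) has_sum
      ((- 2 * of_real pi * \<i>) ^ k / fact (k - 1) * pser (pow_coeff (k - 1)) (nome (of_nat (Suc j) * \<tau>)))) UNIV"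
    by (auto simp del: of_nat_Suc)
  moreover have "(- 2 * of_real pi * \<i>) ^ k = (2 * of_real pi * \<i>) ^ k"
    using assms(2) power_minus_even[of k "2 * of_real pi * \<i>"] by auto
  ultimately show ?thesis unfolding nome_mult_nat by simp
qed

lemma has_sum_rows_pser:
  assumes "Im \<tau> > 0"
  shows "((\<lambda>j. c * pser (pow_coeff k) (nome \<tau> ^ Suc j)) has_sum (c * pser (sigma_coeff k) (nome \<tau>))) UNIV"
  by (intro has_sum_cmult_right lambert_series norm_nome_less_1 assms)

lemma has_sum_eisenstein:
  assumes "Im \<tau> > 0" "k \<in> {4, 6}"
  shows "((\<lambda>(m, n). 1 / lattice_pt \<tau> m n ^ k) has_sum eisenstein k (nome \<tau>)) punctured"
proof -
  have k: "k \<in> {2, 4, 6}" "k \<ge> 3" "even k" using assms(2) by auto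
  obtain S where S: "((\<lambda>(m, n). 1 / lattice_pt \<tau> m n ^ k) has_sum S) punctured"
    using summable_on_lattice_powers[OF assms(1) k(2)] by (auto simp: summable_on_def)
  have "((\<lambda>j. (2 * of_real pi * \<i>) ^ k / fact (k - 1) * pser (pow_coeff (k - 1)) (nome \<tau> ^ Suc j))
     has_sum ((S - 2 * zeta_even k) / 2)) UNIV"
  proof (rule has_sum_lattice_rows[OF S])
    show "(\<lambda>(m, n). 1 / lattice_pt \<tau> m n ^ k) (- m, - n) = (\<lambda>(m, n). 1 / lattice_pt \<tau> m n ^ k) (m, n)" for m n
      using power_minus_even[OF k(3), of "lattice_pt \<tau> m n"] by (simp add: algebra_simps)
    show "((\<lambda>n. (\<lambda>(m, n). 1 / lattice_pt \<tau> m n ^ k) (0, n)) has_sum 2 * zeta_even k) (- {0})"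
      using has_sum_zeta_even_int[OF k(1)] by simp
  qed (use has_sum_lattice_row[OF assms(1) k(1)] in auto)
  from has_sum_unique[OF this has_sum_rows_pser[OF assms(1)]]
  have "S = eisenstein k (nome \<tau>)" by (simp add: eisenstein_def field_simps)
  thus ?thesis using S by simp
qed

lemma g2_eq_eisenstein: "Im \<tau> > 0 \<Longrightarrow> g2 \<tau> = 60 * eisenstein 4 (nome \<tau>)"
  using infsumI[OF has_sum_eisenstein[of \<tau> 4]] by (simp add: g2_def)

lemma g3_eq_eisenstein: "Im \<tau> > 0 \<Longrightarrow> g3 \<tau> = 140 * eisenstein 6 (nome \<tau>)"
  using infsumI[OF has_sum_eisenstein[of \<tau> 6]] by (simp add: g3_def)

subsection \<open>Quasi-modularity of the Weierstrass zeta value\<close>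

lemma finite_lattice_pts:
  assumes "Im \<tau> > 0"
  shows "finite {(m, n). norm (lattice_pt \<tau> m n) < r}"
proof -
  obtain \<delta> where \<delta>: "\<delta> > 0" "\<And>m n. norm (lattice_pt \<tau> m n) \<ge> \<delta> * (\<bar>of_int m\<bar> + \<bar>of_int n\<bar>)"
    using lattice_pt_lower_bound[OF assms] by metis
  define N where "N = \<lceil>r / \<delta>\<rceil>"
  have "{(m, n). norm (lattice_pt \<tau> m n) < r} \<subseteq> {-N..N} \<times> {-N..N}"
  proof clarify
    fix m n assume "norm (lattice_pt \<tau> m n) < r"
    hence "\<delta> * (\<bar>of_int m\<bar> + \<bar>of_int n\<bar>) < r" using \<delta>(2)[of m n] by linarith
    hence "\<bar>real_of_int m\<bar> + \<bar>real_of_int n\<bar> < r / \<delta>" using \<delta>(1) by (simp add: field_simps)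
    also have "\<dots> \<le> of_int N" unfolding N_def by (rule le_of_int_ceiling)
    finally have "real_of_int (\<bar>m\<bar> + \<bar>n\<bar>) < real_of_int N" by simp
    hence "\<bar>m\<bar> + \<bar>n\<bar> < N" by (simp only: of_int_less_iff)
    thus "m \<in> {-N..N} \<and> n \<in> {-N..N}" by auto
  qed
  thus ?thesis by (rule finite_subset) auto
qed

text \<open>The three terms combine to z^2 / (w^2 (z - w)), which is of order |w|^(-3) once the
  finitely many w with |w| < 2 |z| are set aside.\<close>

lemma summable_on_weierstrass_zeta:
  assumes "Im \<tau> > 0" "\<And>m n. z \<noteq> lattice_pt \<tau> m n"
  shows "(\<lambda>(m, n). 1 / (z - lattice_pt \<tau> m n) + 1 / lattice_pt \<tau> m n + z / lattice_pt \<tau> m n ^ 2) summable_on punctured"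
    (is "?f summable_on _")
proof -
  define A where "A = {(m, n). norm (lattice_pt \<tau> m n) < 2 * norm z}"
  have "finite A" unfolding A_def by (rule finite_lattice_pts[OF assms(1)])
  have "(\<lambda>p. norm (?f p)) summable_on (punctured - A)"
  proof (rule Infinite_Sum.abs_summable_on_comparison_test')
    show "(\<lambda>p. 2 * norm z ^ 2 * (case p of (m, n) \<Rightarrow> 1 / norm (lattice_pt \<tau> m n) ^ 3)) summable_on punctured - A"
      by (rule summable_on_subset_banach[where A = punctured])
         (auto intro!: summable_on_cmult_right summable_on_lattice_cubes assms)
    fix p assume p: "p \<in> punctured - A"
    obtain m n where mn: "p = (m, n)" by force
    define w where "w = lattice_pt \<tau> m n"
    have w: "w \<noteq> 0" "z \<noteq> w" "norm w \<ge> 2 * norm z"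
      using p assms lattice_pt_eq_0_iff[OF assms(1), of m n] by (auto simp: w_def mn A_def)
    have "1 / (z - w) + 1 / w + z / w ^ 2 = z ^ 2 / (w ^ 2 * (z - w))"
      using w by (simp add: field_simps power2_eq_square)
    hence "norm (?f p) = norm z ^ 2 / (norm w ^ 2 * norm (z - w))"
      by (simp add: mn w_def[symmetric] norm_divide norm_mult norm_power)
    also have "\<dots> \<le> norm z ^ 2 / (norm w ^ 2 * (norm w / 2))"
    proof -
      have "norm w - norm z \<le> norm (z - w)" using norm_triangle_ineq2[of w z] by (simp add: norm_minus_commute)
      hence "norm w / 2 \<le> norm (z - w)" using w(3) by simp
      thus ?thesis using w(1) by (intro divide_left_mono mult_left_mono mult_pos_pos) auto
    qed
    also have "\<dots> = 2 * norm z ^ 2 * (1 / norm w ^ 3)"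
      using w(1) by (simp add: field_simps power2_eq_square power3_eq_cube)
    finally show "norm (?f p) \<le> 2 * norm z ^ 2 * (case p of (m, n) \<Rightarrow> 1 / norm (lattice_pt \<tau> m n) ^ 3)"
      by (simp add: mn w_def)
  qed
  hence "?f summable_on (punctured - A)" by (rule abs_summable_summable)
  moreover have "?f summable_on (punctured \<inter> A)" using \<open>finite A\<close> by (intro summable_on_finite) auto
  ultimately have "?f summable_on ((punctured - A) \<union> (punctured \<inter> A))"
    by (rule summable_on_Un_disjoint) auto
  moreover have "(punctured - A) \<union> (punctured \<inter> A) = punctured" by blast
  ultimately show ?thesis by (simp only:)
qed

lemma nome_add: "nome (a + b) = nome a * nome b"
  by (simp add: nome_def ring_distribs exp_add)

lemma has_sum_diff:
  fixes f g :: "'a \<Rightarrow> 'b::{topological_ab_group_add}"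
  assumes "(f has_sum a) A" "(g has_sum b) A"
  shows "((\<lambda>x. f x - g x) has_sum (a - b)) A"
  using has_sum_add[OF assms(1), of "\<lambda>x. - g x" "- b"] assms(2) by (simp add: has_sum_uminus)

definition pi_cot :: "complex \<Rightarrow> complex" where
  "pi_cot z = of_real pi * cot (of_real pi * z)"

lemma pi_cot_minus: "pi_cot (- z) = - pi_cot z"
  by (simp add: pi_cot_def)

text \<open>Symmetrizing the defining series under \<open>w \<mapsto> - w\<close> makes every row a difference of an
  Eisenstein row and a difference of cotangents.\<close>

lemma has_sum_weierstrass_zeta_rows:
  assumes "Im \<tau> > 0" "\<And>m n. z \<noteq> lattice_pt \<tau> m n"
  shows "((\<lambda>j. pi_cot (of_nat (Suc j) * \<tau> - z) - pi_cot (of_nat (Suc j) * \<tau> + z)) has_sum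
            (z * eisenstein 2 (nome \<tau>) + pi_cot z - weierstrass_zeta z \<tau>)) UNIV"
proof -
  let ?w = "lattice_pt \<tau>"
  define t where "t = (\<lambda>(m, n). 1 / (z - ?w m n) + 1 / ?w m n + z / ?w m n ^ 2)"
  define T where "T = infsum t punctured"
  have T: "(t has_sum T) punctured"
    using summable_on_weierstrass_zeta[OF assms] by (simp add: t_def T_def)
  have "bij_betw (\<lambda>(m, n). (- m, - n)) punctured punctured"
    by (rule bij_betwI[where g = "\<lambda>(m, n). (- m, - n)"]) auto
  from has_sum_reindex_bij_betw[OF this, of t T] T
  have T': "((\<lambda>p. t (case p of (m, n) \<Rightarrow> (- m, - n))) has_sum T) punctured" by simp
  define u where "u = (\<lambda>p. t p + t (case p of (m, n) \<Rightarrow> (- m, - n)))"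
  have U: "(u has_sum (T + T)) punctured"
    unfolding u_def by (rule has_sum_add[OF T T'])
  have nz: "?w m n - z \<noteq> 0" "?w m n + z \<noteq> 0" for m n
  proof -
    show "?w m n - z \<noteq> 0" using assms(2)[of m n] by simp
    have "- ?w m n = ?w (- m) (- n)" by simp
    hence "z \<noteq> - ?w m n" using assms(2)[of "- m" "- n"] by metis
    thus "?w m n + z \<noteq> 0" by (metis add.commute add_eq_0_iff)
  qed
  have u_eq: "u (m, n) = 2 * z * (1 / ?w m n ^ 2) - (1 / (?w m n - z) - 1 / (?w m n + z))"
    for m n
  proof -
    define w where "w = ?w m n"
    have "?w (- m) (- n) = - w" by (simp add: w_def)
    hence "t (- m, - n) = 1 / (z - - w) + 1 / (- w) + z / (- w) ^ 2"
      by (simp only: t_def split_conv)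
    also have "\<dots> = 1 / (w + z) - 1 / w + z / w ^ 2" by (simp add: add.commute)
    finally have 1: "t (- m, - n) = 1 / (w + z) - 1 / w + z / w ^ 2" .
    have 2: "1 / (z - w) = - (1 / (w - z))"
      by (metis minus_diff_eq minus_divide_right)
    have "t (m, n) = - (1 / (w - z)) + 1 / w + z / w ^ 2"
      by (simp only: t_def split_conv w_def[symmetric] 2)
    with 1 show ?thesis by (simp add: u_def flip: w_def)
  qed
  have ni: "of_int m * \<tau> - z \<notin> \<int>" "of_int m * \<tau> + z \<notin> \<int>" for m
  proof -
    show "of_int m * \<tau> - z \<notin> \<int>"
    proof
      assume "of_int m * \<tau> - z \<in> \<int>"
      then obtain k where "of_int m * \<tau> - z = of_int k" by (auto elim: Ints_cases)
      hence "?w m (- k) - z = 0" by (simp add: algebra_simps)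
      thus False using nz by blast
    qed
    show "of_int m * \<tau> + z \<notin> \<int>"
    proof
      assume "of_int m * \<tau> + z \<in> \<int>"
      then obtain k where "of_int m * \<tau> + z = of_int k" by (auto elim: Ints_cases)
      hence "?w m (- k) + z = 0" by (simp add: algebra_simps)
      thus False using nz by blast
    qed
  qed
  have cots: "((\<lambda>n. 1 / (?w m n - z) - 1 / (?w m n + z)) has_sum
      (pi_cot (of_int m * \<tau> - z) - pi_cot (of_int m * \<tau> + z))) UNIV" for m
    using cot_partial_fractions[OF ni] unfolding pi_cot_def by (simp add: algebra_simps)
  define s where "s = (\<lambda>j. (2 * of_real pi * \<i>) ^ 2 / fact (2 - 1) * pser (pow_coeff (2 - 1)) (nome \<tau> ^ Suc j))"
  \<comment> \<open>The row m = 0 lacks its term n = 0. In the cotangent difference that term is -2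
    / z, and removing it accounts for the summand -2 / z of \<open>R0\<close>.\<close>
  define R0 where "R0 = 2 * z * (2 * zeta_even 2) + 2 * pi_cot z - 2 / z"
  have z0: "z \<noteq> 0" using assms(2)[of 0 0] by simp
  have "((\<lambda>j. 2 * z * s j - (pi_cot (of_int (int (Suc j)) * \<tau> - z) - pi_cot (of_int (int (Suc j)) * \<tau> + z)))
      has_sum ((T + T - R0) / 2)) UNIV"
  proof (rule has_sum_lattice_rows[OF U])
    show "u (- m, - n) = u (m, n)" for m n by (simp add: u_def add.commute)
    show "((\<lambda>n. u (int (Suc j), n)) has_sum 2 * z * s j -
        (pi_cot (of_int (int (Suc j)) * \<tau> - z) - pi_cot (of_int (int (Suc j)) * \<tau> + z))) UNIV" for j
      unfolding u_eq s_def
      by (intro has_sum_diff has_sum_cmult_right cots has_sum_lattice_row assms) auto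
    have "((\<lambda>n. 1 / (?w 0 n - z) - 1 / (?w 0 n + z)) has_sum (- 2 * pi_cot z)) UNIV"
      using cots[of 0] by (simp add: pi_cot_minus)
    moreover have "((\<lambda>n. 1 / (?w 0 n - z) - 1 / (?w 0 n + z)) has_sum (- 2 / z)) {0}"
      using z0 by (intro has_sum_finiteI) (auto simp: field_simps)
    ultimately have "((\<lambda>n. 1 / (?w 0 n - z) - 1 / (?w 0 n + z)) has_sum (- 2 * pi_cot z - (- 2 / z))) (UNIV - {0})"
      by (rule has_sum_Diff) auto
    hence "((\<lambda>n. 1 / (?w 0 n - z) - 1 / (?w 0 n + z)) has_sum (- 2 * pi_cot z + 2 / z)) (- {0})"
      by (simp add: Compl_eq_Diff_UNIV)
    moreover have "((\<lambda>n. 1 / ?w 0 n ^ 2) has_sum 2 * zeta_even 2) (- {0})"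
      using has_sum_zeta_even_int[of 2] by simp
    ultimately have "((\<lambda>n. u (0, n)) has_sum (2 * z * (2 * zeta_even 2) - (- 2 * pi_cot z + 2 / z))) (- {0})"
      unfolding u_eq by (intro has_sum_diff has_sum_cmult_right)
    thus "((\<lambda>n. u (0, n)) has_sum R0) (- {0})" by (simp add: R0_def algebra_simps)
  qed
  from has_sum_diff[OF has_sum_cmult_right[OF has_sum_rows_pser[OF assms(1), of "(2 * of_real pi * \<i>) ^ 2 / fact (2 - 1)" "2 - 1"], of "2 * z"] this]
  have "((\<lambda>j. pi_cot (of_nat (Suc j) * \<tau> - z) - pi_cot (of_nat (Suc j) * \<tau> + z)) has_sum
      (2 * z * ((2 * of_real pi * \<i>) ^ 2 / fact (2 - 1) * pser (sigma_coeff (2 - 1)) (nome \<tau>)) - (T + T - R0) / 2)) UNIV"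
    by (simp add: s_def)
  moreover have "weierstrass_zeta z \<tau> = 1 / z + T"
    unfolding weierstrass_zeta_def T_def t_def by simp
  ultimately show ?thesis
    by (simp add: R0_def eisenstein_def algebra_simps diff_divide_distrib add_divide_distrib)
qed

text \<open>At z = 1/2 every row is a difference of cotangents at points one period apart and
  vanishes; the remaining cotangent, at pi / 2, vanishes too.\<close>

theorem eta1_eq_eisenstein:
  assumes "Im \<tau> > 0"
  shows "eta1 \<tau> = eisenstein 2 (nome \<tau>)"
proof -
  have ni: "1/2 \<noteq> lattice_pt \<tau> m n" for m n
  proof
    assume *: "1/2 = lattice_pt \<tau> m n"
    hence "Im (1/2) = Im (lattice_pt \<tau> m n)" by (rule arg_cong)
    hence "m = 0" using assms by simp
    hence "(1/2::complex) = of_int n" using * by simp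
    hence "(1/2::complex) \<in> \<int>" by (metis Ints_of_int)
    thus False using fraction_not_in_Ints[where 'a = complex, of 2 1] by simp
  qed
  have "pi_cot (a + 1/2) = pi_cot (a - 1/2)" for a
  proof -
    have e: "of_real pi * (a + 1/2) = of_real pi * (a - 1/2) + of_real pi" by (simp add: algebra_simps)
    show ?thesis unfolding pi_cot_def e by (simp add: cot_def sin_add cos_add)
  qed
  hence "((\<lambda>j::nat. 0) has_sum (1/2 * eisenstein 2 (nome \<tau>) + pi_cot (1/2) - weierstrass_zeta (1/2) \<tau>)) UNIV"
    using has_sum_weierstrass_zeta_rows[OF assms ni] by simp
  hence "1/2 * eisenstein 2 (nome \<tau>) + pi_cot (1/2) - weierstrass_zeta (1/2) \<tau> = 0"
    using has_sum_unique has_sum_0_simp by blast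
  moreover have "pi_cot (1/2) = 0"
  proof -
    have "of_real pi * (1/2) = complex_of_real (pi / 2)" by simp
    hence "cos (complex_of_real pi * (1/2)) = 0" by (simp only: cos_of_real cos_pi_half of_real_0)
    thus ?thesis by (simp add: pi_cot_def cot_def)
  qed
  ultimately show ?thesis by (simp add: eta1_def)
qed

text \<open>At z = tau / 2 the rows telescope: they are differences of consecutive values of pi
  cot(pi (j + 1/2) tau), which tend to -pi i because the nome at these points tends to 0.\<close>

lemma legendre_relation:
  assumes "Im \<tau> > 0"
  shows "weierstrass_zeta (\<tau> / 2) \<tau> = \<tau> / 2 * eisenstein 2 (nome \<tau>) - of_real pi * \<i>"
proof -
  have ni: "\<tau> / 2 \<noteq> lattice_pt \<tau> m n" for m n
  proof
    assume "\<tau> / 2 = lattice_pt \<tau> m n"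
    hence "Im (\<tau> / 2) = Im (lattice_pt \<tau> m n)" by (rule arg_cong)
    hence "Im \<tau> * (real_of_int (2 * m) - 1) = 0" by (simp add: algebra_simps)
    hence "real_of_int (2 * m) = of_int 1" using assms by simp
    hence "2 * m = 1" by (simp only: of_int_eq_iff)
    thus False by presburger
  qed
  define f where "f = (\<lambda>j::nat. pi_cot ((of_nat j + 1/2) * \<tau>))"
  have "(\<lambda>j. pi_cot (of_nat (Suc j) * \<tau> - \<tau> / 2) - pi_cot (of_nat (Suc j) * \<tau> + \<tau> / 2)) = (\<lambda>j. f j - f (Suc j))"
    by (simp add: fun_eq_iff f_def algebra_simps)
  hence s1: "(\<lambda>j. f j - f (Suc j)) sums (\<tau> / 2 * eisenstein 2 (nome \<tau>) + pi_cot (\<tau> / 2) - weierstrass_zeta (\<tau> / 2) \<tau>)"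
    using has_sum_imp_sums[OF has_sum_weierstrass_zeta_rows[OF assms ni]] by simp
  have "f \<longlonglongrightarrow> - of_real pi * \<i> - 2 * of_real pi * \<i> * pser (pow_coeff 0) 0"
  proof -
    have "(\<lambda>j. nome \<tau> ^ j) \<longlonglongrightarrow> 0"
      by (rule LIMSEQ_power_zero[OF norm_nome_less_1[OF assms]])
    hence "(\<lambda>j. nome \<tau> ^ j * nome (\<tau> / 2)) \<longlonglongrightarrow> 0 * nome (\<tau> / 2)"
      by (intro tendsto_mult tendsto_const)
    also have "(\<lambda>j. nome \<tau> ^ j * nome (\<tau> / 2)) = (\<lambda>j. nome ((of_nat j + 1/2) * \<tau>))"
    proof
      fix j :: nat
      have "(of_nat j + 1/2) * \<tau> = of_nat j * \<tau> + \<tau> / 2" by (simp add: algebra_simps)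
      thus "nome \<tau> ^ j * nome (\<tau> / 2) = nome ((of_nat j + 1/2) * \<tau>)"
        by (simp only: nome_add nome_mult_nat)
    qed
    finally have 1: "(\<lambda>j. nome ((of_nat j + 1/2) * \<tau>)) \<longlonglongrightarrow> 0" by simp
    obtain d where "(pser (pow_coeff 0) has_field_derivative d) (at 0)"
      using has_field_derivative_pser[OF unit_series_pow_coeff[of 0], of 0] by auto
    hence cont: "isCont (pser (pow_coeff 0)) 0" by (rule DERIV_isCont)
    have "f j = - of_real pi * \<i> - 2 * of_real pi * \<i> * pser (pow_coeff 0) (nome ((of_nat j + 1/2) * \<tau>))" for j
    proof -
      have "(of_nat j + 1/2) * \<tau> = of_real (real j + 1/2) * \<tau>" by simp
      hence "Im ((of_nat j + 1/2) * \<tau>) = (real j + 1/2) * Im \<tau>" by (simp only: Im_complex_of_real Re_complex_of_real times_complex.simps)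
      hence "Im ((of_nat j + 1/2) * \<tau>) > 0" using assms by simp
      thus ?thesis unfolding f_def pi_cot_def by (rule pi_cot_nome)
    qed
    hence fe: "f = (\<lambda>j. - of_real pi * \<i> - 2 * of_real pi * \<i> * pser (pow_coeff 0) (nome ((of_nat j + 1/2) * \<tau>)))"
      by (rule ext)
    from isCont_tendsto_compose[OF cont 1]
    have "(\<lambda>j. - of_real pi * \<i> - 2 * of_real pi * \<i> * pser (pow_coeff 0) (nome ((of_nat j + 1/2) * \<tau>)))
        \<longlonglongrightarrow> - of_real pi * \<i> - 2 * of_real pi * \<i> * pser (pow_coeff 0) 0"
      by (intro tendsto_intros)
    thus ?thesis unfolding fe .
  qed
  also have "pser (pow_coeff 0) 0 = 0" unfolding pser_def powser_zero by (simp add: pow_coeff_def)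
  finally have "f \<longlonglongrightarrow> - of_real pi * \<i>" by simp
  from telescope_sums'[OF this] have "(\<lambda>j. f j - f (Suc j)) sums (f 0 - (- of_real pi * \<i>))" .
  from sums_unique2[OF s1 this] show ?thesis by (simp add: f_def algebra_simps)
qed

text \<open>Homogeneity turns \<open>\<zeta>(1/2; -1/\<tau>)\<close> into \<open>\<tau> \<zeta>(\<tau>/2; \<tau>)\<close>, which Legendre's relation evaluates.\<close>

theorem eta1_inversion:
  assumes "Im \<tau> > 0"
  shows "eta1 (- 1 / \<tau>) = \<tau> ^ 2 * eta1 \<tau> - 2 * of_real pi * \<i> * \<tau>"
proof -
  have \<tau>: "\<tau> \<noteq> 0" using assms by auto
  define h where "h = (\<lambda>p. case p of (m, n) \<Rightarrow> 1 / (\<tau> / 2 - lattice_pt \<tau> m n) + 1 / lattice_pt \<tau> m n + \<tau> / 2 / lattice_pt \<tau> m n ^ 2)"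
  have "(\<Sum>\<^sub>\<infinity>(m, n)\<in>punctured. 1 / (1/2 - lattice_pt (- 1 / \<tau>) m n) + 1 / lattice_pt (- 1 / \<tau>) m n
           + 1/2 / lattice_pt (- 1 / \<tau>) m n ^ 2) = infsum (\<lambda>p. \<tau> * h p) punctured"
  \<comment> \<open>The lattice of -1/tau is the lattice of tau divided by tau: m (-1/tau) + n = (n
    tau - m) / tau.\<close>
  proof (rule infsum_reindex_bij_witness[where i = "\<lambda>(m, n). (- n, m)" and j = "\<lambda>(m, n). (n, - m)"])
    fix p assume p: "p \<in> punctured"
    obtain m n where mn: "p = (m, n)" by force
    define w where "w = lattice_pt \<tau> n (- m)"
    have "lattice_pt (- 1 / \<tau>) m n = w / \<tau>" using \<tau> by (simp add: w_def field_simps)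
    moreover have "1 / (1/2 - w / \<tau>) + 1 / (w / \<tau>) + 1/2 / (w / \<tau>) ^ 2 =
        \<tau> * (1 / (\<tau> / 2 - w) + 1 / w + \<tau> / 2 / w ^ 2)"
    proof -
      have "1/2 - w / \<tau> = (\<tau> / 2 - w) / \<tau>" using \<tau> by (simp add: field_simps)
      hence "1 / (1/2 - w / \<tau>) = \<tau> * (1 / (\<tau> / 2 - w))" by (simp only: divide_divide_eq_right mult_1_left) simp
      thus ?thesis by (simp add: power_divide distrib_left power2_eq_square)
    qed
    ultimately show "\<tau> * h (case p of (m, n) \<Rightarrow> (n, - m)) =
        (case p of (m, n) \<Rightarrow> 1 / (1/2 - lattice_pt (- 1 / \<tau>) m n) + 1 / lattice_pt (- 1 / \<tau>) m n
           + 1/2 / lattice_pt (- 1 / \<tau>) m n ^ 2)"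
      by (simp only: mn h_def split_conv w_def)
  qed auto
  also have "\<dots> = \<tau> * infsum h punctured" by (rule infsum_cmult_right')
  finally have "weierstrass_zeta (1/2) (- 1 / \<tau>) = \<tau> * weierstrass_zeta (\<tau> / 2) \<tau>"
    using \<tau> by (simp add: weierstrass_zeta_def h_def distrib_left)
  thus ?thesis using eta1_eq_eisenstein[OF assms]
    by (simp add: eta1_def legendre_relation[OF assms] power2_eq_square algebra_simps)
qed

section \<open>Modularity of the lattice sums\<close>

lemma lattice_sum_modular:
  fixes a b c d :: int
  assumes "a * d - b * c = 1" and nz: "of_int c * \<tau> + of_int d \<noteq> 0"
  shows "(\<Sum>\<^sub>\<infinity>(m, n)\<in>punctured. 1 / lattice_pt ((of_int a * \<tau> + of_int b) / (of_int c * \<tau> + of_int d)) m n ^ k)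
       = (of_int c * \<tau> + of_int d) ^ k * (\<Sum>\<^sub>\<infinity>(m, n)\<in>punctured. 1 / lattice_pt \<tau> m n ^ k)"
proof -
  define j where "j = of_int c * \<tau> + of_int d"
  define h where "h = (\<lambda>p. case p of (m, n) \<Rightarrow> 1 / lattice_pt \<tau> m n ^ k)"
  have "(\<Sum>\<^sub>\<infinity>(m, n)\<in>punctured. 1 / lattice_pt ((of_int a * \<tau> + of_int b) / j) m n ^ k)
     = infsum (\<lambda>p. j ^ k * h p) punctured"
  \<comment> \<open>A matrix of determinant 1 permutes the nonzero index pairs, and each lattice
    point is divided by the cocycle c tau + d.\<close>
  proof (rule infsum_reindex_bij_witness[where i = "\<lambda>(m, n). (d * m - c * n, a * n - b * m)"
          and j = "\<lambda>(m, n). (a * m + c * n, b * m + d * n)"])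
    fix p assume p: "p \<in> punctured"
    obtain m n where mn: "p = (m, n)" by force
    have 1: "d * (a * m + c * n) - c * (b * m + d * n) = (a * d - b * c) * m"
      "a * (b * m + d * n) - b * (a * m + c * n) = (a * d - b * c) * n" by (simp_all add: algebra_simps)
    show *: "(case case p of (m, n) \<Rightarrow> (a * m + c * n, b * m + d * n) of (m, n) \<Rightarrow> (d * m - c * n, a * n - b * m)) = p"
      unfolding mn using 1 assms(1) by simp
    have 2: "a * (d * m - c * n) + c * (a * n - b * m) = (a * d - b * c) * m"
      "b * (d * m - c * n) + d * (a * n - b * m) = (a * d - b * c) * n" by (simp_all add: algebra_simps)
    show **: "(case case p of (m, n) \<Rightarrow> (d * m - c * n, a * n - b * m) of (m, n) \<Rightarrow> (a * m + c * n, b * m + d * n)) = p"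
      unfolding mn using 2 assms(1) by simp
    show "(case p of (m, n) \<Rightarrow> (a * m + c * n, b * m + d * n)) \<in> punctured" using p * by (auto simp: mn)
    show "(case p of (m, n) \<Rightarrow> (d * m - c * n, a * n - b * m)) \<in> punctured" using p ** by (auto simp: mn)
    have "lattice_pt ((of_int a * \<tau> + of_int b) / j) m n = lattice_pt \<tau> (a * m + c * n) (b * m + d * n) / j"
      using nz by (simp add: j_def field_simps)
    thus "j ^ k * h (case p of (m, n) \<Rightarrow> (a * m + c * n, b * m + d * n)) =
       (case p of (m, n) \<Rightarrow> 1 / lattice_pt ((of_int a * \<tau> + of_int b) / j) m n ^ k)"
      by (simp only: mn h_def split_conv power_divide divide_divide_eq_right mult_1_left mult_1_right times_divide_eq_right)
  qed
  also have "\<dots> = j ^ k * infsum h punctured" by (rule infsum_cmult_right')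
  finally show ?thesis by (simp add: j_def h_def)
qed

lemma g2_modular:
  fixes a b c d :: int
  assumes "a * d - b * c = 1" "of_int c * \<tau> + of_int d \<noteq> 0"
  shows "g2 ((of_int a * \<tau> + of_int b) / (of_int c * \<tau> + of_int d)) = (of_int c * \<tau> + of_int d) ^ 4 * g2 \<tau>"
  unfolding g2_def lattice_sum_modular[OF assms] by simp

lemma g3_modular:
  fixes a b c d :: int
  assumes "a * d - b * c = 1" "of_int c * \<tau> + of_int d \<noteq> 0"
  shows "g3 ((of_int a * \<tau> + of_int b) / (of_int c * \<tau> + of_int d)) = (of_int c * \<tau> + of_int d) ^ 6 * g3 \<tau>"
  unfolding g3_def lattice_sum_modular[OF assms] by simp

subsection \<open>Ramanujan's formula\<close>

lemma nome_surj:
  assumes "q \<noteq> 0"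
  obtains \<tau> where "nome \<tau> = q" "Im \<tau> = - ln (norm q) / (2 * pi)"
proof
  let ?\<tau> = "Ln q / (2 * of_real pi * \<i>)"
  show "nome ?\<tau> = q" using assms by (simp add: nome_def)
  have "?\<tau> = - \<i> * Ln q / of_real (2 * pi)" by (simp add: field_simps)
  hence "Im ?\<tau> = - Re (Ln q) / (2 * pi)" by (simp only: Im_divide_of_real) simp
  thus "Im ?\<tau> = - ln (norm q) / (2 * pi)" using assms by simp
qed

lemma nome_of_int: "nome (of_int k) = 1"
proof -
  have "of_int k \<in> (\<int> :: real set)" by (rule Ints_of_int)
  from exp_integer_2pi[OF this] show ?thesis by (simp add: nome_def mult_ac)
qed

text \<open>Schwarz's lemma for z -> F(r z) / K'. It requires values strictly inside the unit disc,
  so it is applied for every K' > K, and K' then tends to K.\<close>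

lemma schwarz_scaled:
  assumes "F holomorphic_on ball 0 1" "F 0 = 0" "0 < r" "r \<le> 1"
    and bd: "\<And>q. norm q < r \<Longrightarrow> norm (F q) \<le> K" and q: "norm q < r"
  shows "norm (F q) \<le> K * norm q / r"
proof -
  have K0: "K \<ge> 0" using bd[of 0] assms(3) by (metis norm_ge_zero norm_zero order_trans)
  have *: "norm (F q) \<le> K' * (norm q / r)" if K': "K' > K" for K'
  proof -
    define g where "g = (\<lambda>z. F (of_real r * z) / of_real K')"
    have rz: "norm (of_real r * z) < r" if "norm z < 1" for z :: complex
      using that assms(3) by (simp add: norm_mult)
    have "(\<lambda>z. F (of_real r * z)) holomorphic_on ball 0 1"
      using rz assms(4) by (intro holomorphic_on_compose_gen[OF _ assms(1), unfolded o_def] holomorphic_intros) force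
    hence "g holomorphic_on ball 0 1"
      unfolding g_def using K' K0 by (intro holomorphic_intros) auto
    moreover have "g 0 = 0" using assms(2) by (simp add: g_def)
    moreover have "norm (g z) < 1" if "norm z < 1" for z
      using bd[OF rz[OF that]] K' K0 by (simp add: g_def norm_divide)
    moreover have n: "norm (q / of_real r) < 1" using q assms(3) by (simp add: norm_divide)
    ultimately have "norm (g (q / of_real r)) \<le> norm (q / of_real r)"
      by (rule Schwarz_Lemma)
    thus ?thesis using K' K0 assms(3) by (simp add: g_def norm_divide field_simps)
  qed
  show ?thesis
  proof (cases "q = 0")
    case False
    hence p: "norm q / r > 0" using assms(3) by simp
    have "norm (F q) / (norm q / r) \<le> K"
    proof (rule dense_ge)
      fix K' assume "K < K'"
      from *[OF this] show "norm (F q) / (norm q / r) \<le> K'" using p by (subst pos_divide_le_eq) auto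
    qed
    thus ?thesis using p by (subst (asm) pos_divide_le_eq) auto
  qed (use assms in auto)
qed

text \<open>A cusp form of weight 8 vanishes. With \<open>M = sup {|f| y\<^sup>4 : y \<ge> \<surd>3/2}\<close>, one inversion bounds
  \<open>|f| y\<^sup>4\<close> by \<open>M\<close> on the larger half-plane \<open>y > 7/10\<close>; the Schwarz lemma in the nome then
  improves the bound on \<open>y \<ge> \<surd>3/2\<close> to \<open>c M\<close> with \<open>c < 1\<close>.\<close>

lemma cusp_form_weight_8_eq_0:
  assumes holo: "F holomorphic_on ball 0 1" and F0: "F 0 = 0"
    and inv: "\<And>\<tau>. Im \<tau> > 0 \<Longrightarrow> F (nome (- 1 / \<tau>)) = \<tau> ^ 8 * F (nome \<tau>)"
    and t: "Im \<tau>0 > 0"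
  shows "F (nome \<tau>0) = 0"
proof -
  define s where "s = sqrt 3 / 2"
  \<comment> \<open>The radius of the disc that corresponds to Im tau > 7/10. This level must lie
    below sqrt 3 / 2, which leaves room for Schwarz's lemma, and above 2 / pi, so that the decay of
    the nome beats the growth of y^4 below.\<close>
  define r where "r = exp (- 2 * pi * (7/10))"
  have s: "s > 43/50" "s < 1" "s ^ 2 = 3/4"
  proof -
    have "(43/25 :: real) < sqrt 3" by (rule real_less_rsqrt) (simp add: power2_eq_square)
    thus "s > 43/50" by (simp add: s_def)
    have "sqrt 3 < (2::real)" by (rule real_less_lsqrt) auto
    thus "s < 1" by (simp add: s_def)
    show "s ^ 2 = 3/4" by (simp add: s_def power_divide)
  qed
  have r: "0 < r" "r < 1" by (auto simp: r_def)
  have nome_r: "norm (nome \<tau>) < r \<longleftrightarrow> Im \<tau> > 7/10" for \<tau>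
    by (simp add: norm_nome r_def) linarith
  have nome_ratio: "norm (nome \<tau>) / r = exp (- 2 * pi * (Im \<tau> - 7/10))" for \<tau>
    by (simp add: norm_nome r_def flip: exp_diff) (simp add: algebra_simps)
  have y4: "y ^ 4 * exp (- 2 * pi * y) \<le> 1" if "y > 0" for y :: real
  proof -
    have "y \<le> exp y" using exp_ge_add_one_self[of y] by linarith
    hence "y ^ 4 \<le> exp y ^ 4" using that by (intro power_mono) auto
    also have "\<dots> = exp (4 * y)" by (simp flip: exp_of_nat_mult)
    also have "\<dots> \<le> exp (2 * pi * y)" using that pi_gt3 by auto
    finally show ?thesis by (simp add: exp_minus field_simps)
  qed
  obtain K where K: "\<And>q. norm q < r \<Longrightarrow> norm (F q) \<le> K"
  proof -
    have "continuous_on (cball 0 r) F"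
      using r by (intro holomorphic_on_imp_continuous_on holomorphic_on_subset[OF holo]) auto
    hence "bounded (F ` cball 0 r)" by (intro compact_imp_bounded compact_continuous_image) auto
    then obtain K where "\<forall>x\<in>F ` cball 0 r. norm x \<le> K" by (auto simp: bounded_iff)
    thus ?thesis using that[of K] by auto
  qed
  have K0: "K \<ge> 0" using K[of 0] r by (metis norm_ge_zero norm_zero order_trans)
  define G where "G = (\<lambda>\<tau>. norm (F (nome \<tau>)) * Im \<tau> ^ 4)"
  define A where "A = {\<tau>. Im \<tau> \<ge> s}"
  have bdd: "bdd_above (G ` A)"
  proof (rule bdd_aboveI2)
    fix \<tau> assume "\<tau> \<in> A"
    hence y: "Im \<tau> > 7/10" using s by (simp add: A_def)
    have "norm (F (nome \<tau>)) \<le> K * norm (nome \<tau>) / r"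
      by (rule schwarz_scaled[OF holo F0 _ _ K]) (use r nome_r y in auto)
    hence "G \<tau> \<le> K * norm (nome \<tau>) / r * Im \<tau> ^ 4"
      unfolding G_def using y by (intro mult_right_mono) auto
    also have "\<dots> = K / r * (Im \<tau> ^ 4 * exp (- 2 * pi * Im \<tau>))" by (simp add: norm_nome)
    also have "\<dots> \<le> K / r * 1" using y K0 r by (intro mult_left_mono y4) auto
    finally show "G \<tau> \<le> K / r" by simp
  qed
  define M where "M = Sup (G ` A)"
  have M: "G \<tau> \<le> M" if "\<tau> \<in> A" for \<tau>
    unfolding M_def using that bdd by (intro cSUP_upper)
  have "\<i> \<in> A" using s by (simp add: A_def)
  have "0 \<le> G \<i>" by (simp add: G_def)
  hence M0: "M \<ge> 0" using M[OF \<open>\<i> \<in> A\<close>] by linarith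
  have big: "G \<tau> \<le> M" if y: "Im \<tau> > 7/10" for \<tau>
  proof -
    define \<tau>' where "\<tau>' = \<tau> - of_int (round (Re \<tau>))"
    have n': "nome \<tau>' = nome \<tau>"
    proof -
      have "nome \<tau> = nome (\<tau>' + of_int (round (Re \<tau>)))" by (simp add: \<tau>'_def)
      also have "\<dots> = nome \<tau>'" unfolding nome_add by (simp add: nome_of_int)
      finally show ?thesis ..
    qed
    have im: "Im \<tau>' = Im \<tau>" by (simp add: \<tau>'_def)
    have re: "\<bar>Re \<tau>'\<bar> \<le> 1/2" using of_int_round_abs_le[of "Re \<tau>"] by (simp add: \<tau>'_def abs_minus_commute)
    show ?thesis
    proof (cases "Im \<tau> \<ge> s")
      case True thus ?thesis using M by (simp add: A_def)
    next
      case False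
      have y0: "Im \<tau>' > 0" using y im by simp
      have "Re \<tau>' ^ 2 \<le> (1/2) ^ 2" using re abs_le_square_iff[of "Re \<tau>'" "1/2"] by simp
      hence nn: "norm \<tau>' ^ 2 \<le> 1/4 + Im \<tau> ^ 2" unfolding cmod_power2 by (simp add: im power2_eq_square)
      have np: "norm \<tau>' > 0" using y0 by auto
      have im': "Im (- 1 / \<tau>') = Im \<tau> / norm \<tau>' ^ 2"
        by (simp add: Im_divide cmod_power2 im)
      have "s * (1/4 + Im \<tau> ^ 2) \<le> Im \<tau>"
      proof -
        \<comment> \<open>As s^2 = 3/4, this product equals y - s (1/4 + y^2) with y = Im tau. Since
          |tau'|^2 is at most 1/4 + y^2, its sign says that -1 / tau' has height at least s.\<close>
        have "(s - Im \<tau>) * (s * Im \<tau> - 1/4) \<ge> 0"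
        proof (rule mult_nonneg_nonneg)
          have "(43/50) * (7/10) \<le> s * Im \<tau>" using s y by (intro mult_mono) auto
          thus "s * Im \<tau> - 1/4 \<ge> 0" by simp
        qed (use False in simp)
        moreover have "(s - Im \<tau>) * (s * Im \<tau> - 1/4) = s ^ 2 * Im \<tau> - s / 4 - s * Im \<tau> ^ 2 + Im \<tau> / 4"
          by (simp add: field_simps power2_eq_square)
        ultimately have "0 \<le> s ^ 2 * Im \<tau> - s / 4 - s * Im \<tau> ^ 2 + Im \<tau> / 4" by linarith
        thus ?thesis unfolding s(3) distrib_left by linarith
      qed
      moreover have "s * norm \<tau>' ^ 2 \<le> s * (1/4 + Im \<tau> ^ 2)" using nn s(1) by (intro mult_left_mono) auto
      ultimately have "s * norm \<tau>' ^ 2 \<le> Im \<tau>" by linarith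
      hence "s \<le> Im \<tau> / norm \<tau>' ^ 2" using np by (simp add: pos_le_divide_eq)
      hence "- 1 / \<tau>' \<in> A" using im' by (simp add: A_def)
      hence "G (- 1 / \<tau>') \<le> M" by (rule M)
      moreover have "G (- 1 / \<tau>') = norm \<tau>' ^ 8 * norm (F (nome \<tau>)) * (Im \<tau> / norm \<tau>' ^ 2) ^ 4"
        unfolding G_def inv[OF y0] im' n' by (simp add: norm_mult norm_power)
      moreover have "norm \<tau>' ^ 8 * norm (F (nome \<tau>)) * (Im \<tau> / norm \<tau>' ^ 2) ^ 4 = G \<tau>"
        using np unfolding G_def by (simp add: power_divide flip: power_mult)
      ultimately show ?thesis by simp
    qed
  qed
  have small: "norm (F q) \<le> M / (7/10) ^ 4" if "norm q < r" for q
  proof (cases "q = 0")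
    case False
    then obtain \<tau> where \<tau>: "nome \<tau> = q" by (rule nome_surj)
    hence y: "Im \<tau> > 7/10" using that nome_r[of \<tau>] by simp
    hence "norm (F q) * (7/10) ^ 4 \<le> G \<tau>" unfolding G_def \<tau> by (intro mult_left_mono power_mono) auto
    also have "\<dots> \<le> M" by (rule big[OF y])
    finally show ?thesis by (simp add: field_simps)
  qed (use F0 M0 in auto)
  \<comment> \<open>In units x = y / (7/10) the gain is x^4 exp(-(7/5) pi (x - 1)), at most
    exp(-(3/10) (x - 1)) because (7/5) pi - 4 > 3/10; c is this bound at the smallest admissible
    x.\<close>
  define c where "c = exp (- (3/10) * (s / (7/10) - 1))"
  have c: "c < 1" "c > 0" using s by (auto simp: c_def)
  have contract: "G \<tau> \<le> c * M" if "\<tau> \<in> A" for \<tau>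
  proof -
    have y: "Im \<tau> \<ge> s" "Im \<tau> > 7/10" using that s by (auto simp: A_def)
    define x where "x = Im \<tau> / (7/10)"
    have x: "x \<ge> s / (7/10)" "x > 1" using y by (auto simp: x_def)
    have "norm (F (nome \<tau>)) \<le> M / (7/10) ^ 4 * norm (nome \<tau>) / r"
      by (rule schwarz_scaled[OF holo F0 _ _ small]) (use r nome_r y in auto)
    hence "G \<tau> \<le> M / (7/10) ^ 4 * norm (nome \<tau>) / r * Im \<tau> ^ 4"
      unfolding G_def using y by (intro mult_right_mono) auto
    also have "\<dots> = M * (x ^ 4 * (norm (nome \<tau>) / r))" by (simp add: x_def power_divide)
    also have "norm (nome \<tau>) / r = exp (- (7/5) * pi * (x - 1))"
      unfolding nome_ratio by (simp add: x_def algebra_simps)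
    also have "M * (x ^ 4 * exp (- (7/5) * pi * (x - 1))) \<le> M * c"
    proof (rule mult_left_mono[OF _ M0])
      have "x \<le> exp (x - 1)" using exp_ge_add_one_self[of "x - 1"] by linarith
      hence "x ^ 4 \<le> exp (x - 1) ^ 4" using x by (intro power_mono) auto
      also have "\<dots> = exp (4 * (x - 1))" by (simp flip: exp_of_nat_mult)
      finally have "x ^ 4 * exp (- (7/5) * pi * (x - 1)) \<le> exp (4 * (x - 1)) * exp (- (7/5) * pi * (x - 1))"
        by (intro mult_right_mono) auto
      also have "\<dots> = exp (- ((7/5) * pi - 4) * (x - 1))" by (simp flip: exp_add) (simp add: algebra_simps)
      also have "\<dots> \<le> c"
      proof -
        have "(3/10) * (s / (7/10) - 1) \<le> ((7/5) * pi - 4) * (x - 1)"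
          using x s pi_approx by (intro mult_mono) auto
        thus ?thesis unfolding c_def mult_minus_left by (simp only: exp_le_cancel_iff neg_le_iff_le)
      qed
      finally show "x ^ 4 * exp (- (7/5) * pi * (x - 1)) \<le> c" .
    qed
    finally show ?thesis by (simp add: mult.commute)
  qed
  have "M \<le> c * M" unfolding M_def by (rule cSUP_least) (use contract \<open>\<i> \<in> A\<close> in \<open>auto simp: M_def\<close>)
  hence "(1 - c) * M \<le> 0" by (simp add: algebra_simps)
  hence "M = 0" using c M0 by (simp add: mult_le_0_iff)
  have zero: "F q = 0" if "norm q < r" for q
    using small[OF that] \<open>M = 0\<close> by simp
  have "F (nome \<tau>0) = 0"
  proof (rule analytic_continuation[OF holo _ _ _ _ _ zero, where U = "ball 0 r" and \<xi> = 0])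
    show "0 islimpt ball (0::complex) r" using r by (simp add: islimpt_ball)
  qed (use r norm_nome_less_1[OF t] in auto)
  thus ?thesis .
qed

section \<open>The Eisenstein series of weight 6, its derivative, and phi\<close>

abbreviation sigma5_series :: "complex \<Rightarrow> complex" where
  "sigma5_series \<equiv> pser (sigma_coeff 5)"

abbreviation n_sigma5_series :: "complex \<Rightarrow> complex" where
  "n_sigma5_series \<equiv> pser (\<lambda>n. of_nat n * sigma_coeff 5 n)"

lemma E6_eq_sigma5_series:
  assumes "Im \<tau> > 0"
  shows "E6 \<tau> = 1 - 504 * sigma5_series (nome \<tau>)"
proof -
  have "(2 * of_real pi * \<i>) ^ 6 = - 64 * (of_real pi ^ 6 :: complex)"
    by (simp add: power_mult_distrib power_numeral_reduce)
  thus ?thesis unfolding E6_def g3_eq_eisenstein[OF assms] eisenstein_def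
    by (simp add: zeta_even_def field_simps fact_numeral)
qed

definition E6_deriv :: "complex \<Rightarrow> complex" where
  "E6_deriv \<tau> = - 1008 * of_real pi * \<i> * n_sigma5_series (nome \<tau>)"

lemma has_field_derivative_E6:
  assumes "Im \<tau> > 0"
  shows "(E6 has_field_derivative E6_deriv \<tau>) (at \<tau>)"
proof -
  have op: "open {z. Im z > 0}" by (simp add: open_halfspace_Im_gt)
  have "((\<lambda>z. 1 - 504 * sigma5_series (nome z)) has_field_derivative
      (0 - 504 * (2 * of_real pi * \<i> * n_sigma5_series (nome \<tau>)))) (at \<tau>)"
    by (intro DERIV_diff DERIV_const DERIV_cmult has_field_derivative_pser_nome unit_series_sigma_coeff assms)
  hence "(E6 has_field_derivative (0 - 504 * (2 * of_real pi * \<i> * n_sigma5_series (nome \<tau>)))) (at \<tau>)"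
    by (rule has_field_derivative_transform_within_open[OF _ op]) (use assms E6_eq_sigma5_series in auto)
  thus ?thesis by (simp add: E6_deriv_def mult_ac)
qed

lemma E6_modular:
  fixes a b c d :: int
  assumes "a * d - b * c = 1" "of_int c * \<tau> + of_int d \<noteq> 0"
  shows "E6 ((of_int a * \<tau> + of_int b) / (of_int c * \<tau> + of_int d)) = (of_int c * \<tau> + of_int d) ^ 6 * E6 \<tau>"
  unfolding E6_def g3_modular[OF assms] by simp

lemma cocycle_nonzero:
  fixes c d :: int
  assumes "Im \<tau> > 0" "c \<noteq> 0 \<or> d \<noteq> 0"
  shows "of_int c * \<tau> + of_int d \<noteq> 0"
  using lattice_pt_eq_0_iff[OF assms(1), of c d] assms(2) by simp

lemma Im_moebius:
  fixes a b c d :: int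
  assumes "a * d - b * c = 1" "Im \<tau> > 0"
  shows "Im ((of_int a * \<tau> + of_int b) / (of_int c * \<tau> + of_int d)) > 0"
proof -
  have "c \<noteq> 0 \<or> d \<noteq> 0" using assms(1) by auto
  hence nz: "of_int c * \<tau> + of_int d \<noteq> 0" by (rule cocycle_nonzero[OF assms(2)])
  have "real_of_int (a * d - b * c) = 1" using assms(1) by simp
  hence e: "real_of_int a * of_int d - of_int b * of_int c = 1" by simp
  have "Im ((of_int a * \<tau> + of_int b) / (of_int c * \<tau> + of_int d)) =
      (real_of_int a * of_int d - of_int b * of_int c) * Im \<tau> / norm (of_int c * \<tau> + of_int d) ^ 2"
    by (simp add: Im_divide cmod_power2) (simp add: algebra_simps)
  thus ?thesis using e assms(2) nz by simp
qed

text \<open>The transformation law of \<open>E6\<close> is differentiated, with (c tau + d)^(-2) as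
  derivative of the Moebius map. The extra term 6 c E6 is exactly what makes tau + 6 E6 / E6'
  transform like tau.\<close>

lemma E6_deriv_modular:
  fixes a b c d :: int
  assumes "a * d - b * c = 1" "Im \<tau> > 0"
  shows "E6_deriv ((of_int a * \<tau> + of_int b) / (of_int c * \<tau> + of_int d)) =
     (of_int c * \<tau> + of_int d) ^ 7 * (6 * of_int c * E6 \<tau> + (of_int c * \<tau> + of_int d) * E6_deriv \<tau>)"
proof -
  have cd: "c \<noteq> 0 \<or> d \<noteq> 0" using assms(1) by auto
  define j :: "complex \<Rightarrow> complex" where "j = (\<lambda>\<tau>. of_int c * \<tau> + of_int d)"
  define g where "g = (\<lambda>\<tau>. (of_int a * \<tau> + of_int b) / j \<tau>)"
  have nz: "j \<tau> \<noteq> 0" unfolding j_def by (rule cocycle_nonzero[OF assms(2) cd])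
  have op: "open {z. Im z > 0}" by (simp add: open_halfspace_Im_gt)
  have "(of_int (a * d - b * c) :: complex) = 1" using assms(1) by simp
  hence e: "(of_int a * of_int d - of_int b * of_int c :: complex) = 1" by simp
  have dj: "(j has_field_derivative of_int c) (at \<tau>)"
    unfolding j_def by (auto intro!: derivative_eq_intros)
  have "((\<lambda>\<tau>. of_int a * \<tau> + of_int b) has_field_derivative of_int a) (at \<tau>)"
    by (auto intro!: derivative_eq_intros)
  from DERIV_divide[OF this dj nz]
  have "(g has_field_derivative (of_int a * j \<tau> - (of_int a * \<tau> + of_int b) * of_int c) / (j \<tau> * j \<tau>)) (at \<tau>)"
    unfolding g_def .
  also have "of_int a * j \<tau> - (of_int a * \<tau> + of_int b) * of_int c = 1"
    using e by (simp add: j_def algebra_simps)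
  finally have dg: "(g has_field_derivative 1 / (j \<tau> * j \<tau>)) (at \<tau>)" .
  have "Im (g \<tau>) > 0" unfolding g_def j_def by (rule Im_moebius[OF assms])
  from DERIV_chain2[OF has_field_derivative_E6[OF this] dg]
  have 1: "((\<lambda>x. E6 (g x)) has_field_derivative E6_deriv (g \<tau>) * (1 / (j \<tau> * j \<tau>))) (at \<tau>)" .
  have "((\<lambda>x. j x ^ 6 * E6 x) has_field_derivative
      of_nat 6 * j \<tau> ^ 5 * of_int c * E6 \<tau> + E6_deriv \<tau> * j \<tau> ^ 6) (at \<tau>)"
    using DERIV_mult[OF DERIV_power[OF dj, of 6] has_field_derivative_E6[OF assms(2)]] by (simp add: mult_ac)
  hence 2: "((\<lambda>x. E6 (g x)) has_field_derivative
      of_nat 6 * j \<tau> ^ 5 * of_int c * E6 \<tau> + E6_deriv \<tau> * j \<tau> ^ 6) (at \<tau>)"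
  proof (rule has_field_derivative_transform_within_open[OF _ op])
    fix x :: complex assume "x \<in> {z. Im z > 0}"
    thus "j x ^ 6 * E6 x = E6 (g x)"
      unfolding g_def j_def using E6_modular[OF assms(1) cocycle_nonzero[OF _ cd], of x] by simp
  qed (use assms in auto)
  from DERIV_unique[OF 1 2] nz
  have "E6_deriv (g \<tau>) = (of_nat 6 * j \<tau> ^ 5 * of_int c * E6 \<tau> + E6_deriv \<tau> * j \<tau> ^ 6) * (j \<tau> * j \<tau>)"
    by (simp add: field_simps)
  also have "\<dots> = j \<tau> ^ 7 * (6 * of_int c * E6 \<tau> + j \<tau> * E6_deriv \<tau>)"
    by (simp add: algebra_simps power_numeral_reduce)
  finally show ?thesis by (simp add: g_def j_def)
qed

theorem ramanujan_E6:
  assumes "Im \<tau> > 0"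
  shows "27 * (g2 \<tau> ^ 2 - 18 * eta1 \<tau> * g3 \<tau>) = 48 * of_real pi ^ 7 * \<i> * E6_deriv \<tau>"
proof -
  define F where "F = (\<lambda>q. 27 * ((60 * eisenstein 4 q) ^ 2 - 18 * eisenstein 2 q * (140 * eisenstein 6 q))
      - 48 * of_real pi ^ 7 * \<i> * (- 1008 * of_real pi * \<i> * n_sigma5_series q))"
  have F: "F (nome \<tau>) = 27 * (g2 \<tau> ^ 2 - 18 * eta1 \<tau> * g3 \<tau>) - 48 * of_real pi ^ 7 * \<i> * E6_deriv \<tau>"
    if "Im \<tau> > 0" for \<tau>
    using that by (simp add: F_def g2_eq_eisenstein g3_eq_eisenstein eta1_eq_eisenstein E6_deriv_def)
  have eh: "eisenstein k holomorphic_on ball 0 1" for k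
    unfolding eisenstein_def[abs_def]
    by (intro holomorphic_intros holomorphic_pser unit_series_sigma_coeff)
  have "F (nome \<tau>) = 0"
  proof (rule cusp_form_weight_8_eq_0)
    show "F holomorphic_on ball 0 1"
      unfolding F_def
      by (intro holomorphic_intros eh holomorphic_pser unit_series_mult_of_nat unit_series_sigma_coeff)
    have p0: "pser c 0 = c 0" for c unfolding pser_def by (rule powser_zero)
    \<comment> \<open>The constant terms are (4 pi^4 / 3)^2 for the square of \<open>g2\<close> and
      18 (pi^2 / 3) (8 pi^6 / 27) for the other product; both equal 16 pi^8 / 9. The derivative
      series has none.\<close>
    show "F 0 = 0"
      by (simp add: F_def eisenstein_def p0 zeta_even_def sigma_coeff_def power_divide power_mult_distrib flip: power_mult power_add)
    show "F (nome (- 1 / \<tau>)) = \<tau> ^ 8 * F (nome \<tau>)" if \<tau>: "Im \<tau> > 0" for \<tau>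
    proof -
      have nz: "of_int 1 * \<tau> + of_int 0 \<noteq> 0" using \<tau> by auto
      have im: "Im (- 1 / \<tau>) > 0" using Im_moebius[of 0 0 "-1" 1 \<tau>] \<tau> by simp
      have g: "g2 (- 1 / \<tau>) = \<tau> ^ 4 * g2 \<tau>" "g3 (- 1 / \<tau>) = \<tau> ^ 6 * g3 \<tau>"
        using g2_modular[of 0 0 "-1" 1 \<tau>] g3_modular[of 0 0 "-1" 1 \<tau>] nz by simp_all
      have d: "E6_deriv (- 1 / \<tau>) = \<tau> ^ 7 * (6 * E6 \<tau> + \<tau> * E6_deriv \<tau>)"
        using E6_deriv_modular[of 0 0 "-1" 1 \<tau>] \<tau> by simp
      have e6: "E6 \<tau> * (8 * of_real pi ^ 6) = 27 * g3 \<tau>" by (simp add: E6_def)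
      have "F (nome (- 1 / \<tau>)) = 27 * ((\<tau> ^ 4 * g2 \<tau>) ^ 2 - 18 * (\<tau> ^ 2 * eta1 \<tau> - 2 * of_real pi * \<i> * \<tau>) * (\<tau> ^ 6 * g3 \<tau>))
          - 48 * of_real pi ^ 7 * \<i> * (\<tau> ^ 7 * (6 * E6 \<tau> + \<tau> * E6_deriv \<tau>))"
        unfolding F[OF im] g d eta1_inversion[OF \<tau>] ..
      \<comment> \<open>The defects of \<open>eta1\<close> and of \<open>E6_deriv\<close> are
        collected in the last summand, which is 0 by the normalization \<open>e6\<close>.\<close>
      also have "\<dots> = \<tau> ^ 8 * (27 * (g2 \<tau> ^ 2 - 18 * eta1 \<tau> * g3 \<tau>) - 48 * of_real pi ^ 7 * \<i> * E6_deriv \<tau>)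
          + 36 * of_real pi * \<i> * \<tau> ^ 7 * (27 * g3 \<tau> - E6 \<tau> * (8 * of_real pi ^ 6))"
        by (simp add: algebra_simps power_numeral_reduce)
      finally show ?thesis unfolding F[OF \<tau>] e6 by simp
    qed
  qed (use assms in auto)
  thus ?thesis using F[OF assms] by simp
qed

text \<open>By Ramanujan's formula the denominator of \<open>phi\<close> is a constant multiple of
  \<open>E6_deriv\<close>. Where that vanishes, both quotients are 0 by the convention for division
  by zero, so there are no exceptional points.\<close>

theorem phi_eq:
  assumes "Im \<tau> > 0"
  shows "phi \<tau> = \<tau> + 6 * E6 \<tau> / E6_deriv \<tau>"
proof -
  define X where "X = g2 \<tau> ^ 2 - 18 * eta1 \<tau> * g3 \<tau>"
  have X: "X = 48 * of_real pi ^ 7 * \<i> * E6_deriv \<tau> / 27"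
    using ramanujan_E6[OF assms, folded X_def] by (metis nonzero_mult_div_cancel_left zero_neq_numeral)
  have "phi \<tau> = \<tau> + 36 * of_real pi * \<i> * g3 \<tau> / X" by (simp add: phi_def X_def)
  also have "g3 \<tau> = E6 \<tau> * (8 * of_real pi ^ 6) / 27" by (simp add: E6_def)
  also have "36 * of_real pi * \<i> * (E6 \<tau> * (8 * of_real pi ^ 6) / 27) / X = 6 * E6 \<tau> / E6_deriv \<tau>"
    unfolding X by (cases "E6_deriv \<tau> = 0") (simp_all add: field_simps power_numeral_reduce)
  finally show ?thesis .
qed

text \<open>A Moebius image of \<open>\<tau>\<close> is critical for \<open>E\<^sub>6\<close> iff the matrix sends \<open>\<phi> \<tau>\<close> to infinity.\<close>

lemma D_set_iff:
  assumes "\<tau> \<in> F_dom" "E6_deriv \<tau> \<noteq> 0"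
  shows "\<tau> \<in> D_set \<longleftrightarrow> phi \<tau> \<in> \<rat>"
proof
  have \<tau>: "Im \<tau> > 0" using assms(1) by (simp add: F_dom_def upper_half_plane_def)
  have crit: "deriv E6 z = E6_deriv z" if "Im z > 0" for z
    using has_field_derivative_E6[OF that] by (rule DERIV_imp_deriv)
  {
    assume "\<tau> \<in> D_set"
    then obtain z a b c d where z: "Im z > 0" "deriv E6 z = 0" "a * d - b * c = 1"
      and \<tau>z: "\<tau> = (of_int a * z + of_int b) / (of_int c * z + of_int d)"
      unfolding D_set_def upper_half_plane_def by auto
    have cd: "c \<noteq> 0 \<or> d \<noteq> 0" using z(3) by auto
    have "E6_deriv z = 0" using z crit by simp
    have nz: "of_int c * z + of_int d \<noteq> 0" by (rule cocycle_nonzero[OF z(1) cd])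
    \<comment> \<open>The inverse matrix leads from tau back to z, so the criticality of z becomes a
      condition at tau, namely c phi(tau) = a.\<close>
    have det: "d * a - (- b) * (- c) = 1" using z(3) by (simp add: mult.commute)
    have "- c \<noteq> 0 \<or> a \<noteq> 0" using z(3) by auto
    hence nz': "of_int (- c) * \<tau> + of_int a \<noteq> 0" by (rule cocycle_nonzero[OF \<tau>])
    have "\<tau> * (of_int c * z + of_int d) = of_int a * z + of_int b" using \<tau>z nz by simp
    hence "z * (of_int (- c) * \<tau> + of_int a) = of_int d * \<tau> + of_int (- b)" by (simp add: algebra_simps)
    hence zt: "z = (of_int d * \<tau> + of_int (- b)) / (of_int (- c) * \<tau> + of_int a)"
      using nz' by (simp only: nonzero_eq_divide_eq[OF nz'])
    have "6 * of_int (- c) * E6 \<tau> + (of_int (- c) * \<tau> + of_int a) * E6_deriv \<tau> = 0"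
      using E6_deriv_modular[OF det \<tau>] \<open>E6_deriv z = 0\<close> nz' unfolding zt by simp
    hence "of_int c * (\<tau> + 6 * E6 \<tau> / E6_deriv \<tau>) = of_int a"
      using assms(2) by (simp add: field_simps)
    hence ca: "of_int c * phi \<tau> = of_int a" by (simp add: phi_eq[OF \<tau>])
    have "c \<noteq> 0" using ca z(3) by auto
    hence "phi \<tau> = of_int a / of_int c" using ca by (simp add: field_simps)
    thus "phi \<tau> \<in> \<rat>" by simp
  }
  {
    assume "phi \<tau> \<in> \<rat>"
    then obtain r where r: "phi \<tau> = of_rat r" by (auto elim: Rats_cases)
    obtain a c where ac: "quotient_of r = (a, c)" by force
    hence "c > 0" "coprime a c" "r = of_int a / of_int c"
      using quotient_of_denom_pos quotient_of_coprime quotient_of_div by auto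
    hence ph: "phi \<tau> = of_int a / of_int c" using r by (simp add: of_rat_divide)
    \<comment> \<open>Bezout's identity completes (a, c) to a matrix of determinant 1 with second
      column (-v, u); its inverse sends a / c to infinity.\<close>
    obtain u v where "u * a + v * c = 1"
      using bezout_int[of a c] \<open>coprime a c\<close> by (auto simp: coprime_iff_gcd_eq_1)
    define b d where "b = - v" and "d = u"
    have det: "a * d - b * c = 1" using \<open>u * a + v * c = 1\<close> by (simp add: b_def d_def mult.commute)
    have det': "d * a - (- b) * (- c) = 1" using det by (simp add: mult.commute)
    define z where "z = (of_int d * \<tau> + of_int (- b)) / (of_int (- c) * \<tau> + of_int a)"
    have nz': "of_int (- c) * \<tau> + of_int a \<noteq> 0" using \<open>c > 0\<close> by (intro cocycle_nonzero[OF \<tau>]) auto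
    have z: "Im z > 0" unfolding z_def by (rule Im_moebius[OF det' \<tau>])
    have "of_int c * (\<tau> + 6 * E6 \<tau> / E6_deriv \<tau>) = of_int a"
      using ph \<open>c > 0\<close> by (simp add: phi_eq[OF \<tau>])
    hence "6 * of_int (- c) * E6 \<tau> + (of_int (- c) * \<tau> + of_int a) * E6_deriv \<tau> = 0"
      using assms(2) by (simp add: field_simps)
    hence "E6_deriv z = 0" unfolding z_def E6_deriv_modular[OF det' \<tau>] by simp
    hence "deriv E6 z = 0" using crit z by simp
    moreover have "\<tau> = (of_int a * z + of_int b) / (of_int c * z + of_int d)"
    proof -
      have nz: "of_int c * z + of_int d \<noteq> 0"
        using \<open>c > 0\<close> by (intro cocycle_nonzero[OF z]) auto
      have "z * (of_int (- c) * \<tau> + of_int a) = of_int d * \<tau> + of_int (- b)"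
        unfolding z_def using nz' by simp
      hence "\<tau> * (of_int c * z + of_int d) = of_int a * z + of_int b" by (simp add: algebra_simps)
      thus ?thesis using nz by (simp add: nonzero_eq_divide_eq)
    qed
    ultimately show "\<tau> \<in> D_set"
      using assms(1) z det unfolding D_set_def upper_half_plane_def by blast
  }
qed

subsection \<open>Numerical bounds for the expansion in the nome\<close>

text \<open>At x / 64 the quadratic Taylor bound is sharp enough to survive the 64th power, which
  leaves an inequality between rational numbers.\<close>

lemma exp_ge_power_64:
  fixes x :: real
  assumes "x \<ge> 0"
  shows "(1 + x / 64 + (x / 64)\<^sup>2 / 2) ^ 64 \<le> exp x"
proof -
  have "1 + x / 64 + (x / 64)\<^sup>2 / 2 \<le> exp (x / 64)"
    using assms by (intro exp_lower_Taylor_quadratic) auto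
  hence "(1 + x / 64 + (x / 64)\<^sup>2 / 2) ^ 64 \<le> exp (x / 64) ^ 64"
    using assms by (intro power_mono) auto
  also have "\<dots> = exp x" by (simp flip: exp_of_nat_mult)
  finally show ?thesis .
qed

lemma nome_bound_19_20:
  assumes "Im \<tau> \<ge> 19/20"
  shows "norm (nome \<tau>) \<le> 1/380"
proof -
  \<comment> \<open>439/400 is a short fraction just below the base of the next line; 5969/1000 is
    just below 2 pi (19/20).\<close>
  have "(380::real) \<le> (439/400) ^ 64" by (simp add: power_divide)
  also have "\<dots> \<le> (1 + (5969/1000) / 64 + ((5969/1000) / 64)\<^sup>2 / 2) ^ 64"
    by (intro power_mono) (auto simp: power2_eq_square)
  also have "\<dots> \<le> exp (5969/1000)" by (rule exp_ge_power_64) simp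
  also have "\<dots> \<le> exp (2 * pi * Im \<tau>)"
  proof -
    have "5969/1000 \<le> 2 * pi * (19/20)" using pi_approx by simp
    also have "\<dots> \<le> 2 * pi * Im \<tau>" using assms by (intro mult_left_mono) auto
    finally show ?thesis by simp
  qed
  finally show ?thesis by (simp add: norm_nome exp_minus field_simps)
qed

lemma sqrt_3_bounds: "(17320/10000 :: real) < sqrt 3" "sqrt 3 < (17321/10000 :: real)"
  by (rule real_less_rsqrt, simp add: power2_eq_square) (rule real_less_lsqrt, auto simp: power2_eq_square)

lemma nome_bound_sqrt_3:
  assumes "Im \<tau> \<ge> sqrt 3 / 2"
  shows "norm (nome \<tau>) \<le> 1/227"
proof -
  have "(227::real) \<le> (1 + (5440/1000) / 64 + ((5440/1000) / 64)\<^sup>2 / 2) ^ 64" by (simp add: power2_eq_square power_divide)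
  also have "\<dots> \<le> exp (5440/1000)" by (rule exp_ge_power_64) simp
  also have "\<dots> \<le> exp (2 * pi * Im \<tau>)"
  proof -
    have "5440/1000 \<le> 2 * (31415/10000) * ((1732/1000) / 2 :: real)" by simp
    also have "\<dots> \<le> 2 * pi * Im \<tau>" using pi_approx sqrt_3_bounds assms by (intro mult_mono) auto
    finally show ?thesis by simp
  qed
  finally show ?thesis by (simp add: norm_nome exp_minus field_simps)
qed

text \<open>Both sides agree for n = 0; from n to n + 1 the left side grows at most by the factor
  (6/5)^7 < 4.\<close>

lemma power_7_le: "(real n + 5) ^ 7 \<le> 78125 * 4 ^ n"
proof (induction n)
  case (Suc n)
  have "(real (Suc n) + 5) ^ 7 \<le> ((6/5) * (real n + 5)) ^ 7" by (intro power_mono) auto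
  also have "\<dots> \<le> 4 * (real n + 5) ^ 7" unfolding power_mult_distrib by (intro mult_right_mono) (auto simp: power_divide)
  also have "\<dots> \<le> 4 * (78125 * 4 ^ n)" using Suc by simp
  finally show ?case by simp
qed simp

lemma power_6_le: "(real n + 5) ^ 6 \<le> 15625 * 4 ^ n"
proof -
  have "5 * (real n + 5) ^ 6 \<le> (real n + 5) * (real n + 5) ^ 6" by (intro mult_right_mono) auto
  also have "\<dots> = (real n + 5) ^ 7" by (simp add: power_numeral_reduce)
  also have "\<dots> \<le> 78125 * 4 ^ n" by (rule power_7_le)
  finally show ?thesis by simp
qed

text \<open>For |q| at most 1/125 the tail from index 5 on is dominated by a geometric series of
  ratio 4/125, whose sum is 125/121.\<close>

lemma pser_split_5:
  assumes "unit_series c" "norm q \<le> 1/125" "\<And>n. norm (c (n + 5)) \<le> K * 4 ^ n" "c 0 = 0"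
  obtains T where "pser c q = c 1 * q + c 2 * q ^ 2 + c 3 * q ^ 3 + c 4 * q ^ 4 + q ^ 5 * T"
    "norm T \<le> K * (125/121)"
proof -
  have q1: "norm q < 1" using assms(2) by simp
  have K: "K \<ge> 0" using assms(3)[of 0] by (auto intro: order_trans[OF norm_ge_zero])
  have sm: "summable (\<lambda>n. c n * q ^ n)" using assms(1) q1 by (simp add: unit_series_def)
  have g: "(\<lambda>n. K * (4/125) ^ n) sums (K * (1 / (1 - 4/125)))"
    by (intro sums_mult geometric_sums) auto
  have le: "norm (c (n + 5) * q ^ n) \<le> K * (4/125) ^ n" for n
  proof -
    have "norm (c (n + 5) * q ^ n) \<le> (K * 4 ^ n) * (1/125) ^ n"
      unfolding norm_mult norm_power using assms(2,3) K by (intro mult_mono power_mono) auto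
    thus ?thesis by (simp add: power_divide)
  qed
  have sm2: "summable (\<lambda>n. norm (c (n + 5) * q ^ n))"
    by (rule summable_comparison_test'[OF sums_summable[OF g], of 0]) (use le in simp)
  define T where "T = (\<Sum>n. c (n + 5) * q ^ n)"
  have "norm T \<le> (\<Sum>n. norm (c (n + 5) * q ^ n))" unfolding T_def by (rule summable_norm[OF sm2])
  also have "\<dots> \<le> (\<Sum>n. K * (4/125) ^ n)" by (rule suminf_le[OF le sm2 sums_summable[OF g]])
  also have "\<dots> = K * (125/121)" using g by (simp add: sums_iff)
  finally have T: "norm T \<le> K * (125/121)" .
  have "pser c q = (\<Sum>n. c (n + 5) * q ^ (n + 5)) + (\<Sum>i<5. c i * q ^ i)"
    unfolding pser_def by (rule suminf_split_initial_segment[OF sm])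
  also have "(\<Sum>n. c (n + 5) * q ^ (n + 5)) = (\<Sum>n. q ^ 5 * (c (n + 5) * q ^ n))"
    by (simp add: power_add mult_ac)
  also have "\<dots> = q ^ 5 * T" unfolding T_def by (rule suminf_mult[OF summable_norm_cancel[OF sm2]])
  also have "(\<Sum>i<5. c i * q ^ i) = c 1 * q + c 2 * q ^ 2 + c 3 * q ^ 3 + c 4 * q ^ 4"
    using assms(4) by (simp add: eval_nat_numeral)
  finally have "pser c q = c 1 * q + c 2 * q ^ 2 + c 3 * q ^ 3 + c 4 * q ^ 4 + q ^ 5 * T" by simp
  thus ?thesis using that T by blast
qed

lemma sigma_coeff_5_values:
  "sigma_coeff 5 0 = 0" "sigma_coeff 5 1 = 1" "sigma_coeff 5 2 = 33" "sigma_coeff 5 3 = 244" "sigma_coeff 5 4 = 1057"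
proof -
  have le: "d \<le> n" if "d dvd n" "n > 0" for d n :: nat using that by (rule dvd_imp_le)
  have cases: "d = 0 \<or> d = 1 \<or> d = 2 \<or> d = 3 \<or> d = 4" if "d \<le> 4" for d :: nat using that by linarith
  have 2: "{d. d dvd 2} = {1, 2 :: nat}"
    using le[of _ 2] cases by (auto dest: le) (metis One_nat_def prime_nat_iff two_is_prime_nat)
  have 3: "{d. d dvd 3} = {1, 3 :: nat}"
  proof -
    have "d = 1 \<or> d = 3" if d: "d dvd 3" for d :: nat using cases[of d] le[OF d] d by auto
    thus ?thesis by auto
  qed
  have 4: "{d. d dvd 4} = {1, 2, 4 :: nat}"
  proof -
    have "d = 1 \<or> d = 2 \<or> d = 4" if d: "d dvd 4" for d :: nat using cases[of d] le[OF d] d by auto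
    thus ?thesis by auto
  qed
  show "sigma_coeff 5 0 = 0" "sigma_coeff 5 1 = 1" "sigma_coeff 5 2 = 33" "sigma_coeff 5 3 = 244" "sigma_coeff 5 4 = 1057"
    by (simp_all add: sigma_coeff_def 2 3 4)
qed

lemma sigma5_series_expansion:
  assumes "norm q \<le> 1/125"
  obtains T where "sigma5_series q = q + 33 * q ^ 2 + 244 * q ^ 3 + 1057 * q ^ 4 + q ^ 5 * T" "norm T \<le> 16200"
proof -
  have "norm (sigma_coeff 5 (n + 5)) \<le> 15625 * 4 ^ n" for n
    using norm_sigma_coeff_le[of 5 "n + 5"] power_6_le[of n] by (simp add: add.commute)
  then obtain T where "sigma5_series q = sigma_coeff 5 1 * q + sigma_coeff 5 2 * q ^ 2 + sigma_coeff 5 3 * q ^ 3 + sigma_coeff 5 4 * q ^ 4 + q ^ 5 * T"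
      "norm T \<le> 15625 * (125/121)"
    using pser_split_5[OF unit_series_sigma_coeff assms, of 5 15625] sigma_coeff_5_values(1) by metis
  thus ?thesis using that[of T] unfolding sigma_coeff_5_values by simp
qed

lemma n_sigma5_series_expansion:
  assumes "norm q \<le> 1/125"
  obtains U where "n_sigma5_series q = q + 66 * q ^ 2 + 732 * q ^ 3 + 4228 * q ^ 4 + q ^ 5 * U" "norm U \<le> 81000"
proof -
  have "norm (of_nat (n + 5) * sigma_coeff 5 (n + 5)) \<le> 78125 * 4 ^ n" for n
  proof -
    have "norm (of_nat (n + 5) * sigma_coeff 5 (n + 5)) = (real n + 5) * norm (sigma_coeff 5 (n + 5))"
      by (simp add: norm_mult flip: of_nat_add)
    also have "\<dots> \<le> (real n + 5) * (real n + 5) ^ 6"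
      using norm_sigma_coeff_le[of 5 "n + 5"] by (intro mult_left_mono) auto
    also have "\<dots> = (real n + 5) ^ 7" by (simp add: power_numeral_reduce)
    also have "\<dots> \<le> 78125 * 4 ^ n" by (rule power_7_le)
    finally show ?thesis .
  qed
  then obtain U where "n_sigma5_series q = of_nat 1 * sigma_coeff 5 1 * q + of_nat 2 * sigma_coeff 5 2 * q ^ 2 +
        of_nat 3 * sigma_coeff 5 3 * q ^ 3 + of_nat 4 * sigma_coeff 5 4 * q ^ 4 + q ^ 5 * U"
      "norm U \<le> 78125 * (125/121)"
    using pser_split_5[OF unit_series_mult_of_nat[OF unit_series_sigma_coeff] assms, of 5 78125] by auto
  thus ?thesis using that[of U] unfolding sigma_coeff_5_values by simp
qed

text \<open>The remainder in \<open>E\<^sub>6 / (q A') = 1/q - 570 + 20256 q + O(q\<^sup>2)\<close>, where \<open>E\<^sub>6 = 1 - 504 A(q)\<close>.\<close>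

definition eps :: "complex \<Rightarrow> complex" where
  "eps q = (if q = 0 then 0 else (1 - 504 * sigma5_series q) / n_sigma5_series q - 1 / q + 570 - 20256 * q)"

text \<open>Write A for \<open>sigma5_series\<close> and q D for \<open>n_sigma5_series\<close>.
  Dividing with remainder, 1 - 504 A = D (1 - 570 q + 20256 q^2) + q^3 Z, so the remainder is q^2 Z
  / D. The numbers 75 and 1180000 are rounded bounds for (D - 1) / q and Z on |q| <= 1/125.\<close>

lemma eps_bounds:
  assumes "norm q \<le> 1/125"
  shows "q \<noteq> 0 \<Longrightarrow> n_sigma5_series q \<noteq> 0"
    and "norm (eps q) \<le> 1180000 * norm q ^ 2 / (1 - 75 * norm q)"
proof -
  define \<rho> where "\<rho> = norm q"
  have \<rho>: "0 \<le> \<rho>" "\<rho> \<le> 1/125" using assms by (auto simp: \<rho>_def)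
  obtain T where T: "sigma5_series q = q + 33 * q ^ 2 + 244 * q ^ 3 + 1057 * q ^ 4 + q ^ 5 * T" "norm T \<le> 16200"
    by (rule sigma5_series_expansion[OF assms])
  obtain U where U: "n_sigma5_series q = q + 66 * q ^ 2 + 732 * q ^ 3 + 4228 * q ^ 4 + q ^ 5 * U" "norm U \<le> 81000"
    by (rule n_sigma5_series_expansion[OF assms])
  define D where "D = 1 + q * (66 + q * (732 + q * (4228 + q * U)))"
  define Z where "Z = - 1046860 - q * (12950160 + U) + q ^ 2 * (570 * U - 504 * T - 85642368) - q ^ 3 * (20256 * U)"
  have B: "n_sigma5_series q = q * D"
    unfolding U(1) D_def by (simp add: algebra_simps power_numeral_reduce)
  have num: "1 - 504 * sigma5_series q = D * (1 - 570 * q + 20256 * q ^ 2) + q ^ 3 * Z"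
    unfolding T(1) D_def Z_def by (simp add: algebra_simps power_numeral_reduce)
  have t: "norm (a + q * b) \<le> A + C / 125" if "norm a \<le> A" "norm b \<le> C" for a b A C
  proof -
    have "norm (a + q * b) \<le> norm a + norm q * norm b" by (metis norm_mult norm_triangle_ineq)
    also have "\<dots> \<le> A + 1/125 * C" using that assms by (intro add_mono mult_mono) auto
    finally show ?thesis by simp
  qed
  have "norm (66 + q * (732 + q * (4228 + q * U))) \<le> 66 + (732 + (4228 + 81000 / 125) / 125) / 125"
    by (intro t U(2)) auto
  hence "norm (q * (66 + q * (732 + q * (4228 + q * U)))) \<le> \<rho> * 75"
    unfolding norm_mult \<rho>_def by (intro mult_left_mono) auto
  hence D: "norm D \<ge> 1 - 75 * \<rho>"
    using norm_diff_ineq[of 1 "q * (66 + q * (732 + q * (4228 + q * U)))"] by (simp add: D_def)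
  hence D0: "norm D > 0" using \<rho> by linarith
  thus "n_sigma5_series q \<noteq> 0" if "q \<noteq> 0" using that unfolding B by auto
  have Z: "norm Z \<le> 1180000"
  proof -
    have "norm (12950160 + U) \<le> 12950160 + 81000" using U(2) by (intro norm_triangle_le) auto
    moreover have "norm (570 * U - 504 * T - 85642368) \<le> 570 * 81000 + 504 * 16200 + 85642368"
    proof -
      have "norm (570 * U - 504 * T - 85642368) \<le> norm (570 * U) + norm (504 * T) + 85642368"
        using norm_triangle_ineq4[of "570 * U - 504 * T" 85642368] norm_triangle_ineq4[of "570 * U" "504 * T"] by simp
      thus ?thesis using U(2) T(2) by (simp add: norm_mult)
    qed
    moreover have "norm (- (20256 * U)) \<le> 20256 * 81000" using U(2) by (simp add: norm_mult)
    ultimately have "norm (- 1046860 + q * (- (12950160 + U) + q * ((570 * U - 504 * T - 85642368) + q * (- (20256 * U)))))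
        \<le> 1046860 + ((12950160 + 81000) + ((570 * 81000 + 504 * 16200 + 85642368) + (20256 * 81000) / 125) / 125) / 125"
      by (intro t) (simp_all only: norm_minus_cancel, auto)
    moreover have "Z = - 1046860 + q * (- (12950160 + U) + q * ((570 * U - 504 * T - 85642368) + q * (- (20256 * U))))"
      by (simp add: Z_def algebra_simps power_numeral_reduce)
    ultimately show ?thesis by simp
  qed
  show "norm (eps q) \<le> 1180000 * norm q ^ 2 / (1 - 75 * norm q)"
  proof (cases "q = 0")
    case False
    have "eps q = q ^ 2 * Z / D"
    proof -
      have "eps q = (D * (1 - 570 * q + 20256 * q ^ 2) + q ^ 3 * Z) / (q * D) - 1 / q + 570 - 20256 * q"
        using False unfolding eps_def num B by simp
      also have "\<dots> = q ^ 2 * Z / D"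
        using False D0 by (simp add: field_simps power_numeral_reduce)
      finally show ?thesis .
    qed
    hence "norm (eps q) = \<rho> ^ 2 * norm Z / norm D" by (simp add: norm_mult norm_divide norm_power \<rho>_def)
    also have "\<dots> \<le> \<rho> ^ 2 * 1180000 / (1 - 75 * \<rho>)"
      using Z D \<rho> by (intro frac_le mult_left_mono) auto
    finally show ?thesis by (simp add: \<rho>_def mult.commute)
  qed (simp add: eps_def)
qed

lemma eps_le:
  assumes "norm q \<le> r" "r \<le> 1/125"
  shows "norm (eps q) \<le> 1180000 * r ^ 2 / (1 - 75 * r)"
proof -
  have "norm (eps q) \<le> 1180000 * norm q ^ 2 / (1 - 75 * norm q)" using assms by (intro eps_bounds) auto
  also have "\<dots> \<le> 1180000 * r ^ 2 / (1 - 75 * r)"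
    using assms by (intro frac_le mult_left_mono power_mono) auto
  finally show ?thesis .
qed

text \<open>The bound of order |q|^2 gives the limit 0 at the origin, so the singularity there is
  removable.\<close>

lemma holomorphic_eps: "eps holomorphic_on ball 0 (1/125)"
proof (rule no_isolated_singularity'[where K = "{0}"])
  have "(\<lambda>q. (1 - 504 * sigma5_series q) / n_sigma5_series q - 1 / q + 570 - 20256 * q) holomorphic_on ball 0 (1/125) - {0}"
    by (intro holomorphic_intros holomorphic_on_subset[OF holomorphic_pser] unit_series_mult_of_nat unit_series_sigma_coeff)
       (auto simp: eps_bounds)
  thus "eps holomorphic_on ball 0 (1/125) - {0}"
    by (rule holomorphic_transform) (auto simp: eps_def)
  fix z :: complex assume "z \<in> {0}"
  have "((\<lambda>q::complex. 1180000 * norm q ^ 2 / (1 - 75 * norm q)) \<longlongrightarrow> 1180000 * norm (0::complex) ^ 2 / (1 - 75 * norm (0::complex))) (at 0)"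
    by (intro tendsto_intros) auto
  hence "((\<lambda>q::complex. 1180000 * norm q ^ 2 / (1 - 75 * norm q)) \<longlongrightarrow> 0) (at 0)" by simp
  moreover have "eventually (\<lambda>q. norm (eps q) \<le> 1180000 * norm q ^ 2 / (1 - 75 * norm q)) (at 0)"
    unfolding eventually_at by (rule exI[of _ "1/125"]) (auto intro: eps_bounds)
  ultimately have "(eps \<longlongrightarrow> 0) (at 0)" by (rule Lim_null_comparison[rotated])
  thus "(eps \<longlongrightarrow> eps z) (at z within ball 0 (1/125))"
    using \<open>z \<in> {0}\<close> by (auto simp: eps_def intro: Lim_at_imp_Lim_at_within)
qed auto

section \<open>Conjugation symmetry and derivatives of the remainder\<close>

lemma pser_cnj:
  assumes "unit_series c" "norm q < 1" "\<And>n. cnj (c n) = c n"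
  shows "pser c (cnj q) = cnj (pser c q)"
proof -
  have "(\<lambda>n. cnj (c n * q ^ n)) sums cnj (pser c q)"
    using unit_series_sums[OF assms(1,2)] by (simp only: sums_cnj)
  hence "(\<lambda>n. c n * cnj q ^ n) sums cnj (pser c q)" by (simp add: assms(3))
  thus ?thesis by (simp add: pser_def sums_iff)
qed

lemma eps_cnj:
  assumes "norm q < 1" shows "eps (cnj q) = cnj (eps q)"
proof -
  have 1: "cnj (sigma_coeff 5 n) = sigma_coeff 5 n" for n by (simp add: sigma_coeff_def)
  have "sigma5_series (cnj q) = cnj (sigma5_series q)"
    by (intro pser_cnj unit_series_sigma_coeff assms 1)
  moreover have "n_sigma5_series (cnj q) = cnj (n_sigma5_series q)"
    by (intro pser_cnj unit_series_mult_of_nat unit_series_sigma_coeff assms) (simp add: 1)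
  ultimately show ?thesis by (simp add: eps_def)
qed

lemma has_field_derivative_eps:
  "norm q < 1/125 \<Longrightarrow> (eps has_field_derivative deriv eps q) (at q)"
  by (rule holomorphic_derivI[OF holomorphic_eps]) auto

text \<open>Cauchy's estimates on circles of radius 1/380. They stay in |z| <= 1/190, where
  \<open>eps\<close> is at most 55; the bounds are 55 * 380 and 2 * 55 * 380^2.\<close>

lemma eps_deriv_bounds:
  assumes "norm q \<le> 1/380"
  shows "norm (deriv eps q) \<le> 20900" "norm (deriv (deriv eps) q) \<le> 15884000"
proof -
  have sub: "cball q (1/380) \<subseteq> ball 0 (1/125)"
  proof
    fix z assume "z \<in> cball q (1/380)"
    hence "norm (z - q) \<le> 1/380" by (simp add: dist_norm norm_minus_commute)
    hence "norm z \<le> 1/380 + 1/380" using assms norm_triangle_sub[of z q] by linarith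
    thus "z \<in> ball 0 (1/125)" by simp
  qed
  have bd: "norm (eps z) \<le> 55" if "norm (q - z) = 1/380" for z
  proof -
    have "norm z \<le> 1/190" using assms that norm_triangle_sub[of z q] by (simp add: norm_minus_commute)
    from eps_le[OF this] show ?thesis by (simp add: power2_eq_square)
  qed
  have *: "norm ((deriv ^^ n) eps q) \<le> fact n * 55 / (1/380) ^ n" for n
  proof (rule Cauchy_inequality)
    show "eps holomorphic_on ball q (1/380)"
      using sub by (intro holomorphic_on_subset[OF holomorphic_eps]) auto
    show "continuous_on (cball q (1/380)) eps"
      using sub by (intro holomorphic_on_imp_continuous_on holomorphic_on_subset[OF holomorphic_eps]) auto
  qed (use bd in auto)
  show "norm (deriv eps q) \<le> 20900" using *[of 1] by simp
  show "norm (deriv (deriv eps) q) \<le> 15884000" using *[of 2] by (simp add: numeral_2_eq_2)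
qed

text \<open>2 i Im f(q) is the difference of the values at q and its conjugate, two points at
  distance 2 |Im q|. This turns a derivative bound into one that tends to 0 at the real axis, as the
  comparison with sin(2 pi Re tau) requires.\<close>

lemma Im_bound_by_symmetry:
  assumes "\<And>z. norm z \<le> r \<Longrightarrow> (f has_field_derivative f' z) (at z)" "\<And>z. norm z \<le> r \<Longrightarrow> norm (f' z) \<le> L"
    and "\<And>z. norm z \<le> r \<Longrightarrow> f (cnj z) = cnj (f z)" and "norm q \<le> r"
  shows "\<bar>Im (f q)\<bar> \<le> L * \<bar>Im q\<bar>"
proof -
  have "norm (f q - f (cnj q)) \<le> L * norm (q - cnj q)"
    by (rule field_differentiable_bound[of "cball 0 r"])
       (use assms in \<open>auto intro: has_field_derivative_at_within\<close>)
  moreover have "f q - f (cnj q) = 2 * of_real (Im (f q)) * \<i>"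
    using assms(3)[OF assms(4)] by (simp add: complex_eq_iff)
  moreover have "q - cnj q = 2 * of_real (Im q) * \<i>" by (simp add: complex_eq_iff)
  ultimately show ?thesis by (simp add: norm_mult)
qed

lemma Im_eps_bound:
  assumes "norm q \<le> 1/380" shows "\<bar>Im (eps q)\<bar> \<le> 20900 * \<bar>Im q\<bar>"
  by (rule Im_bound_by_symmetry[of "1/380" _ "deriv eps"])
     (use assms in \<open>auto intro: has_field_derivative_eps eps_deriv_bounds eps_cnj\<close>)

lemma Im_deriv_eps_bound:
  assumes "norm q \<le> 1/380" shows "\<bar>Im (q * deriv eps q)\<bar> \<le> 62700 * \<bar>Im q\<bar>"
proof (rule Im_bound_by_symmetry[where f = "\<lambda>q. q * deriv eps q" and f' = "\<lambda>q. deriv eps q + deriv (deriv eps) q * q"])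
  show "norm q \<le> 1/380" by fact
  fix z :: complex assume z: "norm z \<le> 1/380"
  have "(deriv eps has_field_derivative deriv (deriv eps) z) (at z)"
    by (rule holomorphic_derivI[OF holomorphic_deriv[OF holomorphic_eps]]) (use z in auto)
  thus "((\<lambda>q. q * deriv eps q) has_field_derivative (deriv eps z + deriv (deriv eps) z * z)) (at z)"
    using DERIV_mult[OF DERIV_ident, of "deriv eps"] by simp
  have "norm (deriv eps z + deriv (deriv eps) z * z) \<le> norm (deriv eps z) + norm (deriv (deriv eps) z) * norm z"
    by (metis norm_mult norm_triangle_ineq)
  also have "\<dots> \<le> 20900 + 15884000 * (1/380)"
    using z by (intro add_mono mult_mono eps_deriv_bounds) auto
  finally show "norm (deriv eps z + deriv (deriv eps) z * z) \<le> 62700" by simp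
  \<comment> \<open>The symmetry of \<open>eps\<close> passes to its derivative by differentiating
    cnj o eps o cnj at the conjugate point.\<close>
  have "(eps has_field_derivative deriv eps z) (at z)" using z by (intro has_field_derivative_eps) auto
  hence "(eps has_field_derivative deriv eps z) (at (cnj (cnj z)))" by simp
  from has_field_derivative_cnj_cnj[OF this]
  have "(cnj \<circ> eps \<circ> cnj has_field_derivative cnj (deriv eps z)) (at (cnj z))" .
  hence "(eps has_field_derivative cnj (deriv eps z)) (at (cnj z))"
  proof (rule has_field_derivative_transform_within_open[where S = "ball 0 1"])
    fix w :: complex assume "w \<in> ball 0 1"
    thus "(cnj \<circ> eps \<circ> cnj) w = eps w" using eps_cnj[of w] by simp
  qed (use z in auto)
  hence "deriv eps (cnj z) = cnj (deriv eps z)" by (rule DERIV_imp_deriv)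
  thus "cnj z * deriv eps (cnj z) = cnj (z * deriv eps z)" by simp
qed

text \<open>\<open>phi_expansion\<close> differentiated by d/dtau = 2 pi i q d/dq, which turns the
  prefactor i / (168 pi) into -1/84.\<close>

definition phi_deriv :: "complex \<Rightarrow> complex" where
  "phi_deriv \<tau> = 1 + (1 / nome \<tau> - 20256 * nome \<tau> - nome \<tau> * deriv eps (nome \<tau>)) / 84"

lemma Im_pos_if_nome_small: "norm (nome \<tau>) < 1 \<Longrightarrow> Im \<tau> > 0"
  by (auto simp: norm_nome mult_less_0_iff zero_less_mult_iff)

lemma E6_deriv_nonzero:
  assumes "norm (nome \<tau>) < 1/125" shows "E6_deriv \<tau> \<noteq> 0"
  using eps_bounds(1)[of "nome \<tau>"] assms by (simp add: E6_deriv_def)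

lemma phi_expansion:
  assumes "norm (nome \<tau>) < 1/125"
  shows "phi \<tau> = \<tau> + \<i> / (168 * of_real pi) * (1 / nome \<tau> - 570 + 20256 * nome \<tau> + eps (nome \<tau>))"
proof -
  have im: "Im \<tau> > 0" using assms by (intro Im_pos_if_nome_small) simp
  have "1 / nome \<tau> - 570 + 20256 * nome \<tau> + eps (nome \<tau>) = (1 - 504 * sigma5_series (nome \<tau>)) / n_sigma5_series (nome \<tau>)"
    by (simp add: eps_def)
  moreover have "6 * E6 \<tau> / E6_deriv \<tau> = \<i> / (168 * of_real pi) * ((1 - 504 * sigma5_series (nome \<tau>)) / n_sigma5_series (nome \<tau>))"
  proof -
    have "\<i> / (168 * of_real pi) = (6 / (- 1008 * of_real pi * \<i>) :: complex)" by (simp add: field_simps)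
    thus ?thesis unfolding E6_eq_sigma5_series[OF im] E6_deriv_def by (simp only: times_divide_times_eq)
  qed
  ultimately show ?thesis unfolding phi_eq[OF im] by simp
qed

lemma has_field_derivative_phi:
  assumes "norm (nome \<tau>) < 1/125"
  shows "(phi has_field_derivative phi_deriv \<tau>) (at \<tau>)"
proof -
  define g where "g = (\<lambda>q. 1 / q - 570 + 20256 * q + eps q)"
  define q where "q = nome \<tau>"
  have q: "q \<noteq> 0" "norm q < 1/125" using assms by (auto simp: q_def)
  have "((\<lambda>q. 1 / q) has_field_derivative (- 1 / q ^ 2)) (at q)"
    using q by (auto intro!: derivative_eq_intros simp: power2_eq_square)
  hence "(g has_field_derivative (- 1 / q ^ 2 - 0 + 20256 * 1 + deriv eps q)) (at q)"
    unfolding g_def using q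
    by (intro DERIV_add DERIV_diff DERIV_const DERIV_cmult DERIV_ident has_field_derivative_eps) auto
  hence "((\<lambda>\<tau>. g (nome \<tau>)) has_field_derivative
      (- 1 / q ^ 2 - 0 + 20256 * 1 + deriv eps q) * (2 * of_real pi * \<i> * q)) (at \<tau>)"
    unfolding q_def by (rule DERIV_chain2[OF _ has_field_derivative_nome])
  hence "((\<lambda>\<tau>. \<tau> + \<i> / (168 * of_real pi) * g (nome \<tau>)) has_field_derivative
      (1 + \<i> / (168 * of_real pi) * ((- 1 / q ^ 2 - 0 + 20256 * 1 + deriv eps q) * (2 * of_real pi * \<i> * q)))) (at \<tau>)"
    by (intro DERIV_add DERIV_ident DERIV_cmult)
  also have "1 + \<i> / (168 * of_real pi) * ((- 1 / q ^ 2 - 0 + 20256 * 1 + deriv eps q) * (2 * of_real pi * \<i> * q)) = phi_deriv \<tau>"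
    unfolding phi_deriv_def q_def[symmetric] using q by (simp add: field_simps power2_eq_square)
  finally have "((\<lambda>\<tau>. \<tau> + \<i> / (168 * of_real pi) * g (nome \<tau>)) has_field_derivative phi_deriv \<tau>) (at \<tau>)" .
  moreover have "open {\<tau>. norm (nome \<tau>) < 1/125}"
    unfolding norm_nome by (intro open_Collect_less continuous_intros)
  ultimately show ?thesis
    by (rule has_field_derivative_transform_within_open) (use assms in \<open>auto simp: phi_expansion g_def\<close>)
qed

subsection \<open>The sign of the imaginary part\<close>

lemma nome_polar:
  "Re (nome \<tau>) = norm (nome \<tau>) * cos (2 * pi * Re \<tau>)"
  "Im (nome \<tau>) = norm (nome \<tau>) * sin (2 * pi * Re \<tau>)"
  unfolding norm_nome by (simp_all add: nome_def Re_exp Im_exp)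

lemma inverse_nome_polar:
  "Re (1 / nome \<tau>) = cos (2 * pi * Re \<tau>) / norm (nome \<tau>)"
  "Im (1 / nome \<tau>) = - sin (2 * pi * Re \<tau>) / norm (nome \<tau>)"
proof -
  have "1 / nome \<tau> = nome (- \<tau>)"
    by (simp add: nome_def exp_minus inverse_eq_divide)
  moreover have "norm (nome (- \<tau>)) = 1 / norm (nome \<tau>)" by (simp add: norm_nome exp_minus field_simps)
  ultimately show "Re (1 / nome \<tau>) = cos (2 * pi * Re \<tau>) / norm (nome \<tau>)"
    "Im (1 / nome \<tau>) = - sin (2 * pi * Re \<tau>) / norm (nome \<tau>)"
    using nome_polar[of "- \<tau>"] by simp_all
qed

lemma Im_phi:
  assumes "norm (nome \<tau>) < 1/125"
  shows "Im (phi \<tau>) = Im \<tau> + (cos (2 * pi * Re \<tau>) / norm (nome \<tau>) - 570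
     + 20256 * (norm (nome \<tau>) * cos (2 * pi * Re \<tau>)) + Re (eps (nome \<tau>))) / (168 * pi)"
proof -
  have *: "Im (\<i> / (168 * of_real pi) * z) = Re z / (168 * pi)" for z
  proof -
    have "\<i> / (168 * of_real pi) * z = (\<i> * z) / of_real (168 * pi)" by simp
    thus ?thesis by (simp only: Im_divide_of_real) simp
  qed
  show ?thesis unfolding phi_expansion[OF assms] plus_complex.sel * minus_complex.sel inverse_nome_polar
    by (simp add: nome_polar[of \<tau>])
qed

lemma Re_phi:
  assumes "norm (nome \<tau>) < 1/125"
  shows "Re (phi \<tau>) = Re \<tau> + (sin (2 * pi * Re \<tau>) / norm (nome \<tau>)
     - 20256 * (norm (nome \<tau>) * sin (2 * pi * Re \<tau>)) - Im (eps (nome \<tau>))) / (168 * pi)"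
proof -
  have *: "Re (\<i> / (168 * of_real pi) * z) = - Im z / (168 * pi)" for z
  proof -
    have "\<i> / (168 * of_real pi) * z = (\<i> * z) / of_real (168 * pi)" by simp
    thus ?thesis by (simp only: Re_divide_of_real) simp
  qed
  show ?thesis unfolding phi_expansion[OF assms] plus_complex.sel * minus_complex.sel inverse_nome_polar
    by (simp add: nome_polar[of \<tau>])
qed

lemma sin_2pi_pos: "0 < x \<Longrightarrow> x < 1/2 \<Longrightarrow> sin (2 * pi * x) > 0"
  by (intro sin_gt_zero) (auto simp: field_simps)

lemma cos_2pi_nonneg: "0 \<le> x \<Longrightarrow> x \<le> 1/4 \<Longrightarrow> cos (2 * pi * x) \<ge> 0"
  by (intro cos_ge_zero) (auto simp: field_simps intro: order_trans[of _ 0])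

lemma cos_2pi_nonpos:
  assumes "1/4 \<le> x" "x \<le> 1/2" shows "cos (2 * pi * x) \<le> 0"
proof -
  have "cos (2 * pi * x) = - sin (2 * pi * (x - 1/4))"
    using sin_cos_eq[of "2 * pi * (x - 1/4)"] cos_minus[of "2 * pi * x - pi"] cos_periodic_pi[of "2 * pi * x - pi"]
    by (simp add: algebra_simps)
  moreover have "sin (2 * pi * (x - 1/4)) \<ge> 0"
    using assms by (intro sin_ge_zero) (auto simp: field_simps)
  ultimately show ?thesis by simp
qed

lemma nome_small:
  assumes "Im \<tau> \<ge> 19/20"
  shows "norm (nome \<tau>) < 1/125" "norm (nome \<tau>) \<le> 1/380" "0 < norm (nome \<tau>)"
  using nome_bound_19_20[OF assms] by auto

text \<open>Lets the leading term 1 / |q| absorb multiples of |q|; 144400 is 380^2.\<close>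

lemma nome_sq_le:
  assumes "Im \<tau> \<ge> 19/20" shows "K \<ge> 0 \<Longrightarrow> K \<le> 144400 \<Longrightarrow> K * norm (nome \<tau>) \<le> 1 / norm (nome \<tau>)"
proof -
  note q = nome_small[OF assms]
  assume K: "K \<ge> 0" "K \<le> 144400"
  have "K * (norm (nome \<tau>) * norm (nome \<tau>)) \<le> 144400 * (1/380 * (1/380))"
    using q K by (intro mult_mono) auto
  thus ?thesis using q by (simp add: field_simps)
qed

text \<open>Every term carries the factor s = sin(2 pi Re tau) > 0. The term from 20256 q has the
  sign of the leading -s / |q|, and the remainder is at most 62700 |q| s, which does not exceed s /
  |q|.\<close>

lemma Im_phi_deriv_neg:
  assumes "Im \<tau> \<ge> 19/20" "0 < Re \<tau>" "Re \<tau> < 1/2"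
  shows "Im (phi_deriv \<tau>) < 0"
proof -
  note q = nome_small[OF assms(1)]
  define \<rho> where "\<rho> = norm (nome \<tau>)"
  define s where "s = sin (2 * pi * Re \<tau>)"
  have s: "s > 0" unfolding s_def by (rule sin_2pi_pos[OF assms(2,3)])
  have "\<bar>Im (nome \<tau> * deriv eps (nome \<tau>))\<bar> \<le> 62700 * (\<rho> * s)"
    using Im_deriv_eps_bound[OF q(2)] s q(3) unfolding nome_polar(2)[of \<tau>] \<rho>_def s_def by (simp add: abs_mult)
  hence *: "- Im (nome \<tau> * deriv eps (nome \<tau>)) \<le> 62700 * (\<rho> * s)" by linarith
  have "62700 * \<rho> \<le> 1 / \<rho>" unfolding \<rho>_def by (rule nome_sq_le[OF assms(1)]) auto
  hence "62700 * \<rho> * s \<le> 1 / \<rho> * s" using s by (intro mult_right_mono) auto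
  hence **: "62700 * (\<rho> * s) \<le> s / \<rho>" by (simp add: mult.assoc)
  have "\<rho> * s > 0" using s q(3) by (simp add: \<rho>_def)
  have "Im (phi_deriv \<tau>) = Im (1 / nome \<tau> - 20256 * nome \<tau> - nome \<tau> * deriv eps (nome \<tau>)) / 84"
    by (simp add: phi_deriv_def)
  also have "Im (1 / nome \<tau> - 20256 * nome \<tau> - nome \<tau> * deriv eps (nome \<tau>)) =
      - s / \<rho> - 20256 * (\<rho> * s) - Im (nome \<tau> * deriv eps (nome \<tau>))"
    unfolding minus_complex.sel inverse_nome_polar s_def \<rho>_def by (simp add: nome_polar[of \<tau>])
  also have "\<dots> < 0" using * ** \<open>\<rho> * s > 0\<close> by simp
  finally show ?thesis by simp
qed

text \<open>Half of the leading term absorbs the other terms, all of them multiples of the same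
  sine; hence 336 pi where the expansion has 168 pi.\<close>

lemma Re_phi_lower:
  assumes "Im \<tau> \<ge> 19/20" "0 < Re \<tau>" "Re \<tau> < 1/2"
  shows "Re (phi \<tau>) \<ge> Re \<tau> + sin (2 * pi * Re \<tau>) / norm (nome \<tau>) / (336 * pi)"
proof -
  note q = nome_small[OF assms(1)]
  define \<rho> where "\<rho> = norm (nome \<tau>)"
  define s where "s = sin (2 * pi * Re \<tau>)"
  have s: "s > 0" unfolding s_def by (rule sin_2pi_pos[OF assms(2,3)])
  have *: "\<bar>Im (eps (nome \<tau>))\<bar> \<le> 20900 * (\<rho> * s)"
    using Im_eps_bound[OF q(2)] s q(3) unfolding nome_polar(2)[of \<tau>] \<rho>_def s_def by (simp add: abs_mult)
  have "(20256 + 20900) * 2 * \<rho> \<le> 1 / \<rho>" unfolding \<rho>_def by (rule nome_sq_le[OF assms(1)]) auto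
  hence "(20256 + 20900) * 2 * \<rho> * s \<le> 1 / \<rho> * s" using s by (intro mult_right_mono) auto
  hence "s / \<rho> / 2 \<le> s / \<rho> - 20256 * (\<rho> * s) - Im (eps (nome \<tau>))" using * by (simp add: algebra_simps)
  hence "s / \<rho> / 2 / (168 * pi) \<le> (s / \<rho> - 20256 * (\<rho> * s) - Im (eps (nome \<tau>))) / (168 * pi)"
    by (intro divide_right_mono) auto
  thus ?thesis unfolding Re_phi[OF q(1)] s_def[symmetric] \<rho>_def[symmetric] by simp
qed

lemma Re_phi_pos:
  assumes "Im \<tau> \<ge> 19/20" "0 < Re \<tau>" "Re \<tau> < 1/2"
  shows "Re (phi \<tau>) > 0"
proof -
  have "0 \<le> sin (2 * pi * Re \<tau>) / norm (nome \<tau>) / (336 * pi)"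
    using sin_2pi_pos[OF assms(2,3)] by (intro divide_nonneg_nonneg) auto
  thus ?thesis using Re_phi_lower[OF assms] assms(2) by linarith
qed

lemma eps_le_11:
  assumes "Im \<tau> \<ge> 19/20" shows "\<bar>Re (eps (nome \<tau>))\<bar> \<le> 11"
proof -
  have "norm (eps (nome \<tau>)) \<le> 1180000 * (1/380)^2 / (1 - 75 * (1/380))"
    using nome_small[OF assms] by (intro eps_le) auto
  also have "\<dots> \<le> 11" by (simp add: power2_eq_square)
  finally show ?thesis using abs_Re_le_cmod order_trans by blast
qed

lemma scale_168_pi: "(y + K / (168 * pi)) * (168 * pi) = y * (168 * pi) + K"
  by (simp add: distrib_right)

lemma has_vector_derivative_Im:
  assumes "(f has_vector_derivative d) (at t)"
  shows "((\<lambda>t. Im (f t)) has_real_derivative Im d) (at t)"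
  using bounded_linear.has_vector_derivative[OF bounded_linear_Im assms]
  by (simp add: has_real_derivative_iff_has_vector_derivative)

lemma Im_phi_pos_Re_0:
  assumes "Im \<tau> \<ge> 19/20" "Re \<tau> = 0"
  shows "Im (phi \<tau>) > 0"
proof -
  note q = nome_small[OF assms(1)]
  have 1: "1 / norm (nome \<tau>) \<ge> 380" using q by (simp add: field_simps)
  have "19/20 * 3 \<le> Im \<tau> * pi" using assms pi_gt3 by (intro mult_mono) auto
  moreover have "Im \<tau> * (168 * pi) = 168 * (Im \<tau> * pi)" by simp
  ultimately have "168 * (57/20) \<le> Im \<tau> * (168 * pi)" by linarith
  \<comment> \<open>168 (57/20) + 380 exceeds 570 + 11, where 11 bounds the remainder.\<close>
  hence "0 < Im \<tau> * (168 * pi) + (1 / norm (nome \<tau>) - 570 + 20256 * norm (nome \<tau>) + Re (eps (nome \<tau>)))"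
    using 1 q eps_le_11[OF assms(1)] by linarith
  also have "\<dots> = (Im \<tau> + (1 / norm (nome \<tau>) - 570 + 20256 * norm (nome \<tau>) + Re (eps (nome \<tau>))) / (168 * pi)) * (168 * pi)"
    by (rule scale_168_pi[symmetric])
  finally have "0 < Im \<tau> + (1 / norm (nome \<tau>) - 570 + 20256 * norm (nome \<tau>) + Re (eps (nome \<tau>))) / (168 * pi)"
    by (rule zero_less_mult_pos2) simp
  thus ?thesis unfolding Im_phi[OF q(1)] assms(2) by simp
qed

lemma Im_phi_neg_criterion:
  assumes "norm (nome \<tau>) < 1/125"
    and "Im \<tau> * (168 * pi) + cos (2 * pi * Re \<tau>) / norm (nome \<tau>) - 570
      + 20256 * (norm (nome \<tau>) * cos (2 * pi * Re \<tau>)) + Re (eps (nome \<tau>)) < 0"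
  shows "Im (phi \<tau>) < 0"
proof -
  have "Im (phi \<tau>) * (168 * pi) = Im \<tau> * (168 * pi) + (cos (2 * pi * Re \<tau>) / norm (nome \<tau>) - 570
      + 20256 * (norm (nome \<tau>) * cos (2 * pi * Re \<tau>)) + Re (eps (nome \<tau>)))"
    unfolding Im_phi[OF assms(1)] by (rule scale_168_pi)
  hence "Im (phi \<tau>) * (168 * pi) < 0" using assms(2) by linarith
  thus ?thesis by (simp add: mult_less_0_iff)
qed

text \<open>The leading term is now -exp(u) with u = 2 pi Im tau and has to beat 84 u - 570 plus the
  remainder. The tangent of exp at 5 together with exp 5 >= 147 gives exp u >= 147 (u - 4), which
  suffices.\<close>

lemma Im_phi_neg_Re_half:
  assumes "Im \<tau> \<ge> 19/20" "Re \<tau> = 1/2"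
  shows "Im (phi \<tau>) < 0"
proof (rule Im_phi_neg_criterion)
  note q = nome_small[OF assms(1)]
  show "norm (nome \<tau>) < 1/125" by (rule q)
  define u where "u = 2 * pi * Im \<tau>"
  have u: "u \<ge> 57/10"
  proof -
    have "2 * 3 * (19/20) \<le> 2 * pi * Im \<tau>" using pi_gt3 assms by (intro mult_mono) auto
    thus ?thesis by (simp add: u_def)
  qed
  have e: "1 / norm (nome \<tau>) = exp u" by (simp add: norm_nome u_def exp_minus field_simps)
  have eu: "147 * u - 588 \<le> exp u"
  proof -
    have "(147::real) \<le> (1 + 5 / 64 + (5 / 64)\<^sup>2 / 2) ^ 64" by (simp add: power2_eq_square power_divide)
    also have "\<dots> \<le> exp 5" by (rule exp_ge_power_64) simp
    finally have "(147::real) \<le> exp 5" .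
    hence "147 * (u - 4) \<le> exp 5 * exp (u - 5)"
      using u exp_ge_add_one_self[of "u - 5"] by (intro mult_mono) auto
    thus ?thesis by (simp add: right_diff_distrib flip: exp_add)
  qed
  have R: "Re (eps (nome \<tau>)) \<le> 11" using eps_le_11[OF assms(1)] by (rule abs_le_D1)
  have i: "Im \<tau> * (168 * pi) = 84 * u" by (simp add: u_def)
  have c: "cos (2 * pi * Re \<tau>) = - 1" unfolding assms(2) by simp
  have "- 1 / norm (nome \<tau>) = - exp u" using e by simp
  thus "Im \<tau> * (168 * pi) + cos (2 * pi * Re \<tau>) / norm (nome \<tau>) - 570
      + 20256 * (norm (nome \<tau>) * cos (2 * pi * Re \<tau>)) + Re (eps (nome \<tau>)) < 0"
    using u q(3) eu R unfolding i c by linarith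
qed

text \<open>Handles the part of F near its corner. The cosine is nonpositive, so the terms in 1/q
  and q only help; Im tau contributes less than 507 and the remainder at most 35, together less than
  570.\<close>

lemma Im_phi_neg_low:
  assumes "Im \<tau> \<ge> sqrt 3 / 2" "Im \<tau> \<le> 96/100" "1/4 \<le> Re \<tau>" "Re \<tau> \<le> 1/2"
  shows "Im (phi \<tau>) < 0"
proof (rule Im_phi_neg_criterion)
  have q: "norm (nome \<tau>) \<le> 1/227" by (rule nome_bound_sqrt_3[OF assms(1)])
  thus "norm (nome \<tau>) < 1/125" by simp
  have "norm (eps (nome \<tau>)) \<le> 1180000 * (1/227)^2 / (1 - 75 * (1/227))"
    using q by (intro eps_le) auto
  also have "\<dots> \<le> 35" by (simp add: power2_eq_square)
  finally have e: "Re (eps (nome \<tau>)) \<le> 35" using complex_Re_le_cmod order_trans by blast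
  have c: "cos (2 * pi * Re \<tau>) \<le> 0" by (rule cos_2pi_nonpos[OF assms(3,4)])
  have 1: "cos (2 * pi * Re \<tau>) / norm (nome \<tau>) \<le> 0" using c by (simp add: divide_nonpos_nonneg)
  have 2: "norm (nome \<tau>) * cos (2 * pi * Re \<tau>) \<le> 0" using c by (simp add: mult_nonneg_nonpos)
  have "0 \<le> Im \<tau>" using assms(1) sqrt_3_bounds by linarith
  hence "Im \<tau> * (168 * pi) \<le> 96/100 * (168 * (31416/10000))"
    using assms(2) pi_approx by (intro mult_mono) auto
  thus "Im \<tau> * (168 * pi) + cos (2 * pi * Re \<tau>) / norm (nome \<tau>) - 570
      + 20256 * (norm (nome \<tau>) * cos (2 * pi * Re \<tau>)) + Re (eps (nome \<tau>)) < 0"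
    using e 1 2 by linarith
qed

text \<open>On Re tau = 1/4 the cosine vanishes and Im phi is Im tau - 570 / (168 pi) up to the
  remainder. That quotient is about 1.08, so height 1 is still on the negative side.\<close>

lemma Im_phi_neg_quarter: "Im (phi (Complex (1/4) 1)) < 0"
proof (rule Im_phi_neg_criterion)
  let ?\<tau> = "Complex (1/4) 1"
  have im: "Im ?\<tau> \<ge> 19/20" by simp
  show "norm (nome ?\<tau>) < 1/125" by (rule nome_small[OF im])
  have c: "cos (2 * pi * Re ?\<tau>) = 0" by simp
  show "Im ?\<tau> * (168 * pi) + cos (2 * pi * Re ?\<tau>) / norm (nome ?\<tau>) - 570
      + 20256 * (norm (nome ?\<tau>) * cos (2 * pi * Re ?\<tau>)) + Re (eps (nome ?\<tau>)) < 0"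
    unfolding c using eps_le_11[OF im] pi_approx by simp
qed

text \<open>By the Cauchy-Riemann equations this is the derivative of Im phi along vertical lines.
  For Re tau <= 1/4 the cosine is nonnegative, so 1/q outweighs 20256 q, and the remainder is at
  most 55 < 84.\<close>

lemma Re_phi_deriv_pos:
  assumes "Im \<tau> \<ge> 19/20" "0 \<le> Re \<tau>" "Re \<tau> \<le> 1/4"
  shows "Re (phi_deriv \<tau>) > 0"
proof -
  note q = nome_small[OF assms(1)]
  define \<rho> where "\<rho> = norm (nome \<tau>)"
  define c where "c = cos (2 * pi * Re \<tau>)"
  have c: "c \<ge> 0" unfolding c_def by (rule cos_2pi_nonneg[OF assms(2,3)])
  have "norm (nome \<tau> * deriv eps (nome \<tau>)) \<le> 1/380 * 20900"
    unfolding norm_mult using q(2) eps_deriv_bounds(1)[OF q(2)] by (intro mult_mono) auto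
  hence *: "Re (nome \<tau> * deriv eps (nome \<tau>)) \<le> 55"
    using complex_Re_le_cmod[of "nome \<tau> * deriv eps (nome \<tau>)"] by linarith
  have "20256 * \<rho> \<le> 1 / \<rho>" unfolding \<rho>_def by (rule nome_sq_le[OF assms(1)]) auto
  hence "20256 * \<rho> * c \<le> 1 / \<rho> * c" using c by (intro mult_right_mono) auto
  hence **: "20256 * (\<rho> * c) \<le> c / \<rho>" by (simp add: mult.assoc)
  have "Re (phi_deriv \<tau>) = 1 + Re (1 / nome \<tau> - 20256 * nome \<tau> - nome \<tau> * deriv eps (nome \<tau>)) / 84"
    by (simp add: phi_deriv_def)
  also have "Re (1 / nome \<tau> - 20256 * nome \<tau> - nome \<tau> * deriv eps (nome \<tau>)) =
      c / \<rho> - 20256 * (\<rho> * c) - Re (nome \<tau> * deriv eps (nome \<tau>))"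
    unfolding minus_complex.sel inverse_nome_polar c_def \<rho>_def by (simp add: nome_polar[of \<tau>])
  also have "1 + (c / \<rho> - 20256 * (\<rho> * c) - Re (nome \<tau> * deriv eps (nome \<tau>))) / 84 > 0"
  proof -
    have "1 + (A - B - R) / 84 > 0" if "B \<le> A" "R \<le> 55" for A B R :: real using that by (simp add: field_simps)
    thus ?thesis using * ** by blast
  qed
  finally show ?thesis .
qed

text \<open>In the nome this reflection is complex conjugation, and the expansion has real
  coefficients.\<close>

lemma phi_reflection:
  assumes "norm (nome \<tau>) < 1/125"
  shows "phi (1 - cnj \<tau>) = 1 - cnj (phi \<tau>)"
proof -
  have n: "nome (1 - cnj \<tau>) = cnj (nome \<tau>)"
  proof -
    have "nome (1 - cnj \<tau>) = nome (- cnj \<tau> + 1)" by simp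
    also have "\<dots> = nome (- cnj \<tau>)" by (rule nome_plus_1)
    also have "\<dots> = cnj (nome \<tau>)" by (simp add: nome_def exp_cnj)
    finally show ?thesis .
  qed
  have s: "norm (nome (1 - cnj \<tau>)) < 1/125" using assms by (simp add: n)
  have "eps (cnj (nome \<tau>)) = cnj (eps (nome \<tau>))" using assms by (intro eps_cnj) auto
  thus ?thesis unfolding phi_expansion[OF s] phi_expansion[OF assms] n by simp
qed

lemma isCont_phi: "norm (nome \<tau>) < 1/125 \<Longrightarrow> isCont phi \<tau>"
  by (rule DERIV_isCont[OF has_field_derivative_phi])

text \<open>Along horizontal lines the derivative of Im phi is Im phi'. Its sign is needed only in
  the open interval, so the abscissas 0 and 1/2 may be endpoints.\<close>

lemma Im_phi_strict_decreasing:
  assumes "y \<ge> 19/20" "0 \<le> x1" "x1 < x2" "x2 \<le> 1/2"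
  shows "Im (phi (Complex x2 y)) < Im (phi (Complex x1 y))"
proof (rule DERIV_neg_imp_decreasing_open[OF assms(3)])
  have n: "norm (nome (Complex x y)) < 1/125" for x using nome_small[of "Complex x y"] assms(1) by simp
  have d: "((\<lambda>x. Im (phi (Complex x y))) has_real_derivative Im (phi_deriv (Complex x y))) (at x)" for x
  proof -
    have "((\<lambda>x. Complex x y) has_vector_derivative 1) (at x)"
      unfolding complex_of_real_def[symmetric] Complex_eq
      by (auto intro!: derivative_eq_intros)
    from field_vector_diff_chain_at[OF this has_field_derivative_phi[OF n]]
    have "((\<lambda>x. phi (Complex x y)) has_vector_derivative phi_deriv (Complex x y)) (at x)"
      by (simp add: o_def)
    thus ?thesis by (rule has_vector_derivative_Im)
  qed
  show "\<exists>d. ((\<lambda>x. Im (phi (Complex x y))) has_real_derivative d) (at x) \<and> d < 0" if "x1 < x" "x < x2" for x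
    using d[of x] Im_phi_deriv_neg[of "Complex x y"] that assms by auto
  show "continuous_on {x1..x2} (\<lambda>x. Im (phi (Complex x y)))"
    using d DERIV_isCont by (intro continuous_at_imp_continuous_on) blast
qed

lemma Im_phi_strict_increasing:
  assumes "0 \<le> x" "x \<le> 1/4" "19/20 \<le> y1" "y1 < y2"
  shows "Im (phi (Complex x y1)) < Im (phi (Complex x y2))"
proof (rule DERIV_pos_imp_increasing[OF assms(4)])
  fix y assume y: "y1 \<le> y" "y \<le> y2"
  have n: "norm (nome (Complex x y)) < 1/125" using nome_small[of "Complex x y"] assms(3) y by simp
  have "((\<lambda>y. Complex x y) has_vector_derivative \<i>) (at y)"
    unfolding Complex_eq by (auto intro!: derivative_eq_intros)
  from field_vector_diff_chain_at[OF this has_field_derivative_phi[OF n]]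
  have "((\<lambda>y. phi (Complex x y)) has_vector_derivative \<i> * phi_deriv (Complex x y)) (at y)"
    by (simp add: o_def)
  from has_vector_derivative_Im[OF this]
  have "((\<lambda>y. Im (phi (Complex x y))) has_real_derivative Re (phi_deriv (Complex x y))) (at y)" by simp
  moreover have "Re (phi_deriv (Complex x y)) > 0" using assms y by (intro Re_phi_deriv_pos) auto
  ultimately show "\<exists>d. ((\<lambda>y. Im (phi (Complex x y))) has_real_derivative d) (at y) \<and> 0 < d" by blast
qed

text \<open>The Noshiro-Warschawski criterion: (f(b) - f(a)) / (b - a) is the mean of f' over the
  segment from a to b, so its imaginary part cannot be 0.\<close>

lemma inj_on_of_Im_deriv_neg:
  assumes "convex S" "\<And>z. z \<in> S \<Longrightarrow> (f has_field_derivative f' z) (at z)" "\<And>z. z \<in> S \<Longrightarrow> Im (f' z) < 0"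
  shows "inj_on f S"
proof (rule inj_onI, rule ccontr)
  fix a b assume ab: "a \<in> S" "b \<in> S" "f a = f b" "a \<noteq> b"
  define p where "p = (\<lambda>t::real. a + of_real t * (b - a))"
  have pS: "p t \<in> S" if "t \<in> {0..1}" for t
  proof -
    have "p t = (1 - t) *\<^sub>R a + t *\<^sub>R b" by (simp add: p_def scaleR_conv_of_real algebra_simps)
    thus ?thesis using convexD[OF assms(1) ab(1,2), of "1 - t" t] that by simp
  qed
  define g where "g = (\<lambda>t. Im (f (p t) / (b - a)))"
  have dg: "(g has_real_derivative Im (f' (p t))) (at t)" if "t \<in> {0..1}" for t
  proof -
    have "(p has_vector_derivative (b - a)) (at t)"
      unfolding p_def by (auto intro!: derivative_eq_intros)
    from field_vector_diff_chain_at[OF this assms(2)[OF pS[OF that]]]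
    have "((f \<circ> p) has_vector_derivative (b - a) * f' (p t)) (at t)" .
    from has_vector_derivative_mult_right[OF this, of "1 / (b - a)"]
    have "((\<lambda>t. f (p t) / (b - a)) has_vector_derivative f' (p t)) (at t)" using ab(4) by (simp add: o_def)
    thus ?thesis unfolding g_def by (rule has_vector_derivative_Im)
  qed
  have "g 1 < g 0"
  proof (rule DERIV_neg_imp_decreasing[where f = g, OF zero_less_one])
    fix t :: real assume "0 \<le> t" "t \<le> 1"
    thus "\<exists>d. (g has_real_derivative d) (at t) \<and> d < 0" using dg assms(3) pS by (meson atLeastAtMost_iff)
  qed
  moreover have "g 1 = g 0" using ab(3) by (simp add: g_def p_def)
  ultimately show False by simp
qed

subsection \<open>The real locus as a curve\<close>

text \<open>The height \<open>19/20\<close> is below every point of \<open>F\<close> with \<open>Re \<tau> \<le> 1/4\<close>; lower points of \<open>F\<close> with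
  \<open>Re \<tau> \<le> 1/2\<close> are excluded from the real locus by \<open>Im \<phi> < 0\<close>.\<close>

definition strip :: "complex set" where
  "strip = {\<tau>. 0 < Re \<tau> \<and> Re \<tau> < 1/2 \<and> 19/20 < Im \<tau>}"

lemma open_strip: "open strip" and convex_strip: "convex strip"
proof -
  have eq: "strip = {\<tau>. Re \<tau> > 0} \<inter> {\<tau>. Re \<tau> < 1/2} \<inter> {\<tau>. Im \<tau> > 19/20}" by (auto simp: strip_def)
  show "open strip" unfolding eq
    by (intro open_Int open_halfspace_Re_gt open_halfspace_Re_lt open_halfspace_Im_gt)
  show "convex strip" unfolding eq
    by (intro convex_Int convex_halfspace_Re_gt convex_halfspace_Re_lt convex_halfspace_Im_gt)
qed

lemma inj_on_phi_strip: "inj_on phi strip"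
  by (rule inj_on_of_Im_deriv_neg[OF convex_strip, of _ phi_deriv])
     (auto simp: strip_def intro!: has_field_derivative_phi nome_small Im_phi_deriv_neg)

lemma holomorphic_phi_strip: "phi holomorphic_on strip"
proof (rule holomorphic_onI)
  fix \<tau> assume "\<tau> \<in> strip"
  hence "norm (nome \<tau>) < 1/125" by (intro nome_small) (auto simp: strip_def)
  from has_field_derivative_phi[OF this]
  show "phi field_differentiable at \<tau> within strip"
    by (auto simp: field_differentiable_def intro: has_field_derivative_at_within)
qed

section \<open>The zero of Im phi on a horizontal line\<close>

lemma continuous_Im_phi_Complex:
  assumes "y \<ge> 19/20"
  shows "isCont (\<lambda>x. Im (phi (Complex x y))) x" "isCont (\<lambda>y. Im (phi (Complex x y))) y"
proof -
  have c: "isCont phi (Complex x y)" using assms by (intro isCont_phi nome_small) simp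
  have "isCont (\<lambda>x. Complex x y) x" "isCont (\<lambda>y. Complex x y) y"
    unfolding Complex_eq by (intro continuous_intros)+
  from isCont_o2[OF this(1) c] isCont_o2[OF this(2) c]
  show "isCont (\<lambda>x. Im (phi (Complex x y))) x" "isCont (\<lambda>y. Im (phi (Complex x y))) y"
    by (auto intro: continuous_intros)
qed

text \<open>For y >= 19/20 the choice is unique, as Im phi is strictly decreasing along the
  line.\<close>

definition root_x :: "real \<Rightarrow> real" where
  "root_x y = (SOME x. 0 < x \<and> x < 1/2 \<and> Im (phi (Complex x y)) = 0)"

lemma root_x:
  assumes "y \<ge> 19/20"
  shows "0 < root_x y" "root_x y < 1/2" "Im (phi (Complex (root_x y) y)) = 0"
proof -
  have p: "Im (phi (Complex 0 y)) > 0" using assms by (intro Im_phi_pos_Re_0) auto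
  have n: "Im (phi (Complex (1/2) y)) < 0" using assms by (intro Im_phi_neg_Re_half) auto
  have "continuous_on {0..1/2} (\<lambda>x. Im (phi (Complex x y)))"
    using continuous_Im_phi_Complex(1)[OF assms] by (intro continuous_at_imp_continuous_on) blast
  then obtain x where x: "0 \<le> x" "x \<le> 1/2" "Im (phi (Complex x y)) = 0"
    using IVT2'[of "\<lambda>x. Im (phi (Complex x y))" "1/2" 0 0] p n by auto
  have "x \<noteq> 0" "x \<noteq> 1/2" using x(3) p n by (metis less_irrefl)+
  hence "\<exists>x. 0 < x \<and> x < 1/2 \<and> Im (phi (Complex x y)) = 0" using x by (intro exI[of _ x]) auto
  from someI_ex[OF this] show "0 < root_x y" "root_x y < 1/2" "Im (phi (Complex (root_x y) y)) = 0"
    unfolding root_x_def by auto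
qed

lemma Im_phi_sign:
  assumes "y \<ge> 19/20" "0 \<le> x" "x \<le> 1/2"
  shows "Im (phi (Complex x y)) < 0 \<longleftrightarrow> root_x y < x" "Im (phi (Complex x y)) > 0 \<longleftrightarrow> x < root_x y"
    "Im (phi (Complex x y)) = 0 \<longleftrightarrow> x = root_x y"
proof -
  note r = root_x[OF assms(1)]
  have 1: "Im (phi (Complex x y)) < 0" if "root_x y < x"
    using Im_phi_strict_decreasing[OF assms(1) _ that assms(3)] r by simp
  have 2: "Im (phi (Complex x y)) > 0" if "x < root_x y"
    using Im_phi_strict_decreasing[OF assms(1,2) that] r by simp
  show "Im (phi (Complex x y)) < 0 \<longleftrightarrow> root_x y < x" "Im (phi (Complex x y)) > 0 \<longleftrightarrow> x < root_x y"
    "Im (phi (Complex x y)) = 0 \<longleftrightarrow> x = root_x y"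
    using 1 2 r(3) by (cases x "root_x y" rule: linorder_cases; force)+
qed

text \<open>The sign of Im phi at a fixed abscissa b beside the root persists on nearby lines and,
  by \<open>Im_phi_sign\<close>, keeps their roots on the same side of b. Clipping keeps b inside
  [0, 1/2], where that criterion applies.\<close>

lemma continuous_on_root_x: "continuous_on {19/20..} root_x"
  unfolding continuous_on_def
proof
  fix y1 :: real assume "y1 \<in> {19/20..}"
  hence y1: "y1 \<ge> 19/20" by simp
  note r = root_x[OF y1]
  have ev: "eventually (\<lambda>y. y \<ge> 19/20) (at y1 within {19/20..})"
    by (auto simp: eventually_at intro: exI[of _ 1])
  have lim: "((\<lambda>y. Im (phi (Complex x y))) \<longlongrightarrow> Im (phi (Complex x y1))) (at y1 within {19/20..})" for x
    using continuous_Im_phi_Complex(2)[OF y1, of x] unfolding isCont_def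
    by (rule tendsto_within_subset) auto
  show "(root_x \<longlongrightarrow> root_x y1) (at y1 within {19/20..})"
  proof (rule order_tendstoI)
    fix a assume a: "a < root_x y1"
    define b where "b = (max a 0 + root_x y1) / 2"
    have b: "a < b" "0 \<le> b" "b < root_x y1" using a r by (auto simp: b_def)
    hence "Im (phi (Complex b y1)) > 0" using Im_phi_sign(2)[OF y1, of b] r by simp
    from order_tendstoD(1)[OF lim this] ev
    show "eventually (\<lambda>y. a < root_x y) (at y1 within {19/20..})"
    proof eventually_elim
      case (elim y)
      thus ?case using Im_phi_sign(2)[of y b] b r by simp
    qed
  next
    fix a assume a: "root_x y1 < a"
    define b where "b = (min a (1/2) + root_x y1) / 2"
    have b: "b < a" "b \<le> 1/2" "root_x y1 < b" using a r by (auto simp: b_def min_def)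
    hence "Im (phi (Complex b y1)) < 0" using Im_phi_sign(1)[OF y1, of b] r by simp
    from order_tendstoD(2)[OF lim this] ev
    show "eventually (\<lambda>y. root_x y < a) (at y1 within {19/20..})"
    proof eventually_elim
      case (elim y)
      thus ?case using Im_phi_sign(1)[of y b] b r by simp
    qed
  qed
qed

lemma root_x_less_quarter:
  assumes "19/20 \<le> y" "y \<le> 1" shows "root_x y < 1/4"
proof -
  have "Im (phi (Complex (1/4) y)) \<le> Im (phi (Complex (1/4) 1))"
    using Im_phi_strict_increasing[of "1/4" y 1] assms by (cases "y = 1") auto
  hence "Im (phi (Complex (1/4) y)) < 0" using Im_phi_neg_quarter by simp
  thus ?thesis using Im_phi_sign(1)[of y "1/4"] assms by simp
qed

text \<open>Left of Re tau = 1/4 the function Im phi increases with height, so it is positive on the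
  higher line at the old root and the new root lies further right. Height at most 1 keeps the root
  in that range.\<close>

lemma root_x_strict_mono:
  assumes "19/20 \<le> y1" "y1 < y2" "y2 \<le> 1" shows "root_x y1 < root_x y2"
proof -
  have q: "root_x y1 < 1/4" using assms by (intro root_x_less_quarter) auto
  note r = root_x[OF assms(1)]
  have "Im (phi (Complex (root_x y1) y1)) < Im (phi (Complex (root_x y1) y2))"
    using assms q r by (intro Im_phi_strict_increasing) auto
  thus ?thesis using Im_phi_sign(2)[of y2 "root_x y1"] r assms by simp
qed

text \<open>The height at which the graph of \<open>root_x\<close> enters F through the unit circle.
  Up to height 1 both coordinates increase along the graph, so the squared modulus reaches 1 exactly
  once; above height 1 it stays larger than 1.\<close>

lemma threshold_height:
  obtains y0 where "19/20 < y0" "y0 < 1" "root_x y0 ^ 2 + y0 ^ 2 = 1"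
    "\<And>y. y \<ge> 19/20 \<Longrightarrow> root_x y ^ 2 + y ^ 2 \<ge> 1 \<longleftrightarrow> y \<ge> y0"
proof -
  define g where "g = (\<lambda>y. root_x y ^ 2 + y ^ 2)"
  have mono: "g y1 < g y2" if "19/20 \<le> y1" "y1 < y2" "y2 \<le> 1" for y1 y2
  proof -
    have "root_x y1 ^ 2 < root_x y2 ^ 2"
      using root_x_strict_mono[OF that] root_x[OF that(1)] by (intro power_strict_mono) auto
    moreover have "y1 ^ 2 < y2 ^ 2" using that by (intro power_strict_mono) auto
    ultimately show ?thesis by (simp add: g_def)
  qed
  have "continuous_on {19/20..1} g"
    unfolding g_def by (intro continuous_intros continuous_on_subset[OF continuous_on_root_x]) auto
  \<comment> \<open>This is where 19/20 < sqrt 15 / 4 enters: 1/16 + (19/20)^2 < 1.\<close>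
  moreover have lo: "g (19/20) < 1"
  proof -
    have "root_x (19/20) ^ 2 \<le> (1/4) ^ 2"
      using root_x_less_quarter[of "19/20"] root_x[of "19/20"] by (intro power_mono) auto
    thus ?thesis by (simp add: g_def power2_eq_square)
  qed
  moreover have hi: "g 1 > 1" using root_x[of 1] by (simp add: g_def)
  ultimately obtain y0 where y0: "19/20 \<le> y0" "y0 \<le> 1" "g y0 = 1"
    using IVT'[of g "19/20" 1 1] by auto
  have y0': "19/20 < y0" "y0 < 1" using y0 lo hi by (metis less_eq_real_def order_less_irrefl)+
  have "g y \<ge> 1 \<longleftrightarrow> y \<ge> y0" if y: "y \<ge> 19/20" for y
  proof (cases "y \<le> 1")
    case True
    show ?thesis
    proof (cases y y0 rule: linorder_cases)
      case less thus ?thesis using mono[OF y less y0(2)] y0(3) by simp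
    next
      case greater thus ?thesis using mono[OF y0(1) greater True] y0(3) by simp
    qed (use y0 in auto)
  next
    case False
    hence "y ^ 2 \<ge> 1 ^ 2" by (intro power_mono) auto
    moreover have "root_x y ^ 2 \<ge> 0" by simp
    ultimately show ?thesis using False y0 unfolding g_def power_one by linarith
  qed
  thus ?thesis using that[OF y0'] y0(3) unfolding g_def by blast
qed

text \<open>Solving Im phi = 0 for the cosine bounds it by |q| times a linear function of y, which
  tends to 0; arccos recovers the abscissa.\<close>

lemma tendsto_root_x: "(root_x \<longlongrightarrow> 1/4) at_top"
proof -
  define c where "c = (\<lambda>y. cos (2 * pi * root_x y))"
  have "(c \<longlongrightarrow> 0) at_top"
  proof (rule Lim_null_comparison)
    show "((\<lambda>y. exp (- 2 * pi * y) * (168 * pi * y + 640)) \<longlongrightarrow> 0) at_top" by real_asymp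
    show "eventually (\<lambda>y. norm (c y) \<le> exp (- 2 * pi * y) * (168 * pi * y + 640)) at_top"
      using eventually_ge_at_top[of "19/20"]
    proof eventually_elim
      case (elim y)
      define \<tau> where "\<tau> = Complex (root_x y) y"
      have im: "Im \<tau> \<ge> 19/20" using elim by (simp add: \<tau>_def)
      note q = nome_small[OF im]
      define \<rho> where "\<rho> = norm (nome \<tau>)"
      define R where "R = Re (eps (nome \<tau>))"
      have R: "\<bar>R\<bar> \<le> 11" unfolding R_def by (rule eps_le_11[OF im])
      have "0 = Im (phi \<tau>) * (168 * pi)" using root_x[OF elim] by (simp add: \<tau>_def)
      also have "\<dots> = y * (168 * pi) + (c y / \<rho> - 570 + 20256 * (\<rho> * c y) + R)"
        unfolding Im_phi[OF q(1)] scale_168_pi by (simp add: \<rho>_def R_def c_def \<tau>_def)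
      finally have e: "c y / \<rho> = 570 - y * (168 * pi) - 20256 * (\<rho> * c y) - R" by simp
      have "\<bar>\<rho> * c y\<bar> \<le> 1/380 * 1" unfolding abs_mult using q by (intro mult_mono) (auto simp: \<rho>_def c_def)
      moreover have "0 \<le> y * (168 * pi)" using elim by simp
      \<comment> \<open>640 exceeds 570 + 20256/380 + 11.\<close>
      moreover have "\<bar>570 - b - 20256 * a - R\<bar> \<le> b + 640" if "\<bar>a\<bar> \<le> 1/380 * 1" "0 \<le> b" for a b
        using that R by linarith
      ultimately have "\<bar>c y / \<rho>\<bar> \<le> y * (168 * pi) + 640" unfolding e by blast
      hence "\<bar>c y / \<rho>\<bar> \<le> 168 * pi * y + 640" by (simp add: mult_ac)
      hence "\<bar>c y\<bar> \<le> \<rho> * (168 * pi * y + 640)"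
        using q(3) by (simp add: abs_divide \<rho>_def field_simps)
      thus ?case by (simp add: \<rho>_def norm_nome \<tau>_def)
    qed
  qed
  hence "((\<lambda>y. arccos (c y) / (2 * pi)) \<longlongrightarrow> arccos 0 / (2 * pi)) at_top"
    by (intro tendsto_intros isCont_tendsto_compose[OF isCont_arccos]) auto
  moreover have "eventually (\<lambda>y. arccos (c y) / (2 * pi) = root_x y) at_top"
    using eventually_ge_at_top[of "19/20"]
  proof eventually_elim
    case (elim y)
    note r = root_x[OF elim]
    have "arccos (c y) = 2 * pi * root_x y" unfolding c_def
      using r by (intro arccos_cos) (auto simp: field_simps)
    thus ?case by simp
  qed
  ultimately have "(root_x \<longlongrightarrow> arccos 0 / (2 * pi)) at_top" by (rule Lim_transform_eventually)
  thus ?thesis by simp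
qed

section \<open>The graph over the height and the values of phi along it\<close>

definition curve :: "real \<Rightarrow> complex" where
  "curve y = Complex (root_x y) y"

definition curve_val :: "real \<Rightarrow> real" where
  "curve_val y = Re (phi (curve y))"

lemma phi_curve: "y \<ge> 19/20 \<Longrightarrow> phi (curve y) = of_real (curve_val y)"
  using root_x(3)[of y] by (simp add: curve_val_def curve_def complex_eq_iff)

lemma curve_in_strip: "y > 19/20 \<Longrightarrow> curve y \<in> strip"
  using root_x[of y] by (simp add: strip_def curve_def)

lemma continuous_on_curve: "continuous_on {19/20..} curve"
  unfolding curve_def Complex_eq by (intro continuous_intros continuous_on_root_x)

lemma continuous_on_curve_val: "continuous_on {19/20..} curve_val"
proof -
  have "continuous_on (curve ` {19/20..}) phi"
    by (intro continuous_at_imp_continuous_on) (auto simp: curve_def intro!: isCont_phi nome_small)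
  from continuous_on_compose[OF continuous_on_curve this]
  have "continuous_on {19/20..} (\<lambda>y. phi (curve y))" by (simp add: o_def)
  thus ?thesis unfolding curve_val_def by (intro continuous_intros)
qed

lemma filterlim_curve_val: "filterlim curve_val at_top at_top"
proof (rule filterlim_at_top_mono)
  show "filterlim (\<lambda>y::real. y / 336) at_top at_top" by real_asymp
  have "((\<lambda>y. sin (2 * pi * root_x y)) \<longlongrightarrow> sin (2 * pi * (1/4))) at_top"
    by (intro tendsto_intros tendsto_root_x)
  hence "eventually (\<lambda>y. sin (2 * pi * root_x y) > 1/2) at_top"
    by (rule order_tendstoD) simp
  thus "eventually (\<lambda>y. y / 336 \<le> curve_val y) at_top"
    using eventually_ge_at_top[of "19/20"]
  proof eventually_elim
    case (elim y)
    note r = root_x[OF elim(2)]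
    have "exp (2 * pi * y) \<ge> 2 * pi * y" using exp_ge_add_one_self[of "2 * pi * y"] by linarith
    hence "pi * y \<le> 1/2 * exp (2 * pi * y)" by simp
    also have "\<dots> \<le> sin (2 * pi * root_x y) * exp (2 * pi * y)" using elim by (intro mult_right_mono) auto
    also have "\<dots> = sin (2 * pi * Re (curve y)) / norm (nome (curve y))"
      by (simp add: norm_nome curve_def exp_minus field_simps)
    finally have "pi * y / (336 * pi) \<le> sin (2 * pi * Re (curve y)) / norm (nome (curve y)) / (336 * pi)"
      by (intro divide_right_mono) auto
    also have "\<dots> \<le> curve_val y"
      using Re_phi_lower[of "curve y"] r elim(2) by (simp add: curve_val_def curve_def)
    finally show ?case by simp
  qed
qed

text \<open>Injectivity of \<open>phi\<close> on the strip makes \<open>curve_val\<close> injective,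
  hence monotone by continuity; a height y3 far above y2, where the value exceeds that at y1,
  excludes decrease.\<close>

lemma curve_val_strict_mono:
  assumes "19/20 < y1" "y1 < y2" shows "curve_val y1 < curve_val y2"
proof -
  obtain y3 where y3: "y3 > y2" "curve_val y3 > curve_val y1"
  proof -
    have "eventually (\<lambda>y. curve_val y > curve_val y1) at_top"
      using filterlim_curve_val by (simp add: filterlim_at_top_dense)
    moreover have "eventually (\<lambda>y. y > y2) at_top" by (rule eventually_gt_at_top)
    ultimately have "eventually (\<lambda>y. y > y2 \<and> curve_val y > curve_val y1) at_top" by eventually_elim auto
    thus ?thesis using that eventually_happens'[OF trivial_limit_at_top_linorder] by blast
  qed
  have "inj_on curve_val {y1..y3}"
  proof (rule inj_onI)
    fix a b assume ab: "a \<in> {y1..y3}" "b \<in> {y1..y3}" "curve_val a = curve_val b"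
    hence "phi (curve a) = phi (curve b)" using assms by (simp add: phi_curve)
    moreover have "curve a \<in> strip" "curve b \<in> strip" using ab assms by (auto intro: curve_in_strip)
    ultimately have "curve a = curve b" using inj_on_phi_strip by (auto dest: inj_onD)
    thus "a = b" by (simp add: curve_def)
  qed
  moreover have "continuous_on {y1..y3} curve_val"
    using assms by (intro continuous_on_subset[OF continuous_on_curve_val]) auto
  ultimately have "(curve_val y1 < curve_val y2 \<and> curve_val y2 < curve_val y3) \<or>
      (curve_val y3 < curve_val y2 \<and> curve_val y2 < curve_val y1)"
    using assms y3(1) by (intro continuous_inj_imp_mono) auto
  thus ?thesis using y3(2) by linarith
qed

lemma curve_val_surj:
  assumes "19/20 < y0" "curve_val y0 < v"
  obtains y where "y0 < y" "curve_val y = v"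
proof -
  obtain y1 where y1: "y1 > y0" "curve_val y1 > v"
  proof -
    have "eventually (\<lambda>y. curve_val y > v) at_top"
      using filterlim_curve_val by (simp add: filterlim_at_top_dense)
    moreover have "eventually (\<lambda>y. y > y0) at_top" by (rule eventually_gt_at_top)
    ultimately have "eventually (\<lambda>y. y > y0 \<and> curve_val y > v) at_top" by eventually_elim auto
    thus ?thesis using that eventually_happens'[OF trivial_limit_at_top_linorder] by blast
  qed
  have "continuous_on {y0..y1} curve_val"
    using assms by (intro continuous_on_subset[OF continuous_on_curve_val]) auto
  then obtain y where "y0 \<le> y" "y \<le> y1" "curve_val y = v"
    using IVT'[of curve_val y0 v y1] assms y1 by auto
  moreover have "y \<noteq> y0" using assms(2) \<open>curve_val y = v\<close> by auto
  ultimately show ?thesis using that[of y] by simp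
qed

section \<open>Smooth parametrization by the values of phi\<close>

lemma has_vector_derivative_of_real_compose:
  assumes "open U" "H holomorphic_on U" "open T" "of_real ` T \<subseteq> U" "t \<in> T"
    and "\<And>t. t \<in> T \<Longrightarrow> g t = H (of_real t)"
  shows "(g has_vector_derivative deriv H (of_real t)) (at t)"
proof -
  have "of_real t \<in> U" using assms by auto
  hence "(H has_field_derivative deriv H (of_real t)) (at (of_real t))"
    by (rule holomorphic_derivI[OF assms(2,1)])
  hence "((\<lambda>t. H (of_real t)) has_vector_derivative deriv H (of_real t)) (at t)"
    by (rule has_vector_derivative_real_field)
  thus ?thesis
    by (rule has_vector_derivative_transform_within_open[OF _ assms(3,5)]) (use assms(6) in auto)
qed

text \<open>On the real axis every iterated real derivative is the restriction of a complex
  derivative of H, so holomorphy yields all orders.\<close>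

lemma smooth_on_open_of_holomorphic:
  assumes "open U" "H holomorphic_on U" "open T" "of_real ` T \<subseteq> U"
  shows "smooth_on_open T (\<lambda>t. H (of_real t))"
proof -
  have hol: "(deriv ^^ k) H holomorphic_on U" for k
    by (rule holomorphic_higher_deriv[OF assms(2,1)])
  have eq: "((\<lambda>f s. vector_derivative f (at s)) ^^ k) (\<lambda>t. H (of_real t)) t = (deriv ^^ k) H (of_real t)"
    if "t \<in> T" for k t
    using that
  proof (induction k arbitrary: t)
    case (Suc k)
    from has_vector_derivative_of_real_compose[OF assms(1) hol assms(3,4) Suc.prems Suc.IH]
    show ?case by (simp add: vector_derivative_at)
  qed simp
  show ?thesis unfolding smooth_on_open_def
    using has_vector_derivative_of_real_compose[OF assms(1) hol assms(3,4) _ eq]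
    by (meson differentiableI_vector)
qed

text \<open>As y0 lies strictly above 19/20, the endpoint \<open>curve y0\<close> belongs to the
  open strip, so the parametrization extends holomorphically beyond t = 0.\<close>

lemma smooth_curve_above:
  assumes "19/20 < y0"
  shows "smooth_curve_with_ends (curve ` {y0..}) (Point (curve y0)) (Vertical (1/4))"
proof -
  define v0 where "v0 = curve_val y0"
  obtain \<psi> where \<psi>: "\<psi> holomorphic_on (phi ` strip)" "\<And>z. z \<in> strip \<Longrightarrow> \<psi> (phi z) = z"
    using holomorphic_has_inverse[OF holomorphic_phi_strip open_strip inj_on_phi_strip] by metis
  have op: "open (phi ` strip)"
    by (rule open_mapping_thm3[OF holomorphic_phi_strip open_strip inj_on_phi_strip])
  \<comment> \<open>A Moebius map that carries (0,1) increasingly onto (v0, infinity) with its only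
    pole at 1; being holomorphic, it can be composed with \<psi>.\<close>
  define w where "w = (\<lambda>z::complex. of_real v0 + z / (1 - z))"
  define H where "H = (\<lambda>z. \<psi> (w z))"
  define U where "U = - {1} \<inter> w -` (phi ` strip)"
  have wh: "w holomorphic_on - {1}" unfolding w_def by (intro holomorphic_intros) auto
  have opU: "open U" unfolding U_def
    by (rule continuous_open_preimage[OF holomorphic_on_imp_continuous_on[OF wh] _ op]) auto
  have Hh: "H holomorphic_on U" unfolding H_def
    by (rule holomorphic_on_compose_gen[OF holomorphic_on_subset[OF wh] \<psi>(1), unfolded o_def])
       (auto simp: U_def)
  have w_real: "w (of_real t) = of_real (v0 + t / (1 - t))" for t
    by (simp add: w_def)
  define \<gamma> where "\<gamma> = (\<lambda>t. H (of_real t))"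
  have \<psi>_curve: "\<psi> (of_real (curve_val y)) = curve y" if "y > 19/20" for y
    using \<psi>(2)[OF curve_in_strip[OF that]] phi_curve[of y] that by simp
  have point: "\<exists>y>y0. curve_val y = v0 + t / (1 - t) \<and> \<gamma> t = curve y" if t: "t \<in> {0<..<1}" for t
  proof -
    have "v0 < v0 + t / (1 - t)" using t by simp
    then obtain y where y: "y > y0" "curve_val y = v0 + t / (1 - t)"
      unfolding v0_def by (rule curve_val_surj[OF assms]) blast
    have "\<gamma> t = curve y"
      unfolding \<gamma>_def H_def w_real y(2)[symmetric] using y assms by (intro \<psi>_curve) auto
    thus ?thesis using y by blast
  qed
  have in_phi: "of_real (curve_val y) \<in> phi ` strip" if "y > 19/20" for y
    using phi_curve[of y] curve_in_strip[OF that] that by (metis image_eqI less_imp_le)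
  have sub: "of_real ` {0<..<1} \<subseteq> U"
  proof
    fix z :: complex assume "z \<in> of_real ` {0<..<1}"
    then obtain t where t: "z = of_real t" "t \<in> {0<..<1}" by blast
    obtain y where y: "y > y0" "curve_val y = v0 + t / (1 - t)" using point[OF t(2)] by blast
    have "w z \<in> phi ` strip" unfolding t(1) w_real y(2)[symmetric] using y assms by (intro in_phi) auto
    moreover have "z \<noteq> 1" using t by auto
    ultimately show "z \<in> U" by (simp add: U_def)
  qed
  \<comment> \<open>Makes the limit at the lower end a matter of continuity of H at 0.\<close>
  have zero: "0 \<in> U" unfolding U_def using in_phi[OF assms] by (simp add: w_def v0_def)
  show ?thesis unfolding smooth_curve_with_ends_def
  proof (intro exI[of _ \<gamma>] conjI ballI)
    show "curve ` {y0..} - {z. Point z \<in> {Point (curve y0), Vertical (1/4)}} = \<gamma> ` {0<..<1}"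
    proof -
      have "curve ` {y0..} - {z. Point z \<in> {Point (curve y0), Vertical (1/4)}} = curve ` {y0<..}"
        by (auto simp: curve_def image_iff less_le)
      also have "\<dots> = \<gamma> ` {0<..<1}"
      proof (intro equalityI subsetI)
        fix z assume "z \<in> curve ` {y0<..}"
        then obtain y where y: "z = curve y" "y > y0" by auto
        define u where "u = curve_val y - v0"
        have u: "u > 0" unfolding u_def v0_def using curve_val_strict_mono[OF assms y(2)] by simp
        define t where "t = u / (1 + u)"
        have t: "t \<in> {0<..<1}" using u by (simp add: t_def)
        have tu: "t / (1 - t) = u" using u by (simp add: t_def field_simps)
        have "\<gamma> t = curve y" unfolding \<gamma>_def H_def w_real tu
          using \<psi>_curve[of y] y assms by (simp add: u_def)
        thus "z \<in> \<gamma> ` {0<..<1}" using y t by (metis image_eqI)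
      next
        fix z assume "z \<in> \<gamma> ` {0<..<1}"
        thus "z \<in> curve ` {y0<..}" using point by (auto simp: image_iff) (metis greaterThan_iff)
      qed
      finally show ?thesis .
    qed
    show "inj_on \<gamma> {0<..<1}"
    proof (rule inj_onI)
      fix t t' assume t: "t \<in> {0<..<1}" "t' \<in> {0<..<1}" "\<gamma> t = \<gamma> t'"
      obtain y y' where "curve_val y = v0 + t / (1 - t)" "\<gamma> t = curve y"
          "curve_val y' = v0 + t' / (1 - t')" "\<gamma> t' = curve y'" using point t by metis
      hence "t / (1 - t) = t' / (1 - t')" using t(3) by (simp add: curve_def)
      thus "t = t'" using t by (simp add: field_simps)
    qed
    show "smooth_on_open {0<..<1} \<gamma>" unfolding \<gamma>_def
      by (rule smooth_on_open_of_holomorphic[OF opU Hh _ sub]) auto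
    show "vector_derivative \<gamma> (at t) \<noteq> 0" if t: "t \<in> {0<..<1}" for t
    proof
      \<comment> \<open>Then phi o gamma would have derivative 0 at t, but it is v0 + t / (1 - t),
        with derivative 1 / (1 - t)^2.\<close>
      assume z: "vector_derivative \<gamma> (at t) = 0"
      have "(\<gamma> has_vector_derivative deriv H (of_real t)) (at t)"
        unfolding \<gamma>_def by (rule has_vector_derivative_of_real_compose[OF opU Hh _ sub t]) auto
      hence "(\<gamma> has_vector_derivative 0) (at t)" using z by (metis vector_derivative_at)
      moreover have "(phi has_field_derivative phi_deriv (\<gamma> t)) (at (\<gamma> t))"
      proof -
        obtain y where "y > y0" "\<gamma> t = curve y" using point[OF t] by blast
        thus ?thesis using assms by (intro has_field_derivative_phi nome_small) (simp add: curve_def)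
      qed
      ultimately have "((phi \<circ> \<gamma>) has_vector_derivative 0) (at t)"
        using field_vector_diff_chain_at by fastforce
      hence 1: "((\<lambda>t. of_real (v0 + t / (1 - t))) has_vector_derivative (0::complex)) (at t)"
      proof (rule has_vector_derivative_transform_within_open[of _ _ _ "{0<..<1}"])
        fix t :: real assume t: "t \<in> {0<..<1}"
        obtain y where "y > y0" "curve_val y = v0 + t / (1 - t)" "\<gamma> t = curve y" using point[OF t] by blast
        thus "(phi \<circ> \<gamma>) t = of_real (v0 + t / (1 - t))" using assms phi_curve[of y] by simp
      qed (use t in auto)
      have "((\<lambda>t. v0 + t / (1 - t)) has_vector_derivative Re 0) (at t)"
        using bounded_linear.has_vector_derivative[OF bounded_linear_Re 1] by (simp only: Re_complex_of_real)
      moreover have "((\<lambda>t. v0 + t / (1 - t)) has_real_derivative 1 / (1 - t) ^ 2) (at t)"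
        using t by (auto intro!: derivative_eq_intros simp: field_simps power2_eq_square)
      ultimately have "1 / (1 - t) ^ 2 = 0"
        unfolding has_real_derivative_iff_has_vector_derivative
        by (metis vector_derivative_unique_at zero_complex.sel(1))
      thus False using t by simp
    qed
    show "tends_to_end \<gamma> (at_right 0) (Point (curve y0))"
    proof -
      have "isCont H 0"
        using holomorphic_on_imp_continuous_on[OF Hh] opU zero by (simp add: continuous_on_eq_continuous_at)
      moreover have "H 0 = curve y0" using \<psi>_curve[OF assms] by (simp add: H_def w_def v0_def)
      ultimately have "(H \<longlongrightarrow> curve y0) (nhds 0)" by (simp add: isCont_def continuous_at tendsto_nhds_iff)
      moreover have "filterlim (of_real :: real \<Rightarrow> complex) (nhds 0) (at_right 0)"
        using tendsto_of_real[OF tendsto_ident_at, of 0 "{0<..}"] by simp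
      ultimately have "((\<lambda>t. H (of_real t)) \<longlongrightarrow> curve y0) (at_right 0)"
        by (rule filterlim_compose)
      thus ?thesis by (simp add: \<gamma>_def)
    qed
    show "tends_to_end \<gamma> (at_left 1) (Vertical (1/4))"
    proof -
      have ev: "eventually (\<lambda>t::real. t \<in> {0<..<1}) (at_left 1)"
        by (rule eventually_at_leftI[of 0]) auto
      have lim: "filterlim (\<lambda>t. v0 + t / (1 - t)) at_top (at_left (1::real))" by real_asymp
      have im: "filterlim (\<lambda>t. Im (\<gamma> t)) at_top (at_left 1)"
        unfolding filterlim_at_top
      proof
        fix M :: real
        define M' where "M' = max M y0"
        have M': "M' > 19/20" using assms by (auto simp: M'_def)
        have "eventually (\<lambda>t. v0 + t / (1 - t) > curve_val M') (at_left 1)"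
          using lim by (simp add: filterlim_at_top_dense)
        thus "eventually (\<lambda>t. M \<le> Im (\<gamma> t)) (at_left 1)" using ev
        proof eventually_elim
          case (elim t)
          obtain y where y: "y > y0" "curve_val y = v0 + t / (1 - t)" "\<gamma> t = curve y" using point[OF elim(2)] by blast
          have "y > M'"
          proof (rule ccontr)
            assume "\<not> y > M'"
            hence "curve_val y \<le> curve_val M'"
              using curve_val_strict_mono[of y M'] y assms by (cases "y = M'") auto
            thus False using elim y by simp
          qed
          thus ?case using y by (simp add: curve_def M'_def)
        qed
      qed
      have "((\<lambda>t. root_x (Im (\<gamma> t))) \<longlongrightarrow> 1/4) (at_left 1)"
        by (rule filterlim_compose[OF tendsto_root_x im])
      moreover have "eventually (\<lambda>t. root_x (Im (\<gamma> t)) = Re (\<gamma> t)) (at_left 1)"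
        using ev
      proof eventually_elim
        case (elim t)
        then obtain y where "\<gamma> t = curve y" using point by blast
        thus ?case by (simp add: curve_def)
      qed
      ultimately have "((\<lambda>t. Re (\<gamma> t)) \<longlongrightarrow> 1/4) (at_left 1)" by (rule Lim_transform_eventually)
      thus ?thesis using im by simp
    qed
  qed
qed

subsection \<open>The curves and the closure of the transformed critical points\<close>

lemma F_dom_Im_ge:
  assumes "\<tau> \<in> F_dom" shows "Im \<tau> \<ge> sqrt 3 / 2"
proof -
  have F: "0 < Im \<tau>" "0 \<le> Re \<tau>" "Re \<tau> \<le> 1" "1 \<le> norm \<tau>" "1 \<le> norm (\<tau> - 1)"
    using assms by (auto simp: F_dom_def upper_half_plane_def)
  have n: "1 \<le> Re \<tau> ^ 2 + Im \<tau> ^ 2" "1 \<le> (Re \<tau> - 1) ^ 2 + Im \<tau> ^ 2"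
    using power_mono[OF F(4), of 2] power_mono[OF F(5), of 2] by (simp_all add: cmod_power2)
  have "3/4 \<le> Im \<tau> ^ 2"
  proof (cases "Re \<tau> \<le> 1/2")
    case True
    hence "Re \<tau> ^ 2 \<le> (1/2) ^ 2" using F by (intro power_mono) auto
    thus ?thesis using n by (simp add: power2_eq_square)
  next
    case False
    hence "(1 - Re \<tau>) ^ 2 \<le> (1/2) ^ 2" using F by (intro power_mono) auto
    hence "(Re \<tau> - 1) ^ 2 \<le> 1/4" unfolding power2_commute[of 1] by (simp add: power_divide)
    thus ?thesis using n by simp
  qed
  hence "sqrt (3/4) \<le> Im \<tau>" using F by (intro real_le_lsqrt) auto
  thus ?thesis by (simp add: real_sqrt_divide)
qed

lemma F_dom_nome_small: "\<tau> \<in> F_dom \<Longrightarrow> norm (nome \<tau>) < 1/125"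
  using nome_bound_sqrt_3[OF F_dom_Im_ge] by fastforce

text \<open>Below height 19/20 a point outside the unit circle has Re tau >= 1/4, where
  \<open>Im_phi_neg_low\<close> forbids a real value. Above that height the zero of Im phi on the
  line is unique.\<close>

lemma F_dom_left_real_phi:
  assumes "\<tau> \<in> F_dom" "Re \<tau> \<le> 1/2" "Im (phi \<tau>) = 0"
  shows "Im \<tau> \<ge> 19/20" "\<tau> = curve (Im \<tau>)"
proof -
  have F: "0 \<le> Re \<tau>" "1 \<le> norm \<tau>" using assms(1) by (auto simp: F_dom_def)
  have n: "1 \<le> Re \<tau> ^ 2 + Im \<tau> ^ 2"
    using power_mono[OF F(2), of 2] by (simp add: cmod_power2)
  have y: "Im \<tau> \<ge> sqrt 3 / 2" by (rule F_dom_Im_ge[OF assms(1)])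
  show im: "Im \<tau> \<ge> 19/20"
  proof (rule ccontr)
    assume *: "\<not> Im \<tau> \<ge> 19/20"
    have "Im \<tau> \<ge> 0" using y sqrt_3_bounds by linarith
    hence "Im \<tau> ^ 2 \<le> (19/20) ^ 2" using * by (intro power_mono) auto
    hence "(1/4) ^ 2 \<le> Re \<tau> ^ 2" using n by (simp add: power2_eq_square)
    hence "1/4 \<le> Re \<tau>" using F(1) by (rule power2_le_imp_le)
    hence "Im (phi \<tau>) < 0" using * y assms(2) by (intro Im_phi_neg_low) auto
    thus False using assms(3) by simp
  qed
  have "Re \<tau> = root_x (Im \<tau>)" using Im_phi_sign(3)[OF im F(1) assms(2)] assms(3) by simp
  thus "\<tau> = curve (Im \<tau>)" by (simp add: curve_def complex_eq_iff)
qed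

text \<open>For abscissas x < 1/2 the bound at the unit circle implies those at the other two:
  moving the centre to 1 or 1/2 changes the squared modulus by 1 - 2 x > 0 or 1/4 - x >
  -1/4.\<close>

lemma curve_in_C_lt:
  assumes "y \<ge> 19/20" "root_x y ^ 2 + y ^ 2 \<ge> 1"
  shows "curve y \<in> C_lt"
proof -
  note r = root_x[OF assms(1)]
  have n1: "norm (curve y) ^ 2 = root_x y ^ 2 + y ^ 2" by (simp add: cmod_power2 curve_def)
  have n2: "norm (curve y - 1) ^ 2 = root_x y ^ 2 + y ^ 2 + (1 - 2 * root_x y)"
  proof -
    have "curve y - 1 = Complex (root_x y - 1) y" by (simp add: curve_def complex_eq_iff)
    thus ?thesis by (simp add: cmod_power2 power2_diff)
  qed
  have n3: "norm (curve y - 1/2) ^ 2 = root_x y ^ 2 + y ^ 2 + (1/4 - root_x y)"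
  proof -
    have "curve y - 1/2 = Complex (root_x y - 1/2) y" by (simp add: curve_def complex_eq_iff)
    thus ?thesis by (simp add: cmod_power2 power2_diff power_divide)
  qed
  have "1 ^ 2 \<le> norm (curve y) ^ 2" unfolding n1 using assms by simp
  hence a: "1 \<le> norm (curve y)" by (rule power2_le_imp_le) auto
  have "1 ^ 2 \<le> norm (curve y - 1) ^ 2" unfolding n2 using assms r by simp
  hence b: "1 \<le> norm (curve y - 1)" by (rule power2_le_imp_le) auto
  have "(1/2) ^ 2 \<le> norm (curve y - 1/2) ^ 2" unfolding n3 power_divide using assms r by simp
  hence c: "1/2 \<le> norm (curve y - 1/2)" by (rule power2_le_imp_le) auto
  have "curve_val y > 0" unfolding curve_val_def
    using Re_phi_pos[of "curve y"] r assms by (simp add: curve_def)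
  hence "phi (curve y) \<in> of_real ` {0<..}" using phi_curve[OF assms(1)] by auto
  moreover have "0 \<le> Re (curve y)" "Re (curve y) < 1/2" "Re (curve y) \<le> 1" "Im (curve y) > 0"
    using r assms by (auto simp: curve_def)
  ultimately show ?thesis using a b c
    by (simp add: C_lt_def C2_def F0_dom_def F_dom_def upper_half_plane_def)
qed

text \<open>In the left half of F a real value of \<open>phi\<close> forces the point onto the
  graph, where Re tau < 1/2 and phi is positive.\<close>

lemma C_lt_iff: "\<tau> \<in> C_lt \<longleftrightarrow> \<tau> \<in> F_dom \<and> Re \<tau> \<le> 1/2 \<and> Im (phi \<tau>) = 0"
proof
  assume "\<tau> \<in> C_lt"
  thus "\<tau> \<in> F_dom \<and> Re \<tau> \<le> 1/2 \<and> Im (phi \<tau>) = 0" by (auto simp: C_lt_def C2_def)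
next
  assume *: "\<tau> \<in> F_dom \<and> Re \<tau> \<le> 1/2 \<and> Im (phi \<tau>) = 0"
  hence c: "Im \<tau> \<ge> 19/20" "\<tau> = curve (Im \<tau>)" using F_dom_left_real_phi by auto
  have "1 \<le> norm \<tau>" using * by (simp add: F_dom_def)
  hence "1 \<le> Re \<tau> ^ 2 + Im \<tau> ^ 2" using power_mono[of 1 "norm \<tau>" 2] by (simp add: cmod_power2)
  moreover have "Re \<tau> = root_x (Im \<tau>)" using c(2) by (metis complex.sel(1) curve_def)
  ultimately show "\<tau> \<in> C_lt" using curve_in_C_lt[OF c(1)] c(2) by simp
qed

lemma C_lt_eq_curve:
  assumes "19/20 < y0" and "\<And>y. y \<ge> 19/20 \<Longrightarrow> root_x y ^ 2 + y ^ 2 \<ge> 1 \<longleftrightarrow> y \<ge> y0"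
  shows "C_lt = curve ` {y0..}"
proof (intro equalityI subsetI)
  fix \<tau> assume t: "\<tau> \<in> C_lt"
  hence c: "Im \<tau> \<ge> 19/20" "\<tau> = curve (Im \<tau>)" using F_dom_left_real_phi by (auto simp: C_lt_iff)
  have "1 \<le> norm \<tau>" using t by (simp add: C_lt_def F_dom_def)
  hence "1 \<le> Re \<tau> ^ 2 + Im \<tau> ^ 2" using power_mono[of 1 "norm \<tau>" 2] by (simp add: cmod_power2)
  moreover have "Re \<tau> = root_x (Im \<tau>)" using c(2) by (metis complex.sel(1) curve_def)
  ultimately have "Im \<tau> \<ge> y0" using assms(2)[OF c(1)] by simp
  thus "\<tau> \<in> curve ` {y0..}" using c(2) by auto
next
  fix \<tau> assume "\<tau> \<in> curve ` {y0..}"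
  then obtain y where "\<tau> = curve y" "y \<ge> y0" by auto
  thus "\<tau> \<in> C_lt" using assms by (auto intro!: curve_in_C_lt)
qed

section \<open>Reflection in the line Re tau = 1/2\<close>

definition refl_half :: "complex \<Rightarrow> complex" where
  "refl_half \<tau> = 1 - cnj \<tau>"

lemma refl_half_simps [simp]:
  "refl_half (refl_half \<tau>) = \<tau>" "Re (refl_half \<tau>) = 1 - Re \<tau>" "Im (refl_half \<tau>) = Im \<tau>"
  "dist (refl_half a) (refl_half b) = dist a b"
proof -
  have "refl_half a - refl_half b = cnj (b - a)" by (simp add: refl_half_def)
  hence "norm (refl_half a - refl_half b) = norm (b - a)" by (simp only: complex_mod_cnj)
  thus "dist (refl_half a) (refl_half b) = dist a b" by (simp add: dist_norm norm_minus_commute)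
qed (simp_all add: refl_half_def)

lemma refl_half_F_dom: "refl_half \<tau> \<in> F_dom \<longleftrightarrow> \<tau> \<in> F_dom"
proof -
  have "norm (refl_half \<tau>) = norm (\<tau> - 1)" "norm (refl_half \<tau> - 1) = norm \<tau>"
  proof -
    have r: "refl_half 1 = 0" "refl_half 0 = 1" by (simp_all add: refl_half_def)
    show "norm (refl_half \<tau>) = norm (\<tau> - 1)" "norm (refl_half \<tau> - 1) = norm \<tau>"
      using refl_half_simps(4)[of \<tau> 1] refl_half_simps(4)[of \<tau> 0] unfolding r dist_norm by simp_all
  qed
  thus ?thesis by (auto simp: F_dom_def upper_half_plane_def)
qed

lemma phi_refl_half: "\<tau> \<in> F_dom \<Longrightarrow> phi (refl_half \<tau>) = refl_half (phi \<tau>)"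
  unfolding refl_half_def by (rule phi_reflection[OF F_dom_nome_small])

text \<open>The reflection commutes with \<open>phi\<close> on F, preserves F, and exchanges its two
  halves as well as the rays (0, infinity) and (-infinity, 1).\<close>

lemma C_gt_iff: "\<tau> \<in> C_gt \<longleftrightarrow> refl_half \<tau> \<in> C_lt"
proof -
  have norm0: "norm (refl_half \<tau> - 1/2) = norm (\<tau> - 1/2)"
  proof -
    have r: "refl_half (1/2) = 1/2" by (simp add: refl_half_def complex_eq_iff)
    show ?thesis using refl_half_simps(4)[of \<tau> "1/2"] unfolding r dist_norm .
  qed
  have "refl_half z \<in> of_real ` {0<..} \<longleftrightarrow> z \<in> of_real ` {..<1}" for z
  proof
    assume "refl_half z \<in> of_real ` {0<..}"
    then obtain r where "refl_half z = of_real r" "r > 0" by auto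
    have "z = refl_half (refl_half z)" by simp
    also have "\<dots> = of_real (1 - r)" unfolding \<open>refl_half z = of_real r\<close> by (simp add: refl_half_def)
    finally show "z \<in> of_real ` {..<1}" using \<open>r > 0\<close> by (intro image_eqI[of _ _ "1 - r"]) auto
  next
    assume "z \<in> of_real ` {..<1}"
    then obtain r where "z = of_real r" "r < 1" by auto
    hence "refl_half z = of_real (1 - r)" by (simp add: refl_half_def)
    thus "refl_half z \<in> of_real ` {0<..}" using \<open>r < 1\<close> by (intro image_eqI[of _ _ "1 - r"]) auto
  qed
  hence phi: "phi (refl_half \<tau>) \<in> of_real ` {0<..} \<longleftrightarrow> phi \<tau> \<in> of_real ` {..<1}" if "\<tau> \<in> F_dom"
    unfolding phi_refl_half[OF that] .
  have F0: "refl_half \<tau> \<in> F0_dom \<longleftrightarrow> \<tau> \<in> F0_dom"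
    using norm0 by (auto simp: F0_dom_def upper_half_plane_def)
  have Re: "Re (refl_half \<tau>) < 1/2 \<longleftrightarrow> Re \<tau> > 1/2" by auto
  show ?thesis
    unfolding C_gt_def C_lt_def C2_def C3_def Int_iff mem_Collect_eq refl_half_F_dom F0 Re
    using phi by blast
qed

lemma C_gt_eq: "C_gt = refl_half ` C_lt"
proof (intro equalityI subsetI)
  fix \<tau> assume "\<tau> \<in> C_gt"
  hence "refl_half \<tau> \<in> C_lt" by (simp only: C_gt_iff)
  thus "\<tau> \<in> refl_half ` C_lt" by (intro image_eqI[of _ _ "refl_half \<tau>"]) auto
qed (auto simp: C_gt_iff)

text \<open>Describes the union by a single closed condition on F, the form used for the
  closure.\<close>

lemma real_phi_set: "C_lt \<union> C_gt = {\<tau> \<in> F_dom. Im (phi \<tau>) = 0}"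
proof (intro set_eqI)
  fix \<tau>
  have "\<tau> \<in> C_gt \<longleftrightarrow> \<tau> \<in> F_dom \<and> Re \<tau> \<ge> 1/2 \<and> Im (phi \<tau>) = 0"
    unfolding C_gt_iff C_lt_iff using refl_half_F_dom[of \<tau>] phi_refl_half[of \<tau>] by auto
  thus "\<tau> \<in> C_lt \<union> C_gt \<longleftrightarrow> \<tau> \<in> {\<tau> \<in> F_dom. Im (phi \<tau>) = 0}"
    using C_lt_iff[of \<tau>] by auto
qed

text \<open>From the first derivative on, the constant 1 of the reflection is gone and every
  derivative of the reflected curve is minus the conjugate of the original one; hence the induction
  over \<open>Suc k\<close>.\<close>

lemma smooth_curve_refl_half:
  assumes "smooth_curve_with_ends C (Point p) (Vertical a)"
  shows "smooth_curve_with_ends (refl_half ` C) (Point (refl_half p)) (Vertical (1 - a))"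
proof -
  let ?D = "\<lambda>(f :: real \<Rightarrow> complex) s. vector_derivative f (at s)"
  obtain \<gamma> where \<gamma>: "C - {z. Point z \<in> {Point p, Vertical a}} = \<gamma> ` {0<..<1}" "inj_on \<gamma> {0<..<1}"
    "smooth_on_open {0<..<1} \<gamma>" "\<forall>t\<in>{0<..<1}. vector_derivative \<gamma> (at t) \<noteq> 0"
    "tends_to_end \<gamma> (at_right 0) (Point p)" "tends_to_end \<gamma> (at_left 1) (Vertical a)"
    using assms unfolding smooth_curve_with_ends_def by blast
  define \<delta> where "\<delta> = (\<lambda>t. refl_half (\<gamma> t))"
  have inj: "inj refl_half" by (rule injI) (metis refl_half_simps(1))
  have hd: "((?D ^^ k) \<gamma> has_vector_derivative (?D ^^ Suc k) \<gamma> t) (at t)" if "t \<in> {0<..<1}" for k t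
    using \<gamma>(3) that unfolding smooth_on_open_def by (simp add: vector_derivative_works)
  have d0: "(\<delta> has_vector_derivative - cnj ((?D ^^ Suc 0) \<gamma> t)) (at t)" if "t \<in> {0<..<1}" for t
  proof -
    have "((\<lambda>t. 1 - cnj (\<gamma> t)) has_vector_derivative 0 - cnj ((?D ^^ Suc 0) \<gamma> t)) (at t)"
      using hd[OF that, of 0]
      by (intro has_vector_derivative_diff has_vector_derivative_const
            bounded_linear.has_vector_derivative[OF bounded_linear_cnj]) simp
    thus ?thesis by (simp add: \<delta>_def refl_half_def)
  qed
  have eq: "(?D ^^ Suc k) \<delta> t = - cnj ((?D ^^ Suc k) \<gamma> t)" if "t \<in> {0<..<1}" for k t
    using that
  proof (induction k arbitrary: t)
    case 0 thus ?case using vector_derivative_at[OF d0] by simp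
  next
    case (Suc k)
    have "((\<lambda>t. - cnj ((?D ^^ Suc k) \<gamma> t)) has_vector_derivative - cnj ((?D ^^ Suc (Suc k)) \<gamma> t)) (at t)"
      by (intro has_vector_derivative_minus bounded_linear.has_vector_derivative[OF bounded_linear_cnj] hd Suc.prems)
    hence "((?D ^^ Suc k) \<delta> has_vector_derivative - cnj ((?D ^^ Suc (Suc k)) \<gamma> t)) (at t)"
      by (rule has_vector_derivative_transform_within_open[of _ _ _ "{0<..<1}"]) (use Suc in auto)
    thus ?case by (simp add: vector_derivative_at)
  qed
  have diff: "(?D ^^ k) \<delta> differentiable (at t)" if t: "t \<in> {0<..<1}" for k t
  proof (cases k)
    case 0 thus ?thesis using d0[OF t] by (auto intro: differentiableI_vector)
  next
    case (Suc j)
    have "((\<lambda>t. - cnj ((?D ^^ Suc j) \<gamma> t)) has_vector_derivative - cnj ((?D ^^ Suc (Suc j)) \<gamma> t)) (at t)"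
      by (intro has_vector_derivative_minus bounded_linear.has_vector_derivative[OF bounded_linear_cnj] hd t)
    hence "((?D ^^ Suc j) \<delta> has_vector_derivative - cnj ((?D ^^ Suc (Suc j)) \<gamma> t)) (at t)"
      by (rule has_vector_derivative_transform_within_open[of _ _ _ "{0<..<1}"]) (use t eq in auto)
    thus ?thesis unfolding Suc by (rule differentiableI_vector)
  qed
  show ?thesis unfolding smooth_curve_with_ends_def
  proof (intro exI[of _ \<delta>] conjI ballI)
    show "refl_half ` C - {z. Point z \<in> {Point (refl_half p), Vertical (1 - a)}} = \<delta> ` {0<..<1}"
    proof -
      have "refl_half ` (C - {z. Point z \<in> {Point p, Vertical a}}) = refl_half ` C - {refl_half p}"
        using image_set_diff[OF inj, of C "{p}"] by simp
      thus ?thesis unfolding \<gamma>(1) by (simp add: \<delta>_def image_image)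
    qed
    show "inj_on \<delta> {0<..<1}"
      using comp_inj_on[OF \<gamma>(2) inj_on_subset[OF inj]] by (simp add: \<delta>_def o_def)
    show "smooth_on_open {0<..<1} \<delta>" unfolding smooth_on_open_def using diff by blast
    show "vector_derivative \<delta> (at t) \<noteq> 0" if "t \<in> {0<..<1}" for t
      using eq[OF that, of 0] \<gamma>(4) that by simp
    show "tends_to_end \<delta> (at_right 0) (Point (refl_half p))"
      using \<gamma>(5) unfolding \<delta>_def refl_half_def by (auto intro!: tendsto_intros)
    show "tends_to_end \<delta> (at_left 1) (Vertical (1 - a))"
      using \<gamma>(6) unfolding \<delta>_def by (auto intro!: tendsto_intros)
  qed
qed

text \<open>Any step along the radius towards 0 makes the modulus smaller than 1 and leaves
  F.\<close>

lemma frontier_F_dom_left: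
  assumes "\<tau> \<in> F_dom" "norm \<tau> = 1" shows "\<tau> \<in> frontier F_dom"
proof -
  have "\<tau> \<notin> interior F_dom"
  proof
    assume "\<tau> \<in> interior F_dom"
    then obtain e where e: "e > 0" "ball \<tau> e \<subseteq> F_dom" by (auto simp: mem_interior)
    define k where "k = min 1 (e / 2)"
    have k: "0 < k" "k \<le> 1" "k < e" using e(1) by (auto simp: k_def)
    define z where "z = of_real (1 - k) * \<tau>"
    have "dist \<tau> z = norm (of_real k * \<tau>)" by (simp add: dist_norm z_def algebra_simps)
    hence "z \<in> ball \<tau> e" using k assms(2) by (simp add: norm_mult)
    hence "norm z \<ge> 1" using e(2) by (auto simp: F_dom_def)
    moreover have "norm z = \<bar>1 - k\<bar>" unfolding z_def norm_mult norm_of_real assms(2) by simp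
    ultimately show False using k by simp
  qed
  thus ?thesis using assms(1) closure_subset by (auto simp: frontier_def)
qed

lemma frontier_F_dom_refl_half:
  assumes "\<tau> \<in> frontier F_dom" shows "refl_half \<tau> \<in> frontier F_dom"
proof -
  have "(\<exists>x\<in>F_dom. dist (refl_half \<tau>) x < e) \<and> (\<exists>x. x \<notin> F_dom \<and> dist (refl_half \<tau>) x < e)" if "e > 0" for e
  proof -
    obtain x y where "x \<in> F_dom" "dist \<tau> x < e" "y \<notin> F_dom" "dist \<tau> y < e"
      using assms \<open>e > 0\<close> unfolding frontier_straddle by blast
    thus ?thesis using refl_half_F_dom refl_half_simps(4) by metis
  qed
  thus ?thesis unfolding frontier_straddle by blast
qed

section \<open>Rational values of phi and closures\<close>

lemma D_set_eq: "D_set = {\<tau> \<in> F_dom. phi \<tau> \<in> \<rat>}"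
proof -
  have "D_set \<subseteq> F_dom" by (auto simp: D_set_def)
  thus ?thesis using D_set_iff E6_deriv_nonzero F_dom_nome_small by blast
qed

lemma Im_Rats: "z \<in> \<rat> \<Longrightarrow> Im z = 0"
  by (auto elim!: Rats_cases' simp: Im_divide)

lemma D_set_subset: "D_set \<subseteq> C_lt \<union> C_gt"
  unfolding D_set_eq real_phi_set by (auto intro: Im_Rats)

text \<open>F is closed in the plane because Im tau > 0 can be sharpened to Im tau >= sqrt 3 / 2 on
  it; the locus is then a closed preimage of 0.\<close>

lemma closed_real_phi_set: "closed (C_lt \<union> C_gt)"
proof -
  have "F_dom = {\<tau>. Im \<tau> \<ge> sqrt 3 / 2} \<inter> {\<tau>. Re \<tau> \<ge> 0} \<inter> {\<tau>. Re \<tau> \<le> 1} \<inter> {\<tau>. 1 \<le> norm \<tau>} \<inter> {\<tau>. 1 \<le> norm (\<tau> - 1)}"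
    using F_dom_Im_ge sqrt_3_bounds by (auto simp: F_dom_def upper_half_plane_def)
  also have "closed \<dots>"
    by (intro closed_Int closed_halfspace_Im_ge closed_halfspace_Re_ge closed_halfspace_Re_le
          closed_Collect_le continuous_intros)
  finally have "closed F_dom" .
  moreover have "continuous_on F_dom (\<lambda>\<tau>. Im (phi \<tau>))"
    using isCont_phi[OF F_dom_nome_small]
    by (intro continuous_intros continuous_at_imp_continuous_on) auto
  ultimately have "closed (F_dom \<inter> (\<lambda>\<tau>. Im (phi \<tau>)) -` {0})"
    by (intro continuous_closed_preimage) auto
  also have "F_dom \<inter> (\<lambda>\<tau>. Im (phi \<tau>)) -` {0} = C_lt \<union> C_gt" unfolding real_phi_set by auto
  finally show ?thesis .
qed

text \<open>Along the graph the value of \<open>phi\<close> is continuous and strictly increasing,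
  so on any short arc it takes a rational value.\<close>

lemma C_lt_subset_closure: "C_lt \<subseteq> closure D_set"
proof
  fix \<tau> assume t: "\<tau> \<in> C_lt"
  obtain y0 where y0: "19/20 < y0" "C_lt = curve ` {y0..}"
    using threshold_height C_lt_eq_curve by metis
  obtain y1 where y1: "\<tau> = curve y1" "y1 \<ge> y0" using t y0 by auto
  show "\<tau> \<in> closure D_set" unfolding closure_approachable
  proof safe
    fix e :: real assume e: "e > 0"
    have "y1 \<in> {19/20..}" using y1 y0 by simp
    then obtain d where d: "d > 0" "\<And>y. y \<in> {19/20..} \<Longrightarrow> dist y y1 < d \<Longrightarrow> dist (curve y) (curve y1) < e"
      using continuous_on_curve e unfolding continuous_on_iff by metis
    \<comment> \<open>Only larger heights are tried, so the approximating points stay in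
      \<open>C_lt\<close> even when tau is its endpoint.\<close>
    define y2 where "y2 = y1 + d / 2"
    have y2: "y1 < y2" using d by (simp add: y2_def)
    have "curve_val y1 < curve_val y2" using y1 y0 y2 by (intro curve_val_strict_mono) auto
    then obtain r where r: "curve_val y1 < of_rat r" "of_rat r < curve_val y2"
      using of_rat_dense by blast
    have "continuous_on {y1..y2} curve_val"
      using y1 y0 by (intro continuous_on_subset[OF continuous_on_curve_val]) auto
    then obtain y where y: "y1 \<le> y" "y \<le> y2" "curve_val y = of_rat r"
      using IVT'[of curve_val y1 "of_rat r" y2] r y2 by auto
    obtain a b where "r = of_int a / of_int b" by (metis quotient_of_div prod.exhaust)
    hence "phi (curve y) = of_int a / of_int b" using phi_curve[of y] y y1 y0 by (simp add: of_rat_divide)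
    hence "phi (curve y) \<in> \<rat>" by simp
    moreover have "curve y \<in> C_lt" using y0 y1 y by auto
    ultimately have "curve y \<in> D_set" unfolding D_set_eq by (auto simp: C_lt_def)
    moreover have "dist (curve y) \<tau> < e"
      unfolding y1(1) using y y1 y0 d(1) by (intro d(2)) (auto simp: dist_real_def y2_def)
    ultimately show "\<exists>x\<in>D_set. dist x \<tau> < e" by blast
  qed
qed

lemma refl_half_D_set: "\<tau> \<in> D_set \<Longrightarrow> refl_half \<tau> \<in> D_set"
proof -
  assume "\<tau> \<in> D_set"
  hence t: "\<tau> \<in> F_dom" "phi \<tau> \<in> \<rat>" by (auto simp: D_set_eq)
  have "cnj (phi \<tau>) = phi \<tau>" using Im_Rats[OF t(2)] by (simp add: complex_eq_iff)
  hence "phi (refl_half \<tau>) = 1 - phi \<tau>" unfolding phi_refl_half[OF t(1)] by (simp add: refl_half_def)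
  thus ?thesis using t by (simp add: D_set_eq refl_half_F_dom)
qed

lemma closure_D_set: "closure D_set = C_lt \<union> C_gt"
proof
  show "closure D_set \<subseteq> C_lt \<union> C_gt"
    by (rule closure_minimal[OF D_set_subset closed_real_phi_set])
  have "C_gt \<subseteq> closure D_set"
  proof
    fix \<tau> assume "\<tau> \<in> C_gt"
    hence *: "refl_half \<tau> \<in> closure D_set" using C_gt_iff C_lt_subset_closure by blast
    show "\<tau> \<in> closure D_set" unfolding closure_approachable
    proof safe
      fix e :: real assume "e > 0"
      then obtain x where "x \<in> D_set" "dist x (refl_half \<tau>) < e" using * unfolding closure_approachable by blast
      thus "\<exists>x\<in>D_set. dist x \<tau> < e" using refl_half_D_set refl_half_simps(1,4) by metis
    qed
  qed
  thus "C_lt \<union> C_gt \<subseteq> closure D_set" using C_lt_subset_closure by blast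
qed

text \<open>At finite points the compactification has the topology of the closed half-plane, which
  is itself closed in the plane; so the two closures can differ in infinity only.\<close>

lemma closure_H_finite_part:
  assumes "A \<subseteq> {\<tau>. Im \<tau> \<ge> 0}"
  shows "closure_H A - {None} = Some ` closure A"
proof -
  let ?X = "top_of_set {\<tau>. Im \<tau> \<ge> 0}"
  have sub: "closure A \<subseteq> {\<tau>. Im \<tau> \<ge> 0}"
    using assms by (rule closure_minimal) (rule closed_halfspace_Im_ge)
  have "Some x \<in> closure_H A \<longleftrightarrow> x \<in> closure A" for x
  proof
    assume x: "Some x \<in> closure_H A"
    hence im: "Im x \<ge> 0"
      unfolding closure_H_def closed_half_plane_compact_def by (auto simp: in_closure_of)
    show "x \<in> closure A" unfolding closure_approachable
    proof safe
      fix e :: real assume "e > 0"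
      have "openin ?X ({\<tau>. Im \<tau> \<ge> 0} \<inter> ball x e)" by (intro openin_open_Int) auto
      hence "openin (Alexandroff_compactification ?X) (Some ` ({\<tau>. Im \<tau> \<ge> 0} \<inter> ball x e))" by simp
      moreover have "Some x \<in> Some ` ({\<tau>. Im \<tau> \<ge> 0} \<inter> ball x e)" using im \<open>e > 0\<close> by auto
      moreover have "\<exists>z. z \<in> Some ` A \<and> z \<in> T"
        if "openin (Alexandroff_compactification ?X) T" "Some x \<in> T" for T
        using x that unfolding closure_H_def closed_half_plane_compact_def in_closure_of by simp
      ultimately obtain z where "z \<in> Some ` A" "z \<in> Some ` ({\<tau>. Im \<tau> \<ge> 0} \<inter> ball x e)"
        by metis
      thus "\<exists>y\<in>A. dist y x < e" by (auto simp: dist_commute)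
    qed
  next
    assume x: "x \<in> closure A"
    hence im: "Im x \<ge> 0" using sub by auto
    show "Some x \<in> closure_H A"
      unfolding closure_H_def closed_half_plane_compact_def in_closure_of
    proof (intro conjI allI impI)
      show "Some x \<in> topspace (Alexandroff_compactification ?X)" using im by simp
      fix T assume T: "Some x \<in> T \<and> openin (Alexandroff_compactification ?X) T"
      have "openin ?X {y \<in> topspace ?X. Some y \<in> T}"
        by (rule openin_continuous_map_preimage[OF continuous_map_Some]) (use T in auto)
      then obtain V where V: "open V" "{y \<in> topspace ?X. Some y \<in> T} = {\<tau>. Im \<tau> \<ge> 0} \<inter> V"
        unfolding openin_open by blast
      have "x \<in> V" using V(2) T im by auto
      then obtain y where "y \<in> A" "y \<in> V" using x V(1) unfolding closure_iff_nhds_not_empty by blast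
      hence "y \<in> {y \<in> topspace ?X. Some y \<in> T}" unfolding V(2) using assms by auto
      thus "\<exists>y. y \<in> Some ` A \<and> y \<in> T" using \<open>y \<in> A\<close> by auto
    qed
  qed
  thus ?thesis by (auto simp: image_iff) (metis option.exhaust)
qed

theorem theorem1p8:
  shows "(\<exists>\<tau>\<^sub>1\<in>frontier F_dom. smooth_curve_with_ends C_lt (Point \<tau>\<^sub>1) (Vertical (1 / 4)))
    \<and> (\<exists>\<tau>\<^sub>2\<in>frontier F_dom. smooth_curve_with_ends C_gt (Point \<tau>\<^sub>2) (Vertical (3 / 4)))
    \<and> D_set \<subseteq> C_lt \<union> C_gt
    \<and> Some ` (C_lt \<union> C_gt) = closure_H D_set \<inter> Some ` F_dom
    \<and> closure_H D_set \<inter> Some ` F_dom = closure_H D_set - {None}"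
proof -
  obtain y0 where y0: "19/20 < y0" "root_x y0 ^ 2 + y0 ^ 2 = 1"
      "\<And>y. y \<ge> 19/20 \<Longrightarrow> root_x y ^ 2 + y ^ 2 \<ge> 1 \<longleftrightarrow> y \<ge> y0"
    using threshold_height by metis
  have C: "C_lt = curve ` {y0..}" by (rule C_lt_eq_curve[OF y0(1,3)])
  have "curve y0 \<in> F_dom" using C by (auto simp: C_lt_def)
  moreover have "norm (curve y0) = 1"
    using y0(2) by (simp add: curve_def complex_norm)
  ultimately have fr: "curve y0 \<in> frontier F_dom" by (rule frontier_F_dom_left)
  have sm: "smooth_curve_with_ends C_lt (Point (curve y0)) (Vertical (1/4))"
    unfolding C by (rule smooth_curve_above[OF y0(1)])
  have sm': "smooth_curve_with_ends C_gt (Point (refl_half (curve y0))) (Vertical (3/4))"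
    using smooth_curve_refl_half[OF sm] unfolding C_gt_eq by simp
  have fin: "closure_H D_set - {None} = Some ` (C_lt \<union> C_gt)"
    unfolding closure_D_set[symmetric]
    by (rule closure_H_finite_part) (auto simp: D_set_def F_dom_def upper_half_plane_def)
  \<comment> \<open>Infinity is \<open>None\<close>, which is no \<open>Some\<close> value, and all
    finite points of the closure already lie in F; so meeting with F and deleting infinity give the
    same set.\<close>
  have "closure_H D_set \<inter> Some ` F_dom = (closure_H D_set - {None}) \<inter> Some ` F_dom" by auto
  also have "\<dots> = Some ` (C_lt \<union> C_gt)" unfolding fin real_phi_set by auto
  finally have int: "closure_H D_set \<inter> Some ` F_dom = Some ` (C_lt \<union> C_gt)" .
  show ?thesis
    using sm sm' fr frontier_F_dom_refl_half[OF fr] D_set_subset fin int by blast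
qed

end
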